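(* Let $p\ge1$, let $X\in\mathbb R^p$ have density $f(\|x-\theta\|)$, and consider estimating $\theta\in\mathbb R^p$ under the loss $L_Q(\theta,\delta)=(\delta-\theta)'Q(\delta-\theta)$ with $Q$ positive definite. Let $n$ be a nonnegative integer, let $c$ be such that $\mathrm{Log}_n(c)>0$, and let $G(\eta)=\eta^{2-p}\prod_{i=0}^n\mathrm{Log}_i(\eta+c)$. Assume that (F1) there exist $r_0>0$, $L>0$ and $s>3$ such that $r^{p+s}f(r)\le L$ for all $r\ge r_0$; (FG1) $\int_0^\infty r^{p-1}f(r)G(r)dr<\infty$ and $\int_0^\infty r^{p-2}F(r)G(r)dr<\infty$, where $F(u)=\int_u^\infty rf(r)dr$. Then the generalized Bayes estimator with respect to the prior $g(\theta)=G(\|\theta\|_d)=\|\theta\|_d^{2-p}\prod_{i=0}^n\mathrm{Log}_i(\|\theta\|_d+c)$ is admissible.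
   Context: $\|x\|$ is the Euclidean norm and $\|x\|_d^2=d_1^2x_1^2+\cdots+d_p^2x_p^2$ for fixed constants $d_1\ge\cdots\ge d_p\ge1$. $\mathrm{Log}_0\equiv1$ and, for $i\ge1$, $\mathrm{Log}_i(u)=\log\log\cdots\log u$ ($i$-fold iterated logarithm). The generalized Bayes estimator is $\delta_g(x)=\int_{\mathbb R^p}\theta f(\|x-\theta\|)g(\theta)d\theta\big/\int_{\mathbb R^p}f(\|x-\theta\|)g(\theta)d\theta$. An estimator $\delta$ is admissible if no estimator $\delta'$ satisfies $R(\theta,\delta')\le R(\theta,\delta)$ for all $\theta$ with strict inequality for some $\theta$, where $R(\theta,\delta)=E_\theta[L_Q(\theta,\delta(X))]$. *)

theory Defs
  imports "HOL-Probability.Probability"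
begin

(* Log_0 is the constant 1, not the identity, and for i >= 1 it is the i-fold iterated logarithm. *)
definition iLog :: "nat \<Rightarrow> real \<Rightarrow> real" where
  "iLog i u = (if i = 0 then 1 else (ln ^^ i) u)"

(* ln is total in HOL, with ln (- x) = ln x and ln 0 = 0. This predicate says that Log_i u makes
   sense mathematically: each logarithm is applied to a positive number. It holds trivially
   for i = 0. *)
definition iLog_defined :: "nat \<Rightarrow> real \<Rightarrow> bool" where
  "iLog_defined i u \<longleftrightarrow> (\<forall>j<i. 0 < (ln ^^ j) u)"

(* The profile G of the prior. For p > 2, HOL gives 0 powi (2 - p) = 0, so G 0 is a dummy value; G is
   only ever integrated, so this single point does not matter. *)
definition prior_profile :: "nat \<Rightarrow> nat \<Rightarrow> real \<Rightarrow> real \<Rightarrow> real" where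
  "prior_profile p n c \<eta> = \<eta> powi (2 - int p) * (\<Prod>i=0..n. iLog i (\<eta> + c))"

definition weighted_norm :: "real^'p \<Rightarrow> real^'p \<Rightarrow> real" where
  "weighted_norm d x = sqrt (\<Sum>i\<in>UNIV. (d $ i)\<^sup>2 * (x $ i)\<^sup>2)"

definition pos_def_matrix :: "real^'p^'p \<Rightarrow> bool" where
  "pos_def_matrix Q \<longleftrightarrow> transpose Q = Q \<and> (\<forall>x. x \<noteq> 0 \<longrightarrow> 0 < x \<bullet> (Q *v x))"

definition quad_loss :: "real^'p^'p \<Rightarrow> real^'p \<Rightarrow> real^'p \<Rightarrow> real" where
  "quad_loss Q \<theta> a = (a - \<theta>) \<bullet> (Q *v (a - \<theta>))"

(* The law of X when the location parameter is \<theta>. *)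
definition sampling :: "(real \<Rightarrow> real) \<Rightarrow> real^'p \<Rightarrow> (real^'p) measure" where
  "sampling f \<theta> = density lborel (\<lambda>x. ennreal (f (norm (x - \<theta>))))"

(* f (norm (x - \<theta>)) is a probability density for every \<theta>. Only the values of f on
   [0, \<infinity>) matter. *)
definition location_density :: "'p::finite itself \<Rightarrow> (real \<Rightarrow> real) \<Rightarrow> bool" where
  "location_density _ f \<longleftrightarrow>
     (\<forall>r\<ge>0. 0 \<le> f r) \<and>
     (\<forall>\<theta>::real^'p. (\<lambda>x. f (norm (x - \<theta>))) \<in> borel_measurable borel \<and> prob_space (sampling f \<theta>))"

(* Extended-valued, so that an estimator may have infinite risk. *)
definition risk :: "(real \<Rightarrow> real) \<Rightarrow> real^'p^'p \<Rightarrow> real^'p \<Rightarrow> (real^'p \<Rightarrow> real^'p) \<Rightarrow> ennreal" where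
  "risk f Q \<theta> \<delta> = (\<integral>\<^sup>+ x. ennreal (quad_loss Q \<theta> (\<delta> x)) \<partial>sampling f \<theta>)"

(* An estimator is a Borel measurable map from observations to parameter values. *)
definition admissible :: "(real \<Rightarrow> real) \<Rightarrow> real^'p^'p \<Rightarrow> (real^'p \<Rightarrow> real^'p) \<Rightarrow> bool" where
  "admissible f Q \<delta> \<longleftrightarrow>
     \<delta> \<in> borel_measurable borel \<and>
     \<not> (\<exists>\<delta>'\<in>borel_measurable borel.
          (\<forall>\<theta>. risk f Q \<theta> \<delta>' \<le> risk f Q \<theta> \<delta>) \<and> (\<exists>\<theta>. risk f Q \<theta> \<delta>' < risk f Q \<theta> \<delta>))"

definition gen_bayes :: "(real \<Rightarrow> real) \<Rightarrow> (real^'p \<Rightarrow> real) \<Rightarrow> real^'p \<Rightarrow> real^'p" where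
  "gen_bayes f g x =
     (LINT \<theta>|lborel. (f (norm (x - \<theta>)) * g \<theta>) *\<^sub>R \<theta>) /\<^sub>R (LINT \<theta>|lborel. f (norm (x - \<theta>)) * g \<theta>)"

(* F(u); the integrand is nonnegative for u >= 0, so the integral is taken in [0, \<infinity>]. *)
definition tail_fun :: "(real \<Rightarrow> real) \<Rightarrow> real \<Rightarrow> ennreal" where
  "tail_fun f u = (\<integral>\<^sup>+ r\<in>{u<..}. ennreal (r * f r) \<partial>lborel)"

end

theory Submission
  imports Defs
begin

text \<open>The proof is Blyth's method with the priors \<open>g h\<^sub>i\<^sup>2\<close>, where
  \<open>h\<^sub>i = max w (1 - v / (i + 1))\<close>. With all logarithms shifted so as to be at least 1 on
  \<open>[0, \<infinity>)\<close>, \<open>v\<close> is the iterated logarithm \<open>Log\<^bsub>n+2\<^esub>\<close> and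
  \<open>w = v' = 1 / (r Log\<^sub>1 r \<dots> Log\<^bsub>n+1\<^esub> r)\<close>, so that \<open>\<integral> g w\<^sup>2\<close> is finite, being dominated by
  the integral of \<open>(- 1 / Log\<^bsub>n+1\<^esub>)'\<close>. Each \<open>h\<^sub>i\<close> lies between \<open>w\<close> and 1, is Lipschitz with local
  constant of order \<open>w\<close>, agrees with \<open>w\<close> far out (hence \<open>g h\<^sub>i\<^sup>2\<close> has finite mass), and tends to 1.
  For large \<open>x\<close> the excess risk density \<open>|\<delta>\<^sub>g - \<delta>\<^sub>i|\<^sup>2 m\<^sub>i\<close> at \<open>x\<close> is of order
  \<open>g w\<^sup>2 + |x| powr (- p - \<epsilon>)\<close>, the second term coming from parameters at distance more than
  \<open>|x| / 2\<close> from \<open>x\<close>; for bounded \<open>x\<close> it is at most the posterior second moment. As this bound is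
  integrable and does not depend on \<open>i\<close>, dominated convergence applies.\<close>

section \<open>Radial integrals\<close>

text \<open>The radial density of the prior is \<open>r * l r\<close>, with \<open>l\<close> the
  product of its logarithms, and up to the shifts \<open>1 / (r * l r)\<close> has the divergent
  primitive \<open>Log_(n+1)\<close>: the prior sits at the edge where cutoffs of vanishing energy
  still exist. Cutoffs built from \<open>Log_(n+1)\<close> would have an energy that is small only
  for large \<open>i\<close>. One more logarithm makes \<open>g w^2\<close> integrable outright, so
  the factor \<open>1 / (i + 1)\<close> in the slope can be thrown away and one majorant serves all
  \<open>i\<close>.

  The obstacle is the posterior mass in the denominator of the excess risk. It is bounded below by a
  multiple of \<open>g x * h_i x ^ 2\<close>, whereas parameters far from \<open>x\<close>
  contribute to the numerator an amount that does not see \<open>h_i x\<close>; a cutoff reaching 0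
  would leave the quotient uncontrolled. The floor \<open>w\<close> decays only barely faster than
  \<open>1 / r\<close>, so \<open>g w^2\<close> stays above a multiple of
  \<open>|x| powr (- p - 2 e)\<close>. This is the size of the far contribution itself, and its
  square divided by the mass is again of that size.\<close>

lemma emeasure_lborel_cball:
  fixes a :: "'a::euclidean_space"
  assumes "0 \<le> r"
  shows "emeasure lborel (cball a r) = ennreal (unit_ball_vol (DIM('a)) * r ^ DIM('a))"
  using emeasure_cball[OF assms, of a] by simp

lemma nn_integral_power_Icc:
  assumes "0 \<le> r" "0 < n"
  shows "(\<integral>\<^sup>+t. ennreal (real n * t ^ (n - 1)) * indicator {0<..r} t \<partial>lborel) = ennreal (r ^ n)"
proof -
  have "(\<integral>\<^sup>+t. ennreal (real n * t ^ (n - 1)) * indicator {0<..r} t \<partial>lborel)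
      = (\<integral>\<^sup>+t. ennreal (real n * t ^ (n - 1)) * indicator {0..r} t \<partial>lborel)"
    by (rule nn_integral_cong_AE, rule AE_mp[OF AE_lborel_singleton[of 0]])
       (auto simp: indicator_def intro!: AE_I2)
  also have "\<dots> = ennreal (r ^ n - 0 ^ n)"
    using assms by (intro nn_integral_FTC_Icc) (auto intro!: derivative_eq_intros)
  finally show ?thesis using assms by simp
qed

text \<open>Polar coordinates without a surface measure: a radial integrand sees only the image of
  Lebesgue measure under the norm, and this image is determined by the volumes of balls, because the
  half-lines \<open>{..r}\<close> form an intersection-stable generator.\<close>

lemma distr_norm_lborel:
  "distr lborel borel (norm :: 'a::euclidean_space \<Rightarrow> real)
     = density lborel (\<lambda>r. ennreal (real DIM('a) * unit_ball_vol (DIM('a)) * r ^ (DIM('a) - 1)) * indicator {0<..} r)"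
  (is "?M = ?N")
proof (rule measure_eqI_generator_eq[where E = "range (\<lambda>r::real. {..r})" and \<Omega> = UNIV and A = "\<lambda>n::nat. {..real n}"])
  show "Int_stable (range (\<lambda>r::real. {..r}))"
    by (auto simp: Int_stable_def)
  \<comment> \<open>\<open>max 0 r\<close> covers negative \<open>r\<close> as well: the ball is
    then empty, and the power vanishes because the dimension is positive.\<close>
  have em: "emeasure ?M {..r} = ennreal (unit_ball_vol (DIM('a)) * (max 0 r) ^ DIM('a))"
    and en: "emeasure ?N {..r} = ennreal (unit_ball_vol (DIM('a)) * (max 0 r) ^ DIM('a))" for r
  proof -
    have "emeasure ?M {..r} = emeasure lborel (norm -` {..r} :: 'a set)"
      by (simp add: emeasure_distr)
    also have "norm -` {..r} = cball (0::'a) r" by auto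
    also have "emeasure lborel (cball (0::'a) r) = ennreal (unit_ball_vol (DIM('a)) * (max 0 r) ^ DIM('a))"
      by (cases "0 \<le> r") (auto simp: emeasure_lborel_cball max_def not_le)
    finally show "emeasure ?M {..r} = ennreal (unit_ball_vol (DIM('a)) * (max 0 r) ^ DIM('a))" .
    have "emeasure ?N {..r} = (\<integral>\<^sup>+t. ennreal (unit_ball_vol (DIM('a))) *
          (ennreal (real DIM('a) * t ^ (DIM('a) - 1)) * indicator {0<..max 0 r} t) \<partial>lborel)"
      by (subst emeasure_density)
         (auto intro!: nn_integral_cong simp: indicator_def ennreal_mult[symmetric] mult_ac)
    also have "\<dots> = ennreal (unit_ball_vol (DIM('a)) * (max 0 r) ^ DIM('a))"
      by (subst nn_integral_cmult, measurable, subst nn_integral_power_Icc) (auto simp: ennreal_mult[symmetric])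
    finally show "emeasure ?N {..r} = ennreal (unit_ball_vol (DIM('a)) * (max 0 r) ^ DIM('a))" .
  qed
  show "emeasure ?M X = emeasure ?N X" if "X \<in> range (\<lambda>r::real. {..r})" for X
    using that by (elim rangeE) (simp only: em en)
  show "emeasure ?M {..real n} \<noteq> \<infinity>" for n
    unfolding em by simp
  show "sets ?M = sigma_sets UNIV (range (\<lambda>r::real. {..r}))"
    "sets ?N = sigma_sets UNIV (range (\<lambda>r::real. {..r}))"
    by (simp_all add: borel_eq_atMost)
  show "(\<Union>n. {..real n}) = UNIV"
    by (auto intro: real_arch_simple)
qed (auto)

lemma nn_integral_radial:
  fixes k :: "real \<Rightarrow> ennreal"
  assumes [measurable]: "k \<in> borel_measurable borel"
  shows "(\<integral>\<^sup>+x. k (norm (x::'a::euclidean_space)) \<partial>lborel)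
    = ennreal (real DIM('a) * unit_ball_vol (DIM('a))) * (\<integral>\<^sup>+r\<in>{0<..}. ennreal (r ^ (DIM('a) - 1)) * k r \<partial>lborel)"
proof -
  have "(\<integral>\<^sup>+x. k (norm (x::'a)) \<partial>lborel) = (\<integral>\<^sup>+r. k r \<partial>distr lborel borel (norm :: 'a \<Rightarrow> real))"
    by (simp add: nn_integral_distr)
  also have "\<dots> = (\<integral>\<^sup>+r. ennreal (real DIM('a) * unit_ball_vol (DIM('a))) * (ennreal (r ^ (DIM('a) - 1)) * k r * indicator {0<..} r) \<partial>lborel)"
    unfolding distr_norm_lborel
    by (subst nn_integral_density)
       (auto intro!: nn_integral_cong simp: indicator_def ennreal_mult mult_ac)
  also have "\<dots> = ennreal (real DIM('a) * unit_ball_vol (DIM('a))) * (\<integral>\<^sup>+r\<in>{0<..}. ennreal (r ^ (DIM('a) - 1)) * k r \<partial>lborel)"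
    by (rule nn_integral_cmult) simp
  finally show ?thesis .
qed

lemma nn_integral_powr_at_top_finite:
  fixes a e :: real
  assumes "0 < a" "e < -1"
  shows "(\<integral>\<^sup>+r\<in>{a..}. ennreal (r powr e) \<partial>lborel) < \<infinity>"
proof -
  have "(\<integral>\<^sup>+r\<in>{a..}. ennreal (r powr e) \<partial>lborel) = ennreal (0 - a powr (e + 1) / (e + 1))"
  proof (rule nn_integral_FTC_atLeast)
    show "((\<lambda>r. r powr (e + 1) / (e + 1)) \<longlongrightarrow> 0) at_top"
      using assms by (auto intro!: tendsto_divide_zero tendsto_neg_powr filterlim_ident)
  qed (use assms in \<open>auto intro!: derivative_eq_intros\<close>)
  then show ?thesis by simp
qed

section \<open>Iterated logarithms\<close>

text \<open>The total function \<open>ln\<close> is increasing only on positive arguments. The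
  iterates at \<open>a\<close> and \<open>b\<close> stay there because they lie above those at
  \<open>c\<close>; the last iterate at \<open>c\<close> may itself be nonpositive.\<close>

lemma funpow_ln_mono:
  assumes "\<forall>j<n. 0 < (ln ^^ j) c" "c \<le> a" "a \<le> b" "k \<le> n"
  shows "(ln ^^ k) c \<le> (ln ^^ k) a" "(ln ^^ k) a \<le> (ln ^^ k) (b::real)"
proof -
  have "(ln ^^ k) c \<le> (ln ^^ k) a \<and> (ln ^^ k) a \<le> (ln ^^ k) b"
    using \<open>k \<le> n\<close>
  proof (induction k)
    case (Suc k)
    then have "0 < (ln ^^ k) c" "(ln ^^ k) c \<le> (ln ^^ k) a" "(ln ^^ k) a \<le> (ln ^^ k) b"
      using assms by auto
    then show ?case by (auto simp del: ln_le_cancel_iff intro!: ln_mono)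
  qed (use assms in auto)
  then show "(ln ^^ k) c \<le> (ln ^^ k) a" "(ln ^^ k) a \<le> (ln ^^ k) b" by auto
qed

text \<open>Slow variation: each logarithm turns the factor \<open>C\<close> into an additive
  \<open>ln C\<close>, which is absorbed into a factor again because the next iterate is bounded
  below by its positive value at \<open>c\<close>.\<close>

lemma funpow_ln_scale:
  assumes pos: "\<forall>j\<le>n. 0 < (ln ^^ j) c" and "1 \<le> A"
  shows "k \<le> n \<Longrightarrow> \<exists>C\<ge>1. \<forall>z\<ge>c. (ln ^^ k) (A * z) \<le> C * (ln ^^ k) (z::real)"
proof (induction k)
  case 0
  then show ?case using assms by (intro exI[of _ A]) auto
next
  case (Suc k)
  then obtain C where C: "C \<ge> 1" "\<And>z. z \<ge> c \<Longrightarrow> (ln ^^ k) (A * z) \<le> C * (ln ^^ k) z" by auto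
  define l where "l = (ln ^^ Suc k) c"
  have l: "0 < l" using pos Suc.prems unfolding l_def by blast
  have c: "0 < c" using pos[rule_format, of 0] by simp
  have "(ln ^^ Suc k) (A * z) \<le> (1 + ln C / l) * (ln ^^ Suc k) z" if z: "z \<ge> c" for z
  proof -
    have Az: "z \<le> A * z" using z c \<open>1 \<le> A\<close> by (simp add: mult_le_cancel_right1)
    have mono: "(ln ^^ j) c \<le> (ln ^^ j) z" "(ln ^^ j) z \<le> (ln ^^ j) (A * z)" if "j \<le> n" for j
      using funpow_ln_mono[of n c z "A * z" j] that pos Az z by auto
    have p: "0 < (ln ^^ k) c" using pos Suc.prems by auto
    have "(ln ^^ Suc k) (A * z) \<le> ln (C * (ln ^^ k) z)"
      using C(2)[OF z] mono[of k] p Suc.prems by (auto intro!: ln_mono)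
    also have "\<dots> = ln C + (ln ^^ Suc k) z"
      using C(1) mono[of k] p Suc.prems by (simp add: ln_mult)
    also have "\<dots> = (ln C / l) * l + (ln ^^ Suc k) z" using l by simp
    also have "\<dots> \<le> (ln C / l) * (ln ^^ Suc k) z + (ln ^^ Suc k) z"
      using mono[of "Suc k"] Suc.prems C(1) l unfolding l_def
      by (intro add_right_mono mult_left_mono) auto
    finally show ?thesis by (simp add: algebra_simps)
  qed
  then show ?case using C(1) l by (intro exI[of _ "1 + ln C / l"]) auto
qed

text \<open>Unlike in \<open>iLog\<close>, the factor for \<open>i = 0\<close> is \<open>z\<close>
  itself, so that \<open>1 / log_prod N\<close> is the derivative of the \<open>N\<close>-fold
  iterated logarithm.\<close>

definition log_prod :: "nat \<Rightarrow> real \<Rightarrow> real" where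
  "log_prod N z = (\<Prod>i<N. (ln ^^ i) z)"

lemma log_prod_Suc: "log_prod (Suc N) z = log_prod N z * (ln ^^ N) z"
  by (simp add: log_prod_def)

lemma prod_scale:
  fixes k :: "'i \<Rightarrow> real \<Rightarrow> real"
  assumes "finite I" "\<And>i z. i \<in> I \<Longrightarrow> c \<le> z \<Longrightarrow> 0 \<le> k i z" "1 \<le> A" "0 < c"
    and "\<And>i. i \<in> I \<Longrightarrow> \<exists>C\<ge>1. \<forall>z\<ge>c. k i (A * z) \<le> C * k i z"
  shows "\<exists>C\<ge>1. \<forall>z\<ge>c. (\<Prod>i\<in>I. k i (A * z)) \<le> C * (\<Prod>i\<in>I. k i z)"
proof -
  obtain C where C: "\<And>i. i \<in> I \<Longrightarrow> C i \<ge> 1" "\<And>i z. i \<in> I \<Longrightarrow> c \<le> z \<Longrightarrow> k i (A * z) \<le> C i * k i z"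
    using assms(5) by metis
  have "c \<le> A * z" if "c \<le> z" for z
    using that assms(3,4) mult_right_mono[of 1 A z] by linarith
  then have "(\<Prod>i\<in>I. k i (A * z)) \<le> (\<Prod>i\<in>I. C i) * (\<Prod>i\<in>I. k i z)" if "c \<le> z" for z
    unfolding prod.distrib[symmetric] using C(2) assms(2) that by (intro prod_mono) auto
  moreover have "(\<Prod>i\<in>I. C i) \<ge> 1" using C(1) by (intro prod_ge_1) auto
  ultimately show ?thesis by blast
qed

text \<open>Every further iterate is at most \<open>ln z\<close>, by \<open>ln u <= u - 1\<close>,
  and \<open>ln z\<close> is below any power of \<open>z\<close>. Half of the exponent
  \<open>e\<close> pays for the new factor, the other half goes to the induction hypothesis.\<close>

lemma prod_funpow_ln_growth:
  assumes pos: "\<forall>j\<le>n. 0 < (ln ^^ j) (c::real)"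
  shows "k \<le> n \<Longrightarrow> 0 < e \<Longrightarrow> \<exists>C>0. \<forall>z\<ge>c. (\<Prod>i=1..k. (ln ^^ i) z) \<le> C * z powr e"
proof (induction k arbitrary: e)
  case 0
  have "0 < c" using pos[rule_format, of 0] by simp
  then have "1 \<le> (1 / c powr e) * z powr e" if "z \<ge> c" for z
    using that 0 by (simp add: powr_mono2)
  then show ?case using \<open>0 < c\<close> by (intro exI[of _ "1 / c powr e"]) auto
next
  case (Suc k)
  obtain C where C: "C > 0" "\<And>z. z \<ge> c \<Longrightarrow> (\<Prod>i=1..k. (ln ^^ i) z) \<le> C * z powr (e/2)"
    using Suc.IH[of "e/2"] Suc.prems by auto
  have c: "0 < c" using pos[rule_format, of 0] by simp
  have c1: "1 < c" using pos[rule_format, of 1] Suc.prems c by (simp add: ln_gt_zero_iff)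
  have "(\<Prod>i=1..Suc k. (ln ^^ i) z) \<le> (C / (e/2)) * z powr e" if z: "z \<ge> c" for z
  proof -
    have pz: "0 < (ln ^^ j) z" if "j \<le> n" for j
      using funpow_ln_mono(1)[of n c z z j] pos that z by (metis less_imp_le_nat less_le_trans order_refl)
    have le: "(ln ^^ Suc j) z \<le> ln z" if "Suc j \<le> n" for j
      using that
    proof (induction j)
      case (Suc j)
      have "(ln ^^ Suc (Suc j)) z \<le> (ln ^^ Suc j) z - 1"
        using pz[of "Suc j"] Suc.prems by (auto intro!: ln_le_minus_one)
      also have "\<dots> \<le> ln z" using Suc by simp
      finally show ?case .
    qed simp
    have "(ln ^^ Suc k) z \<le> z powr (e/2) / (e/2)"
      using le[of k] ln_powr_bound[of z "e/2"] z c1 Suc.prems by auto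
    then have "(\<Prod>i=1..k. (ln ^^ i) z) * (ln ^^ Suc k) z \<le> (C * z powr (e/2)) * (z powr (e/2) / (e/2))"
      using C(2)[OF z] pz[of "Suc k"] Suc.prems C(1)
      by (intro mult_mono) (simp_all only: mult_nonneg_nonneg powr_ge_zero less_imp_le)
    also have "\<dots> = (C / (e/2)) * (z powr (e/2) * z powr (e/2))" by simp
    also have "z powr (e/2) * z powr (e/2) = z powr e" using powr_add[of z "e/2" "e/2"] by simp
    finally show ?thesis by simp
  qed
  then show ?case using C(1) Suc.prems by (intro exI[of _ "C / (e/2)"]) auto
qed

text \<open>Concavity: an increment is at most the slope at the left end times the length. Applying
  \<open>ln u <= u - 1\<close> to the quotient of two iterates gives this one logarithm at a
  time.\<close>

lemma funpow_ln_diff_le: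
  assumes "\<forall>j<k. 0 < (ln ^^ j) a" "a \<le> b"
  shows "(ln ^^ k) b - (ln ^^ k) a \<le> (b - a) / log_prod k (a::real)"
  using assms(1)
proof (induction k)
  case (Suc k)
  have p: "0 < (ln ^^ k) a" using Suc.prems by auto
  have le: "(ln ^^ k) a \<le> (ln ^^ k) b"
    using funpow_ln_mono[of k a a b k] Suc.prems assms by auto
  have "(ln ^^ Suc k) b - (ln ^^ Suc k) a = ln ((ln ^^ k) b / (ln ^^ k) a)"
    using p le by (simp add: ln_div)
  also have "\<dots> \<le> (ln ^^ k) b / (ln ^^ k) a - 1"
    using p le by (intro ln_le_minus_one) (auto intro!: divide_pos_pos)
  also have "\<dots> = ((ln ^^ k) b - (ln ^^ k) a) / (ln ^^ k) a" using p by (simp add: field_simps)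
  also have "\<dots> \<le> ((b - a) / log_prod k a) / (ln ^^ k) a"
    using Suc p by (intro divide_right_mono) auto
  finally show ?case by (simp add: log_prod_Suc)
qed (simp add: log_prod_def)

lemma DERIV_funpow_ln:
  "\<forall>j<k. 0 < (ln ^^ j) z \<Longrightarrow> ((ln ^^ k) has_real_derivative 1 / log_prod k z) (at (z::real))"
proof (induction k)
  case (Suc k)
  then have "((\<lambda>z. ln ((ln ^^ k) z)) has_real_derivative (1 / (ln ^^ k) z) * (1 / log_prod k z)) (at z)"
    by (intro DERIV_chain2[OF DERIV_ln_divide] Suc.IH) auto
  then show ?case by (simp add: log_prod_Suc mult.commute)
qed (simp add: log_prod_def id_def)

lemma filterlim_funpow_ln: "filterlim (ln ^^ k) at_top (at_top :: real filter)"
proof (induction k)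
  case (Suc k)
  then show ?case using filterlim_compose[OF ln_at_top Suc] by (simp add: comp_def)
qed (simp add: id_def filterlim_ident)

lemma funpow_ln_tower:
  "j \<le> N \<Longrightarrow> (ln ^^ j) ((exp ^^ N) (t::real)) = (exp ^^ (N - j)) t"
proof (induction j)
  case (Suc j)
  then have "N - j = Suc (N - Suc j)" by simp
  with Suc show ?case by simp
qed simp

lemma le_funpow_exp: "(t::real) \<le> (exp ^^ N) t"
proof (induction N)
  case (Suc N)
  have "(exp ^^ N) t \<le> exp ((exp ^^ N) t)" using exp_ge_add_one_self[of "(exp ^^ N) t"] by linarith
  with Suc show ?case by simp
qed simp

section \<open>The cutoff functions\<close>

lemma borel_measurable_funpow_ln [measurable]:
  "(ln ^^ k) \<in> borel_measurable (borel :: real measure)"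
proof (induction k)
  case (Suc k)
  then have "(\<lambda>z. ln ((ln ^^ k) z)) \<in> borel_measurable (borel :: real measure)"
    by measurable
  then show ?case by (simp add: comp_def)
qed (simp add: id_def)

text \<open>The shift \<open>b\<close> belongs to the cutoffs and is separate from the shift
  \<open>c\<close> of the prior, whose logarithms may be small near 0. It can therefore be taken as
  large as convenient; the two meet only through \<open>c <= b\<close>.\<close>

locale log_scale =
  fixes n :: nat and b :: real
  assumes ge1: "j \<le> n + 2 \<Longrightarrow> 1 \<le> (ln ^^ j) b"
begin

definition w :: "real \<Rightarrow> real" where "w r = 1 / log_prod (n + 2) (r + b)"
definition v :: "real \<Rightarrow> real" where "v r = (ln ^^ (n + 2)) (r + b)"
definition cutoff :: "nat \<Rightarrow> real \<Rightarrow> real" where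
  "cutoff i r = max (w r) (1 - v r / real (Suc i))"

lemma w_measurable [measurable]: "w \<in> borel_measurable borel"
  unfolding w_def[abs_def] log_prod_def by measurable

lemma v_measurable [measurable]: "v \<in> borel_measurable borel"
  unfolding v_def[abs_def] by measurable

lemma cutoff_measurable [measurable]: "cutoff i \<in> borel_measurable borel"
  unfolding cutoff_def[abs_def] by measurable

lemma b_ge_1: "1 \<le> b"
  using ge1[of 0] by simp

lemma pos: "j \<le> n + 2 \<Longrightarrow> 0 < (ln ^^ j) b"
  using ge1[of j] by simp

lemma mono:
  assumes "0 \<le> x" "x \<le> y" "j \<le> n + 2"
  shows "(ln ^^ j) (x + b) \<le> (ln ^^ j) (y + b)"
  using funpow_ln_mono(2)[of "n + 2" b "x + b" "y + b" j] pos assms by auto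

lemma one_le: "0 \<le> x \<Longrightarrow> j \<le> n + 2 \<Longrightarrow> 1 \<le> (ln ^^ j) (x + b)"
  using mono[of 0 x j] ge1[of j] by simp

lemma one_le_log_prod: "0 \<le> x \<Longrightarrow> k \<le> n + 3 \<Longrightarrow> 1 \<le> log_prod k (x + b)"
  unfolding log_prod_def by (intro prod_ge_1) (auto intro!: one_le)

lemma log_prod_mono:
  assumes "0 \<le> x" "x \<le> y" "k \<le> n + 3"
  shows "log_prod k (x + b) \<le> log_prod k (y + b)"
  unfolding log_prod_def
proof (rule prod_mono)
  fix i assume "i \<in> {..<k}"
  then show "0 \<le> (ln ^^ i) (x + b) \<and> (ln ^^ i) (x + b) \<le> (ln ^^ i) (y + b)"
    using one_le[of x i] mono[of x y i] assms by auto
qed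

lemma w_pos: "0 \<le> r \<Longrightarrow> 0 < w r"
  using one_le_log_prod[of r "n + 2"] by (simp add: w_def)

lemma w_le_1: "0 \<le> r \<Longrightarrow> w r \<le> 1"
  using one_le_log_prod[of r "n + 2"] by (simp add: w_def)

lemma w_antimono: "0 \<le> x \<Longrightarrow> x \<le> y \<Longrightarrow> w y \<le> w x"
  unfolding w_def
  using one_le_log_prod[of x "n + 2"] one_le_log_prod[of y "n + 2"] log_prod_mono[of x y "n + 2"]
  by (intro divide_left_mono) auto

lemma v_ge_1: "0 \<le> r \<Longrightarrow> 1 \<le> v r"
  unfolding v_def by (rule one_le) auto

lemma v_mono: "0 \<le> x \<Longrightarrow> x \<le> y \<Longrightarrow> v x \<le> v y"
  unfolding v_def by (rule mono) auto

lemma v_diff_le: "0 \<le> x \<Longrightarrow> x \<le> y \<Longrightarrow> v y - v x \<le> w x * (y - x)"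
  using funpow_ln_diff_le[of "n + 2" "x + b" "y + b"] one_le[of x]
  by (force simp: v_def w_def intro: less_le_trans[OF zero_less_one])

lemma v_at_top: "filterlim v at_top at_top"
proof -
  have "filterlim (\<lambda>r::real. r + b) at_top at_top"
    using filterlim_tendsto_add_at_top[OF tendsto_const[of b] filterlim_ident] by (simp add: add.commute)
  then show ?thesis
    unfolding v_def[abs_def] by (rule filterlim_compose[OF filterlim_funpow_ln])
qed

text \<open>The product of logarithms is the exponential of the sum of the next ones, each of which is
  1-Lipschitz.\<close>

lemma w_diff_le:
  assumes "0 \<le> x" "x \<le> y"
  shows "w x - w y \<le> real (n + 2) * w x * (y - x)"
proof -
  define S where "S z = (\<Sum>i<n+2. (ln ^^ Suc i) (z + b))" for z
  have w_eq: "w z = exp (- S z)" if "0 \<le> z" for z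
  proof -
    have "log_prod (n + 2) (z + b) = (\<Prod>i<n+2. exp ((ln ^^ Suc i) (z + b)))"
      unfolding log_prod_def
    proof (rule prod.cong)
      fix i assume "i \<in> {..<n+2}"
      then have "1 \<le> (ln ^^ i) (z + b)" using that by (intro one_le) auto
      then show "(ln ^^ i) (z + b) = exp ((ln ^^ Suc i) (z + b))" by simp
    qed simp
    also have "\<dots> = exp (S z)" unfolding S_def by (simp only: exp_sum finite_lessThan)
    finally show ?thesis by (simp add: w_def exp_minus inverse_eq_divide)
  qed
  have "S y - S x = (\<Sum>i<n+2. (ln ^^ Suc i) (y + b) - (ln ^^ Suc i) (x + b))"
    unfolding S_def by (simp only: sum_subtractf)
  also have "\<dots> \<le> (\<Sum>i<n+2. y - x)"
  proof (rule sum_mono)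
    fix i assume i: "i \<in> {..<n+2}"
    have "(ln ^^ Suc i) (y + b) - (ln ^^ Suc i) (x + b) \<le> (y - x) / log_prod (Suc i) (x + b)"
      using funpow_ln_diff_le[of "Suc i" "x + b" "y + b"] one_le[of x] assms i
      by (force intro: less_le_trans[OF zero_less_one])
    also have "\<dots> \<le> y - x"
      using one_le_log_prod[of x "Suc i"] assms i by (simp add: divide_le_eq mult_le_cancel_left1)
    finally show "(ln ^^ Suc i) (y + b) - (ln ^^ Suc i) (x + b) \<le> y - x" .
  qed
  also have "\<dots> = real (n + 2) * (y - x)" by simp
  finally have S: "S y - S x \<le> real (n + 2) * (y - x)" .
  have "w x - w y = w x * (1 - exp (- (S y - S x)))"
    using assms by (simp add: w_eq algebra_simps flip: exp_add)
  also have "\<dots> \<le> w x * (S y - S x)"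
    using w_pos[OF assms(1)] exp_ge_add_one_self[of "- (S y - S x)"] by (intro mult_left_mono) linarith+
  also have "\<dots> \<le> w x * (real (n + 2) * (y - x))"
    using w_pos[OF assms(1)] S by (intro mult_left_mono) auto
  finally show ?thesis by (simp add: mult_ac)
qed

text \<open>Doubling property, used to replace the value of \<open>w\<close> at half a norm by the
  value at the norm itself. After enlarging \<open>r + b\<close> by another \<open>b\<close> it is
  exactly twice \<open>r / 2 + b\<close>, and the logarithms vary slowly.\<close>

lemma w_half: "\<exists>C\<ge>1. \<forall>r\<ge>0. w (r / 2) \<le> C * w r"
proof -
  have "\<exists>C\<ge>1. \<forall>z\<ge>b. (\<Prod>i\<in>{..<n+2}. (ln ^^ i) (2 * z)) \<le> C * (\<Prod>i\<in>{..<n+2}. (ln ^^ i) z)"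
  proof (rule prod_scale)
    show "0 \<le> (ln ^^ i) z" if "i \<in> {..<n+2}" "b \<le> z" for i z
      using one_le[of "z - b" i] that by auto
    show "\<exists>C\<ge>1. \<forall>z\<ge>b. (ln ^^ i) (2 * z) \<le> C * (ln ^^ i) z" if "i \<in> {..<n+2}" for i
      using funpow_ln_scale[of "n + 2" b 2 i] pos that by auto
  qed (use b_ge_1 in auto)
  then obtain C where C: "C \<ge> 1" "\<And>z. z \<ge> b \<Longrightarrow> log_prod (n + 2) (2 * z) \<le> C * log_prod (n + 2) z"
    unfolding log_prod_def by auto
  have "w (r / 2) \<le> C * w r" if r: "0 \<le> r" for r
  proof -
    have "log_prod (n + 2) (r + b) \<le> log_prod (n + 2) ((r + b) + b)"
      using log_prod_mono[of r "r + b" "n + 2"] r b_ge_1 by auto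
    also have "(r + b) + b = 2 * (r / 2 + b)" by simp
    also have "log_prod (n + 2) \<dots> \<le> C * log_prod (n + 2) (r / 2 + b)" using r by (intro C) auto
    finally show ?thesis
      using one_le_log_prod[of r "n + 2"] one_le_log_prod[of "r/2" "n + 2"] r
      by (simp add: w_def field_simps)
  qed
  with C(1) show ?thesis by auto
qed

lemma log_prod_eq: "log_prod (Suc k) z = z * (\<Prod>i=1..k. (ln ^^ i) z)"
  by (induction k) (simp_all add: log_prod_Suc log_prod_def mult_ac)

text \<open>This quantifies how little is lost by the floor of the cutoffs: \<open>w\<close> falls
  below \<open>1 / r\<close> by less than any power. It is what bounds the posterior mass from below
  against the far parameters.\<close>

lemma w_lower:
  assumes "0 < e"
  shows "\<exists>k>0. \<forall>r\<ge>0. k * (1 + r) powr (- 1 - e) \<le> w r"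
proof -
  obtain C where C: "C > 0" "\<And>z. z \<ge> b \<Longrightarrow> (\<Prod>i=1..n+1. (ln ^^ i) z) \<le> C * z powr e"
    using prod_funpow_ln_growth[of "n + 2" b "n + 1" e] pos assms by auto
  define k where "k = 1 / (C * b powr (1 + e))"
  have k: "k > 0" using C b_ge_1 by (simp add: k_def)
  have "k * (1 + r) powr (- 1 - e) \<le> w r" if r: "0 \<le> r" for r
  proof -
    have "log_prod (n + 2) (r + b) \<le> (r + b) * (C * (r + b) powr e)"
      using log_prod_eq[of "n + 1" "r + b"] C(2)[of "r + b"] r b_ge_1 by auto
    also have "\<dots> = C * (r + b) powr (1 + e)" using r b_ge_1 by (simp add: powr_add)
    \<comment> \<open>\<open>r + b <= b * (1 + r)\<close> because \<open>1 <= b\<close>.\<close>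
    also have "\<dots> \<le> C * (b * (1 + r)) powr (1 + e)"
      using r b_ge_1 C assms mult_right_mono[of 1 b r]
      by (intro mult_left_mono powr_mono2) (auto simp: algebra_simps)
    also have "\<dots> = (C * b powr (1 + e)) * (1 + r) powr (1 + e)"
      using r b_ge_1 by (simp add: powr_mult)
    finally have *: "log_prod (n + 2) (r + b) \<le> (C * b powr (1 + e)) * (1 + r) powr (1 + e)" .
    have "k * (1 + r) powr (- 1 - e) = 1 / ((C * b powr (1 + e)) * (1 + r) powr (1 + e))"
      using powr_minus_divide[of "1 + r" "1 + e"] by (simp add: k_def)
    also have "\<dots> \<le> w r"
      unfolding w_def using * one_le_log_prod[of r "n + 2"] r by (intro divide_left_mono) auto
    finally show ?thesis .
  qed
  with k show ?thesis by blast
qed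

lemma cutoff_ge: "w r \<le> cutoff i r"
  by (simp add: cutoff_def)

lemma cutoff_le_1: "0 \<le> r \<Longrightarrow> cutoff i r \<le> 1"
  using w_le_1[of r] v_ge_1[of r] by (simp add: cutoff_def)

lemma cutoff_tendsto: "0 \<le> r \<Longrightarrow> (\<lambda>i. cutoff i r) \<longlonglongrightarrow> 1"
proof -
  assume r: "0 \<le> r"
  have "(\<lambda>i. max (w r) (1 - v r / real (Suc i))) \<longlonglongrightarrow> max (w r) (1 - 0)"
    by (intro tendsto_max tendsto_diff tendsto_const LIMSEQ_Suc[OF lim_const_over_n])
  then show ?thesis using w_le_1[OF r] by (simp add: cutoff_def max_def)
qed

lemma cutoff_eq_w: "\<exists>R\<ge>0. \<forall>r\<ge>R. cutoff i r = w r"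
proof -
  have "eventually (\<lambda>r. real (Suc i) \<le> v r) at_top"
    using v_at_top by (simp add: filterlim_at_top)
  then obtain R where R: "\<And>r. r \<ge> R \<Longrightarrow> real (Suc i) \<le> v r"
    by (auto simp: eventually_at_top_linorder)
  have "cutoff i r = w r" if "r \<ge> max 0 R" for r
  proof -
    have "1 - v r / real (Suc i) \<le> 0" using R[of r] that by (simp add: field_simps)
    moreover have "0 < w r" using that by (intro w_pos) auto
    ultimately show ?thesis unfolding cutoff_def by linarith
  qed
  then show ?thesis by (intro exI[of _ "max 0 R"]) auto
qed

text \<open>Both branches of the maximum have slope at most \<open>(n + 2) * w\<close>: the floor by
  \<open>w_diff_le\<close>, the other because \<open>w\<close> is the derivative of \<open>v\<close>
  and division by \<open>i + 1\<close> only helps. Since \<open>w\<close> decreases, any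
  \<open>z\<close> below both points gives an admissible constant, and it does not depend on
  \<open>i\<close>.\<close>

lemma cutoff_diff_le:
  assumes "0 \<le> z" "z \<le> x" "z \<le> y"
  shows "\<bar>cutoff i x - cutoff i y\<bar> \<le> real (n + 2) * w z * \<bar>x - y\<bar>"
proof -
  have *: "\<bar>cutoff i x - cutoff i y\<bar> \<le> real (n + 2) * w z * (y - x)" if "0 \<le> z" "z \<le> x" "x \<le> y" for x y
  proof -
    have wx: "w x \<le> w z" "0 < w x" using that by (auto intro: w_antimono w_pos)
    have "w x - w y \<le> real (n + 2) * w x * (y - x)" using that by (intro w_diff_le) auto
    also have "\<dots> \<le> real (n + 2) * w z * (y - x)"
      using wx that by (intro mult_right_mono mult_left_mono) auto
    finally have 1: "w x - w y \<le> real (n + 2) * w z * (y - x)" .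
    have "(v y - v x) / real (Suc i) \<le> (v y - v x) / 1"
      using v_mono[of x y] that by (intro divide_left_mono) auto
    also have "\<dots> \<le> w x * (y - x)" using v_diff_le[of x y] that by simp
    also have "\<dots> \<le> real (n + 2) * w z * (y - x)"
      using wx that mult_mono[of 1 "real (n+2)" "w x" "w z"] by (intro mult_right_mono) auto
    finally have 2: "v y / real (Suc i) - v x / real (Suc i) \<le> real (n + 2) * w z * (y - x)"
      by (simp add: diff_divide_distrib)
    have "w y \<le> w x" "v x / real (Suc i) \<le> v y / real (Suc i)"
      using that by (auto intro!: w_antimono divide_right_mono v_mono)
    with 1 2 show ?thesis unfolding cutoff_def by linarith
  qed
  show ?thesis
    using *[of x y] *[of y x] assms by (cases "x \<le> y") (auto simp: abs_minus_commute)
qed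

lemma w_square_integrable:
  fixes l :: "real \<Rightarrow> real"
  assumes "\<And>r. 0 < r \<Longrightarrow> 0 \<le> l r \<and> r * l r \<le> log_prod (n + 1) (r + b)"
  shows "(\<integral>\<^sup>+r\<in>{0<..}. ennreal (r * l r * (w r)\<^sup>2) \<partial>lborel) < \<infinity>"
proof -
  define u where "u r = (ln ^^ (n + 1)) (r + b)" for r
  have u: "1 \<le> u r" if "0 \<le> r" for r using one_le[of r "n + 1"] that by (simp add: u_def)
  have u_deriv: "(u has_real_derivative 1 / log_prod (n + 1) (r + b)) (at r)" if "0 \<le> r" for r
  proof -
    have "((ln ^^ (n + 1)) has_real_derivative 1 / log_prod (n + 1) (r + b)) (at (r + b))"
      using one_le[OF that] by (intro DERIV_funpow_ln) (force intro: less_le_trans[OF zero_less_one])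
    then show ?thesis unfolding u_def[abs_def] by (simp only: DERIV_shift)
  qed
  have "(\<integral>\<^sup>+r\<in>{0<..}. ennreal (r * l r * (w r)\<^sup>2) \<partial>lborel)
      \<le> (\<integral>\<^sup>+r\<in>{0..}. ennreal (1 / log_prod (n + 1) (r + b) / (u r)\<^sup>2) \<partial>lborel)"
  proof (intro nn_integral_mono)
    fix r :: real
    have "r * l r * (w r)\<^sup>2 \<le> 1 / log_prod (n + 1) (r + b) / (u r)\<^sup>2" if "0 < r"
    proof -
      have P: "1 \<le> log_prod (n + 1) (r + b)" using that by (intro one_le_log_prod) auto
      \<comment> \<open>\<open>w\<close> has the factor \<open>u\<close> beyond the product that
        bounds \<open>r * l r\<close>; squaring and cancelling leaves that product once and
        \<open>u\<close> twice in the denominator, which is the derivative of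
        \<open>- 1 / u\<close>.\<close>
      have "w r = 1 / (log_prod (n + 1) (r + b) * u r)"
        using log_prod_Suc[of "n + 1" "r + b"] by (simp add: w_def u_def)
      then have "r * l r * (w r)\<^sup>2 \<le> log_prod (n + 1) (r + b) * (1 / (log_prod (n + 1) (r + b) * u r))\<^sup>2"
        using assms[OF that] by (auto intro!: mult_right_mono)
      also have "\<dots> = 1 / log_prod (n + 1) (r + b) / (u r)\<^sup>2"
        using P u[of r] that by (simp add: power2_eq_square field_simps)
      finally show ?thesis .
    qed
    then show "ennreal (r * l r * (w r)\<^sup>2) * indicator {0<..} r
        \<le> ennreal (1 / log_prod (n + 1) (r + b) / (u r)\<^sup>2) * indicator {0..} r"
      by (auto simp: indicator_def intro!: ennreal_leI)
  qed
  also have "\<dots> = ennreal (0 - (- 1 / u 0))"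
  proof (rule nn_integral_FTC_atLeast)
    show "(\<lambda>r. 1 / log_prod (n + 1) (r + b) / (u r)\<^sup>2) \<in> borel_measurable borel"
      unfolding u_def log_prod_def by measurable
    show "((\<lambda>r. - 1 / u r) has_real_derivative 1 / log_prod (n + 1) (r + b) / (u r)\<^sup>2) (at r)"
      if "0 \<le> r" for r
      using u_deriv[OF that] u[OF that]
      by (auto intro!: derivative_eq_intros simp: power2_eq_square)
    show "0 \<le> 1 / log_prod (n + 1) (r + b) / (u r)\<^sup>2" if "0 \<le> r" for r
      using one_le_log_prod[OF that, of "n + 1"] by auto
    have "filterlim (\<lambda>r::real. r + b) at_top at_top"
      using filterlim_tendsto_add_at_top[OF tendsto_const[of b] filterlim_ident] by (simp add: add.commute)
    then have "filterlim u at_top at_top"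
      unfolding u_def[abs_def] by (rule filterlim_compose[OF filterlim_funpow_ln])
    then show "((\<lambda>r. - 1 / u r) \<longlongrightarrow> 0) at_top"
      by (rule real_tendsto_divide_at_top[OF tendsto_const])
  qed
  finally show ?thesis by (simp add: le_less_trans[OF _ ennreal_less_top])
qed

end

text \<open>Take a tower of \<open>n + 2\<close> exponentials over a number at least 1: its iterated
  logarithms are the shorter towers, and a tower is never below its top entry.\<close>

lemma log_scale_exists: "\<exists>b\<ge>c. log_scale n b"
proof -
  define t where "t = max 1 c"
  have "1 \<le> (exp ^^ k) t" for k
    using le_funpow_exp[of t k] by (simp add: t_def)
  then have "log_scale n ((exp ^^ (n + 2)) t)"
    by unfold_locales (simp only: funpow_ln_tower)
  moreover have "c \<le> (exp ^^ (n + 2)) t" using le_funpow_exp[of t "n + 2"] by (simp add: t_def)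
  ultimately show ?thesis by blast
qed

section \<open>The prior\<close>

text \<open>Starting the product at 1 drops the exceptional \<open>iLog 0\<close>; from there on
  \<open>iLog i\<close> agrees with \<open>ln ^^ i\<close>.\<close>

definition log_factor :: "nat \<Rightarrow> real \<Rightarrow> real \<Rightarrow> real" where
  "log_factor n c r = (\<Prod>i=1..n. (ln ^^ i) (r + c))"

lemma prior_profile_eq: "prior_profile p n c r = r powi (2 - int p) * log_factor n c r"
proof -
  have "(\<Prod>i=0..n. iLog i (r + c)) = iLog 0 (r + c) * (\<Prod>i=1..n. iLog i (r + c))"
    by (simp add: prod.atLeast_Suc_atMost)
  also have "(\<Prod>i=1..n. iLog i (r + c)) = log_factor n c r"
    unfolding log_factor_def by (intro prod.cong) (auto simp: iLog_def)
  finally show ?thesis by (simp add: prior_profile_def iLog_def)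
qed

lemma log_factor_measurable [measurable]: "log_factor n c \<in> borel_measurable borel"
  unfolding log_factor_def[abs_def] by measurable

lemma prior_profile_measurable [measurable]: "prior_profile p n c \<in> borel_measurable borel"
  unfolding prior_profile_eq[abs_def] power_int_def by measurable

locale log_prior =
  fixes n :: nat and c :: real
  assumes pos: "\<forall>j\<le>n. 0 < (ln ^^ j) c"
begin

abbreviation "l \<equiv> log_factor n c"

lemma c_pos: "0 < c"
  using pos[rule_format, of 0] by simp

lemma factor_mono:
  assumes "0 \<le> x" "x \<le> y" "j \<le> n"
  shows "0 < (ln ^^ j) (x + c)" "(ln ^^ j) (x + c) \<le> (ln ^^ j) (y + c)"
proof -
  show "(ln ^^ j) (x + c) \<le> (ln ^^ j) (y + c)"
    using funpow_ln_mono(2)[of n c "x + c" "y + c" j] pos assms by auto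
  have "(ln ^^ j) c \<le> (ln ^^ j) (x + c)"
    using funpow_ln_mono(1)[of n c "x + c" "y + c" j] pos assms by auto
  with pos assms show "0 < (ln ^^ j) (x + c)" by (meson less_le_trans)
qed

lemma l_pos: "0 \<le> r \<Longrightarrow> 0 < l r"
  unfolding log_factor_def using factor_mono(1)[of r r] by (intro prod_pos) auto

lemma l_mono: "0 \<le> x \<Longrightarrow> x \<le> y \<Longrightarrow> l x \<le> l y"
  unfolding log_factor_def using factor_mono by (intro prod_mono) (auto intro: less_imp_le)

lemma l_scale:
  assumes "1 \<le> A"
  shows "\<exists>C\<ge>1. \<forall>r\<ge>0. l (A * r) \<le> C * l r"
proof -
  have "\<exists>C\<ge>1. \<forall>z\<ge>c. (\<Prod>i\<in>{1..n}. (ln ^^ i) (A * z)) \<le> C * (\<Prod>i\<in>{1..n}. (ln ^^ i) z)"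
  proof (rule prod_scale)
    show "0 \<le> (ln ^^ i) z" if "i \<in> {1..n}" "c \<le> z" for i z
      using factor_mono(1)[of "z - c" "z - c" i] that by auto
    show "\<exists>C\<ge>1. \<forall>z\<ge>c. (ln ^^ i) (A * z) \<le> C * (ln ^^ i) z" if "i \<in> {1..n}" for i
      using funpow_ln_scale[of n c A i] pos that assms by auto
  qed (use c_pos assms in auto)
  then obtain C where C: "C \<ge> 1"
      "\<And>z. z \<ge> c \<Longrightarrow> (\<Prod>i\<in>{1..n}. (ln ^^ i) (A * z)) \<le> C * (\<Prod>i\<in>{1..n}. (ln ^^ i) z)"
    by auto
  have "l (A * r) \<le> C * l r" if r: "0 \<le> r" for r
  proof -
    \<comment> \<open>Increasing the argument by \<open>(A - 1) * c\<close> turns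
      \<open>A * r + c\<close> into \<open>A * (r + c)\<close>, where the scaling bound for
      unshifted logarithms applies.\<close>
    have "l (A * r) \<le> (\<Prod>i\<in>{1..n}. (ln ^^ i) (A * (r + c)))"
      using l_mono[of "A * r" "A * r + (A - 1) * c"] r c_pos assms
      by (simp add: log_factor_def algebra_simps)
    also have "\<dots> \<le> C * l r" using C(2)[of "r + c"] r by (simp add: log_factor_def)
    finally show ?thesis .
  qed
  with C(1) show ?thesis by blast
qed

lemma l_growth:
  assumes "0 < e"
  shows "\<exists>C>0. \<forall>r\<ge>0. l r \<le> C * (1 + r) powr e"
proof -
  obtain C where C: "C > 0" "\<And>z. z \<ge> c \<Longrightarrow> (\<Prod>i=1..n. (ln ^^ i) z) \<le> C * z powr e"
    using prod_funpow_ln_growth[of n c n e] pos assms by auto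
  have "l r \<le> (C * (max 1 c) powr e) * (1 + r) powr e" if r: "0 \<le> r" for r
  proof -
    have "l r \<le> C * (r + c) powr e" using C(2)[of "r + c"] r by (simp add: log_factor_def)
    also have "r + c \<le> max 1 c * (1 + r)"
      using mult_right_mono[OF max.cobounded1 r, of 1 c] max.cobounded2[of c 1] by (simp only: distrib_left)
    then have "C * (r + c) powr e \<le> C * (max 1 c * (1 + r)) powr e"
      using r c_pos C assms by (intro mult_left_mono powr_mono2) auto
    also have "\<dots> = (C * (max 1 c) powr e) * (1 + r) powr e" using r by (simp add: powr_mult)
    finally show ?thesis .
  qed
  moreover have "C * (max 1 c) powr e > 0" using C(1) by simp
  ultimately show ?thesis by blast
qed

abbreviation "G p \<equiv> prior_profile p n c"

lemma G_pos: "0 < r \<Longrightarrow> 0 < G p r"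
  using l_pos[of r] by (simp add: prior_profile_eq)

lemma G_nonneg: "0 \<le> r \<Longrightarrow> 0 \<le> G p r"
  using l_pos[of r] by (simp add: prior_profile_eq)

lemma G_eq_powr: "0 < r \<Longrightarrow> G p r = r powr (2 - real p) * l r"
  using powr_real_of_int'[of r "2 - int p"] by (simp add: prior_profile_eq)

text \<open>Comparable radii have comparable prior values: the power changes by at most
  \<open>A powr |2 - p|\<close>, whether it increases (\<open>p <= 2\<close>) or decreases
  (\<open>p > 2\<close>), and the logarithms vary slowly.\<close>

lemma G_comparable:
  assumes "1 \<le> A"
  shows "\<exists>C\<ge>1. \<forall>x>0. \<forall>y>0. y \<le> A * x \<longrightarrow> x \<le> A * y \<longrightarrow> G p y \<le> C * G p x"
proof -
  obtain C where C: "C \<ge> 1" "\<And>r. r \<ge> 0 \<Longrightarrow> l (A * r) \<le> C * l r"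
    using l_scale[OF assms] by auto
  define B where "B = A powr \<bar>2 - real p\<bar>"
  have B: "1 \<le> B" using assms by (simp add: B_def ge_one_powr_ge_zero)
  have "G p y \<le> (B * C) * G p x" if "0 < x" "0 < y" "y \<le> A * x" "x \<le> A * y" for x y
  proof -
    have "y powr (2 - real p) \<le> B * x powr (2 - real p)"
    proof (cases "2 - real p \<ge> 0")
      case True
      have "y powr (2 - real p) \<le> (A * x) powr (2 - real p)" using that True by (intro powr_mono2) auto
      then show ?thesis using True that assms by (simp add: B_def powr_mult)
    next
      case False
      have "y powr (2 - real p) \<le> (x / A) powr (2 - real p)"
        using that False assms by (intro powr_mono2') (auto simp: field_simps)
      also have "\<dots> = B * x powr (2 - real p)"
        using False that assms by (simp add: B_def powr_divide powr_diff field_simps)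
      finally show ?thesis .
    qed
    moreover have "l y \<le> C * l x" using l_mono[of y "A * x"] C(2)[of x] that by simp
    ultimately have "y powr (2 - real p) * l y \<le> (B * x powr (2 - real p)) * (C * l x)"
      using that B l_pos[of y] by (intro mult_mono) auto
    then show ?thesis using that by (simp add: G_eq_powr mult_ac)
  qed
  moreover have "1 \<le> B * C" using B C(1) mult_mono[of 1 B 1 C] by simp
  ultimately show ?thesis by blast
qed

lemma G_lower: "\<exists>k>0. \<forall>r>0. k * r powr (2 - real p) \<le> G p r"
proof (intro exI[of _ "l 0"] conjI allI impI)
  show "0 < l 0" by (rule l_pos) simp
  show "l 0 * r powr (2 - real p) \<le> G p r" if "0 < r" for r
    using l_mono[of 0 r] that by (simp add: G_eq_powr mult.commute mult_right_mono)
qed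

text \<open>The exponent \<open>2 - p\<close> exactly offsets the Jacobian of polar coordinates up
  to one power of \<open>r\<close>, so all radial integrals against the prior look the same in every
  dimension.\<close>

lemma power_G:
  assumes "0 < r" "0 < p"
  shows "r ^ (p - 1) * G p r = r * l r"
proof -
  have "r ^ (p - 1) * r powr (2 - real p) = r powr (real (p - 1) + (2 - real p))"
    using assms by (simp only: powr_add powr_realpow)
  also have "real (p - 1) + (2 - real p) = 1" using assms by (simp add: of_nat_diff)
  finally show ?thesis using assms by (simp add: G_eq_powr mult.assoc[symmetric])
qed

lemma nn_integral_radial_G:
  fixes k :: "real \<Rightarrow> real"
  assumes [measurable]: "k \<in> borel_measurable borel" and k: "\<And>r. 0 < r \<Longrightarrow> 0 \<le> k r"
  shows "(\<integral>\<^sup>+x. ennreal (k (norm x) * G (DIM('a)) (norm (x::'a::euclidean_space))) \<partial>lborel)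
    = ennreal (real DIM('a) * unit_ball_vol (DIM('a))) * (\<integral>\<^sup>+r\<in>{0<..}. ennreal (r * l r * k r) \<partial>lborel)"
proof -
  have "(\<integral>\<^sup>+r\<in>{0<..}. ennreal (r ^ (DIM('a) - 1)) * ennreal (k r * G (DIM('a)) r) \<partial>lborel)
      = (\<integral>\<^sup>+r\<in>{0<..}. ennreal (r * l r * k r) \<partial>lborel)"
  proof (rule nn_integral_cong)
    fix r :: real
    have "ennreal (r ^ (DIM('a) - 1)) * ennreal (k r * G (DIM('a)) r) = ennreal (r * l r * k r)" if "0 < r"
      using power_G[OF that, of "DIM('a)"] that k[OF that] G_nonneg[of r]
      by (simp add: ennreal_mult[symmetric] mult_ac)
    then show "ennreal (r ^ (DIM('a) - 1)) * ennreal (k r * G (DIM('a)) r) * indicator {0<..} r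
        = ennreal (r * l r * k r) * indicator {0<..} r"
      by (auto simp: indicator_def)
  qed
  then show ?thesis by (subst nn_integral_radial) auto
qed

text \<open>Of the spare decay \<open>2 * e\<close>, one \<open>e\<close> absorbs the growth of the
  logarithms and the other makes \<open>r powr (- 1 - e)\<close> integrable. Near 0 the radial
  density \<open>r * l r\<close> is bounded.\<close>

lemma G_tail_finite:
  assumes e: "0 < e"
  shows "(\<integral>\<^sup>+x. ennreal (max 1 (norm x) powr (- 2 - 2 * e) * G (DIM('a)) (norm (x::'a::euclidean_space))) \<partial>lborel) < \<infinity>"
proof -
  obtain C where C: "C > 0" "\<And>r. r \<ge> 0 \<Longrightarrow> l r \<le> C * (1 + r) powr e"
    using l_growth[OF e] by auto
  have bound: "r * l r * max 1 r powr (- 2 - 2 * e) \<le> C * 2 powr e * (indicator {0..1} r + indicator {1..} r * r powr (- 1 - e))"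
    if r: "0 < r" for r
  proof -
    have "1 + r \<le> 2 * max 1 r" by simp
    then have "(1 + r) powr e \<le> (2 * max 1 r) powr e" using r e by (intro powr_mono2) auto
    then have "l r \<le> C * (2 powr e * max 1 r powr e)"
      using C(2)[of r] r C(1) by (intro order_trans[OF C(2)] mult_left_mono) (auto simp: powr_mult)
    then have "r * l r * max 1 r powr (- 2 - 2 * e) \<le> max 1 r * (C * (2 powr e * max 1 r powr e)) * max 1 r powr (- 2 - 2 * e)"
      using r l_pos[of r] by (intro mult_right_mono mult_mono) auto
    also have "\<dots> = C * 2 powr e * (max 1 r powr 1 * max 1 r powr e * max 1 r powr (- 2 - 2 * e))" by simp
    also have "max 1 r powr 1 * max 1 r powr e * max 1 r powr (- 2 - 2 * e) = max 1 r powr (- 1 - e)"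
      unfolding powr_add[symmetric] by simp
    also have "\<dots> \<le> indicator {0..1} r + indicator {1..} r * r powr (- 1 - e)"
      using r by (auto simp: indicator_def max_def)
    finally show ?thesis using C(1) by (simp add: mult_left_mono)
  qed
  have "(\<integral>\<^sup>+r\<in>{0<..}. ennreal (r * l r * max 1 r powr (- 2 - 2 * e)) \<partial>lborel)
      \<le> (\<integral>\<^sup>+r. ennreal (C * 2 powr e) * (indicator {0..1} r + ennreal (r powr (- 1 - e)) * indicator {1..} r) \<partial>lborel)"
  proof (rule nn_integral_mono)
    fix r :: real
    show "ennreal (r * l r * max 1 r powr (- 2 - 2 * e)) * indicator {0<..} r
      \<le> ennreal (C * 2 powr e) * (indicator {0..1} r + ennreal (r powr (- 1 - e)) * indicator {1..} r)"
      using ennreal_leI[OF bound[of r]] C(1)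
      by (auto simp: indicator_def ennreal_mult ennreal_plus[symmetric] simp del: ennreal_plus split: if_splits)
  qed
  also have "\<dots> = ennreal (C * 2 powr e) * (emeasure lborel {0..1::real} + (\<integral>\<^sup>+r\<in>{1..}. ennreal (r powr (- 1 - e)) \<partial>lborel))"
    by (subst nn_integral_cmult, measurable, subst nn_integral_add) auto
  also have "\<dots> < \<infinity>"
    using nn_integral_powr_at_top_finite[of 1 "- 1 - e"] e by (simp add: ennreal_mult_less_top)
  finally show ?thesis
    using nn_integral_radial_G[of "\<lambda>r. max 1 r powr (- 2 - 2 * e)", where 'a='a]
    by (simp add: ennreal_mult_less_top)
qed

text \<open>With \<open>c <= b\<close> the logarithms of the prior are dominated by those of the
  cutoffs, which is the hypothesis of \<open>w_square_integrable\<close>.\<close>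

lemma G_w_square_finite:
  assumes "log_scale n b" "c \<le> b"
  shows "(\<integral>\<^sup>+x. ennreal ((log_scale.w n b (norm x))\<^sup>2 * G (DIM('a)) (norm (x::'a::euclidean_space))) \<partial>lborel) < \<infinity>"
proof -
  interpret ls: log_scale n b by fact
  have "(\<integral>\<^sup>+r\<in>{0<..}. ennreal (r * l r * (ls.w r)\<^sup>2) \<partial>lborel) < \<infinity>"
  proof (rule ls.w_square_integrable)
    fix r :: real assume r: "0 < r"
    have "l r \<le> (\<Prod>i=1..n. (ln ^^ i) (r + b))"
      unfolding log_factor_def
    proof (rule prod_mono)
      fix i assume i: "i \<in> {1..n}"
      show "0 \<le> (ln ^^ i) (r + c) \<and> (ln ^^ i) (r + c) \<le> (ln ^^ i) (r + b)"
        using factor_mono[of r "r + (b - c)" i] i r assms(2) by auto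
    qed
    then have "r * l r \<le> (r + b) * (\<Prod>i=1..n. (ln ^^ i) (r + b))"
      using l_pos[of r] r ls.b_ge_1 by (intro mult_mono) auto
    then show "0 \<le> l r \<and> r * l r \<le> log_prod (n + 1) (r + b)"
      using l_pos[of r] r ls.log_prod_eq[of n "r + b"] by simp
  qed
  then show ?thesis
    using nn_integral_radial_G[of "\<lambda>r. (ls.w r)\<^sup>2", where 'a='a]
    by (simp add: ennreal_mult_less_top)
qed

end

section \<open>Comparison of the weighted norm with the Euclidean norm\<close>

lemma norm_le_weighted_norm:
  assumes "\<forall>i. 1 \<le> d $ i"
  shows "norm x \<le> weighted_norm d x"
  unfolding weighted_norm_def norm_vec_def L2_set_def real_norm_def
  using assms mult_mono[of 1 "(d $ i)\<^sup>2" "(x $ i)\<^sup>2" "(x $ i)\<^sup>2" for i]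
  by (intro real_sqrt_le_mono sum_mono) (simp add: mult_le_cancel_right1)

text \<open>Only comparability up to a constant matters later; the sum serves as a convenient bound
  for every weight.\<close>

lemma weighted_norm_le:
  assumes "\<forall>i. 1 \<le> d $ i"
  shows "weighted_norm d x \<le> (\<Sum>i\<in>UNIV. d $ i) * norm x"
proof -
  define D where "D = (\<Sum>i\<in>UNIV. d $ i)"
  have D: "0 \<le> d $ i" "d $ i \<le> D" for i
    using assms order_trans[OF zero_le_one] unfolding D_def by (auto intro!: member_le_sum)
  have "weighted_norm d x \<le> sqrt (\<Sum>i\<in>UNIV. D\<^sup>2 * (x $ i)\<^sup>2)"
    unfolding weighted_norm_def using D
    by (intro real_sqrt_le_mono sum_mono mult_right_mono power_mono) auto
  also have "\<dots> = D * norm x"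
    using D order_trans[OF D(1) D(2)] by (simp add: sum_distrib_left[symmetric] real_sqrt_mult norm_vec_def L2_set_def)
  finally show ?thesis by (simp add: D_def)
qed

lemma weighted_norm_measurable [measurable]: "weighted_norm d \<in> borel_measurable borel"
  unfolding weighted_norm_def[abs_def] by measurable

section \<open>Posterior means under reweighting\<close>

text \<open>With \<open>k\<close> an unnormalised posterior density this is a posterior mean. Stated
  for arbitrary \<open>k\<close>, it covers the prior and all its reweightings at once.\<close>

definition kernel_mean :: "('a::euclidean_space \<Rightarrow> real) \<Rightarrow> 'a" where
  "kernel_mean k = (LINT \<theta>|lborel. k \<theta> *\<^sub>R \<theta>) /\<^sub>R (LINT \<theta>|lborel. k \<theta>)"

lemma gen_bayes_eq_kernel_mean: "gen_bayes f g x = kernel_mean (\<lambda>\<theta>. f (norm (x - \<theta>)) * g \<theta>)"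
  by (simp add: gen_bayes_def kernel_mean_def)

locale kernel =
  fixes k :: "'a::euclidean_space \<Rightarrow> real"
  assumes nonneg: "0 \<le> k \<theta>"
    and integrable_k: "integrable lborel k"
    and integrable_sq: "integrable lborel (\<lambda>\<theta>. k \<theta> * (norm \<theta>)\<^sup>2)"
    and mass_pos: "0 < (LINT \<theta>|lborel. k \<theta>)"
begin

lemma measurable_k [measurable]: "k \<in> borel_measurable borel"
  using borel_measurable_integrable[OF integrable_k] by simp

lemma integrable_mean: "integrable lborel (\<lambda>\<theta>. k \<theta> *\<^sub>R \<theta>)"
proof (rule Bochner_Integration.integrable_bound)
  show "integrable lborel (\<lambda>\<theta>. k \<theta> + k \<theta> * (norm \<theta>)\<^sup>2)"
    using integrable_k integrable_sq by simp
  have "norm \<theta> \<le> 1 + (norm \<theta>)\<^sup>2" for \<theta> :: 'a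
    using zero_le_power2[of "norm \<theta> - 1/2"] by (simp add: power2_eq_square algebra_simps)
  then have "k \<theta> * norm \<theta> \<le> k \<theta> * (1 + (norm \<theta>)\<^sup>2)" for \<theta>
    using nonneg by (intro mult_left_mono)
  then show "AE \<theta> in lborel. norm (k \<theta> *\<^sub>R \<theta>) \<le> norm (k \<theta> + k \<theta> * (norm \<theta>)\<^sup>2)"
    using nonneg by (auto simp: algebra_simps)
qed measurable

lemma integral_mean: "(LINT \<theta>|lborel. k \<theta> *\<^sub>R \<theta>) = (LINT \<theta>|lborel. k \<theta>) *\<^sub>R kernel_mean k"
  using mass_pos by (simp add: kernel_mean_def)

lemma integral_centered: "(LINT \<theta>|lborel. k \<theta> *\<^sub>R (\<theta> - kernel_mean k)) = 0"
  using integrable_mean integrable_k integral_mean by (simp add: scaleR_diff_right)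

lemma integrable_sq_dist: "integrable lborel (\<lambda>\<theta>. k \<theta> * (norm (\<theta> - a))\<^sup>2)"
proof (rule Bochner_Integration.integrable_bound)
  show "integrable lborel (\<lambda>\<theta>. 2 * (k \<theta> * (norm \<theta>)\<^sup>2) + 2 * (norm a)\<^sup>2 * k \<theta>)"
    using integrable_k integrable_sq by simp
  have "(norm (\<theta> - a))\<^sup>2 \<le> 2 * (norm \<theta>)\<^sup>2 + 2 * (norm a)\<^sup>2" for \<theta>
  proof -
    have "(norm (\<theta> - a))\<^sup>2 \<le> (norm \<theta> + norm a)\<^sup>2"
      by (intro power_mono norm_triangle_ineq4) simp
    also have "\<dots> \<le> 2 * (norm \<theta>)\<^sup>2 + 2 * (norm a)\<^sup>2"
      using zero_le_power2[of "norm \<theta> - norm a"] by (simp add: power2_eq_square algebra_simps)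
    finally show ?thesis .
  qed
  then have "k \<theta> * (norm (\<theta> - a))\<^sup>2 \<le> k \<theta> * (2 * (norm \<theta>)\<^sup>2 + 2 * (norm a)\<^sup>2)" for \<theta>
    using nonneg by (intro mult_left_mono)
  then show "AE \<theta> in lborel. norm (k \<theta> * (norm (\<theta> - a))\<^sup>2) \<le> norm (2 * (k \<theta> * (norm \<theta>)\<^sup>2) + 2 * (norm a)\<^sup>2 * k \<theta>)"
    using nonneg by (auto simp: algebra_simps)
qed measurable

text \<open>The bias-variance identity: expanding about the mean, the cross term integrates to 0 by
  \<open>integral_centered\<close>. Leaving \<open>A\<close> general serves both the loss matrix and
  the plain squared norm.\<close>

lemma quadratic_decomposition:
  fixes A :: "'a \<Rightarrow> 'a"
  assumes A: "linear A" and sym: "\<And>x y. x \<bullet> A y = A x \<bullet> y" and psd: "\<And>x. 0 \<le> x \<bullet> A x"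
  shows "(\<integral>\<^sup>+\<theta>. ennreal (k \<theta> * ((a - \<theta>) \<bullet> A (a - \<theta>))) \<partial>lborel)
    = ennreal ((LINT \<theta>|lborel. k \<theta>) * ((a - kernel_mean k) \<bullet> A (a - kernel_mean k)))
      + (\<integral>\<^sup>+\<theta>. ennreal (k \<theta> * ((kernel_mean k - \<theta>) \<bullet> A (kernel_mean k - \<theta>))) \<partial>lborel)"
proof -
  let ?m = "kernel_mean k"
  define q where "q x = x \<bullet> A x" for x
  have bl: "bounded_linear A" using A by (simp add: linear_conv_bounded_linear)
  have [measurable]: "A \<in> borel_measurable borel"
    using bl by (intro borel_measurable_continuous_onI linear_continuous_on)
  have [measurable]: "q \<in> borel_measurable borel" unfolding q_def[abs_def] by measurable
  obtain K where K0: "0 \<le> K" and K: "\<And>x. norm (A x) \<le> norm x * K"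
    using bounded_linear.nonneg_bounded[OF bl] by blast
  have int_q: "integrable lborel (\<lambda>\<theta>. k \<theta> * q (b - \<theta>))" for b
  proof (rule Bochner_Integration.integrable_bound)
    show "integrable lborel (\<lambda>\<theta>. K * (k \<theta> * (norm (\<theta> - b))\<^sup>2))"
      by (intro integrable_mult_right integrable_sq_dist)
    have "\<bar>q (b - \<theta>)\<bar> \<le> K * (norm (\<theta> - b))\<^sup>2" for \<theta>
    proof -
      have "\<bar>q (b - \<theta>)\<bar> \<le> norm (b - \<theta>) * norm (A (b - \<theta>))"
        unfolding q_def by (rule Cauchy_Schwarz_ineq2)
      also have "\<dots> \<le> norm (b - \<theta>) * (norm (b - \<theta>) * K)" by (intro mult_left_mono K) simp
      finally show ?thesis by (simp add: power2_eq_square norm_minus_commute mult_ac)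
    qed
    then have "k \<theta> * \<bar>q (b - \<theta>)\<bar> \<le> k \<theta> * (K * (norm (\<theta> - b))\<^sup>2)" for \<theta>
      using nonneg by (intro mult_left_mono)
    then show "AE \<theta> in lborel. norm (k \<theta> * q (b - \<theta>)) \<le> norm (K * (k \<theta> * (norm (\<theta> - b))\<^sup>2))"
      using nonneg K0 by (auto simp: abs_mult mult_ac)
  qed measurable
  have eq: "k \<theta> * q (a - \<theta>) = k \<theta> * q (a - ?m) - 2 * (A (a - ?m) \<bullet> (k \<theta> *\<^sub>R (\<theta> - ?m))) + k \<theta> * q (?m - \<theta>)" for \<theta>
  proof -
    have "q (a - \<theta>) = q ((a - ?m) + (?m - \<theta>))" by simp
    also have "\<dots> = q (a - ?m) + 2 * (A (a - ?m) \<bullet> (?m - \<theta>)) + q (?m - \<theta>)"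
      unfolding q_def using sym[of "a - ?m" "?m - \<theta>"]
      by (simp only: linear_add[OF A] inner_add_left inner_add_right inner_commute[of "?m - \<theta>" "A (a - ?m)"])
    also have "A (a - ?m) \<bullet> (?m - \<theta>) = - (A (a - ?m) \<bullet> (\<theta> - ?m))"
      by (simp add: inner_diff_right)
    finally have *: "q (a - \<theta>) = q (a - ?m) + 2 * - (A (a - ?m) \<bullet> (\<theta> - ?m)) + q (?m - \<theta>)" .
    show ?thesis by (simp only: * inner_scaleR_right distrib_left mult.left_commute[of "k \<theta>"])
  qed
  have int_c: "integrable lborel (\<lambda>\<theta>. k \<theta> *\<^sub>R (\<theta> - ?m))"
    using integrable_mean integrable_k by (simp add: scaleR_diff_right)
  have int_A: "integrable lborel (\<lambda>\<theta>. A (a - ?m) \<bullet> (k \<theta> *\<^sub>R (\<theta> - ?m)))"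
    using int_c by (rule integrable_inner_right)
  have zero: "(LINT \<theta>|lborel. A (a - ?m) \<bullet> (k \<theta> *\<^sub>R (\<theta> - ?m))) = 0"
    using integral_inner_right[OF int_c, of "A (a - ?m)"] integral_centered by simp
  have "(LINT \<theta>|lborel. k \<theta> * q (a - \<theta>))
      = (LINT \<theta>|lborel. k \<theta>) * q (a - ?m) + (LINT \<theta>|lborel. k \<theta> * q (?m - \<theta>))"
    unfolding eq using int_A zero int_q[of ?m] integrable_k
    by (simp del: inner_scaleR_right)
  then show ?thesis
    unfolding q_def[symmetric]
    using int_q psd nonneg mass_pos
    by (simp add: nn_integral_eq_integral q_def[symmetric] ennreal_plus[symmetric] integral_nonneg_AE
        del: ennreal_plus)
qed

lemma sq_decomposition:
  "(\<integral>\<^sup>+\<theta>. ennreal (k \<theta> * (norm (a - \<theta>))\<^sup>2) \<partial>lborel)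
    = ennreal ((LINT \<theta>|lborel. k \<theta>) * (norm (a - kernel_mean k))\<^sup>2)
      + (\<integral>\<^sup>+\<theta>. ennreal (k \<theta> * (norm (kernel_mean k - \<theta>))\<^sup>2) \<partial>lborel)"
  using quadratic_decomposition[of "\<lambda>x. x" a] by (simp add: linear_id[unfolded id_def] dot_square_norm)

lemma norm_mean_diff_le:
  assumes "integrable lborel (\<lambda>\<theta>. k \<theta> * norm (\<theta> - x))" "(LINT \<theta>|lborel. k \<theta> * norm (\<theta> - x)) \<le> e * (LINT \<theta>|lborel. k \<theta>)"
  shows "norm (kernel_mean k - x) \<le> e"
proof -
  let ?I = "LINT \<theta>|lborel. k \<theta>"
  have eq: "?I *\<^sub>R (kernel_mean k - x) = (LINT \<theta>|lborel. k \<theta> *\<^sub>R (\<theta> - x))"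
    using integrable_mean integrable_k integral_mean by (simp add: scaleR_diff_right)
  have "?I * norm (kernel_mean k - x) = norm (?I *\<^sub>R (kernel_mean k - x))"
    using mass_pos by simp
  also have "\<dots> = norm (LINT \<theta>|lborel. k \<theta> *\<^sub>R (\<theta> - x))" by (simp only: eq)
  also have "\<dots> \<le> (LINT \<theta>|lborel. norm (k \<theta> *\<^sub>R (\<theta> - x)))" by (rule integral_norm_bound)
  also have "\<dots> \<le> ?I * e" using assms(2) nonneg by (simp add: mult.commute)
  finally show ?thesis using mass_pos by simp
qed

end

locale weighted_kernel = kernel k for k :: "'a::euclidean_space \<Rightarrow> real" +
  fixes h :: "'a \<Rightarrow> real"
  assumes measurable_h [measurable]: "h \<in> borel_measurable borel"
    and h_pos: "0 < h \<theta>" and h_le_1: "h \<theta> \<le> 1"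
begin

lemma h_sq: "0 \<le> (h \<theta>)\<^sup>2" "(h \<theta>)\<^sup>2 \<le> 1"
  using h_pos[of \<theta>] h_le_1[of \<theta>] by (auto simp: power_le_one)

lemma weighted_le: "k \<theta> * (h \<theta>)\<^sup>2 \<le> k \<theta>"
  using h_sq[of \<theta>] nonneg[of \<theta>] by (simp add: mult_left_le)

lemma integrable_weighted: "integrable lborel (\<lambda>\<theta>. k \<theta> * (h \<theta>)\<^sup>2)"
  by (rule Bochner_Integration.integrable_bound[OF integrable_k])
     (use weighted_le nonneg in auto)

sublocale weighted: kernel "\<lambda>\<theta>. k \<theta> * (h \<theta>)\<^sup>2"
proof
  show "integrable lborel (\<lambda>\<theta>. k \<theta> * (h \<theta>)\<^sup>2 * (norm \<theta>)\<^sup>2)"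
  proof (rule Bochner_Integration.integrable_bound[OF integrable_sq])
    show "AE \<theta> in lborel. norm (k \<theta> * (h \<theta>)\<^sup>2 * (norm \<theta>)\<^sup>2) \<le> norm (k \<theta> * (norm \<theta>)\<^sup>2)"
      using weighted_le nonneg by (auto intro!: mult_right_mono)
  qed measurable
  show "0 < (LINT \<theta>|lborel. k \<theta> * (h \<theta>)\<^sup>2)"
  proof (rule ccontr)
    assume "\<not> ?thesis"
    moreover have "0 \<le> (LINT \<theta>|lborel. k \<theta> * (h \<theta>)\<^sup>2)" using nonneg by (intro integral_nonneg_AE) auto
    ultimately have "AE \<theta> in lborel. k \<theta> * (h \<theta>)\<^sup>2 = 0"
      using integral_nonneg_eq_0_iff_AE[OF integrable_weighted] nonneg by auto
    \<comment> \<open>Strict positivity of the weight enters here: a vanishing reweighted mass would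
      force the original kernel to vanish almost everywhere.\<close>
    then have "AE \<theta> in lborel. k \<theta> = 0" using h_pos by (simp add: less_imp_neq[symmetric])
    then have "(LINT \<theta>|lborel. k \<theta>) = (LINT \<theta>|lborel. (0::real) * (norm (\<theta>::'a)))" by (intro integral_cong_AE) auto
    then show False using mass_pos by simp
  qed
qed (use nonneg integrable_weighted in auto)

lemma mean_shift_sq_le:
  "ennreal ((LINT \<theta>|lborel. k \<theta> * (h \<theta>)\<^sup>2) * (norm (kernel_mean k - kernel_mean (\<lambda>\<theta>. k \<theta> * (h \<theta>)\<^sup>2)))\<^sup>2)
    \<le> (\<integral>\<^sup>+\<theta>. ennreal (k \<theta> * (norm (x - \<theta>))\<^sup>2) \<partial>lborel)"
proof -
  let ?m = "kernel_mean k"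
  have "ennreal ((LINT \<theta>|lborel. k \<theta> * (h \<theta>)\<^sup>2) * (norm (?m - kernel_mean (\<lambda>\<theta>. k \<theta> * (h \<theta>)\<^sup>2)))\<^sup>2)
      \<le> (\<integral>\<^sup>+\<theta>. ennreal (k \<theta> * (h \<theta>)\<^sup>2 * (norm (?m - \<theta>))\<^sup>2) \<partial>lborel)"
    unfolding weighted.sq_decomposition[of ?m] by simp
  also have "\<dots> \<le> (\<integral>\<^sup>+\<theta>. ennreal (k \<theta> * (norm (?m - \<theta>))\<^sup>2) \<partial>lborel)"
    using weighted_le by (intro nn_integral_mono ennreal_leI mult_right_mono) auto
  also have "\<dots> \<le> (\<integral>\<^sup>+\<theta>. ennreal (k \<theta> * (norm (x - \<theta>))\<^sup>2) \<partial>lborel)"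
    unfolding sq_decomposition[of x] by simp
  finally show ?thesis .
qed

text \<open>Centering at the unweighted mean allows an arbitrary constant \<open>a\<close> to be subtracted from the
  weight.\<close>

lemma mean_shift_le:
  assumes e: "norm (kernel_mean k - x) \<le> e"
    and U: "integrable lborel U" "\<And>\<theta>. k \<theta> * (norm (\<theta> - x) + e) * \<bar>(h \<theta>)\<^sup>2 - a\<bar> \<le> U \<theta>"
  shows "(LINT \<theta>|lborel. k \<theta> * (h \<theta>)\<^sup>2) * norm (kernel_mean k - kernel_mean (\<lambda>\<theta>. k \<theta> * (h \<theta>)\<^sup>2)) \<le> (LINT \<theta>|lborel. U \<theta>)"
proof -
  let ?m = "kernel_mean k" and ?m' = "kernel_mean (\<lambda>\<theta>. k \<theta> * (h \<theta>)\<^sup>2)"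
  let ?I = "LINT \<theta>|lborel. k \<theta> * (h \<theta>)\<^sup>2"
  have i1: "integrable lborel (\<lambda>\<theta>. (k \<theta> * (h \<theta>)\<^sup>2) *\<^sub>R (\<theta> - ?m))"
    using weighted.integrable_mean weighted.integrable_k by (simp add: scaleR_diff_right)
  have i2: "integrable lborel (\<lambda>\<theta>. a *\<^sub>R (k \<theta> *\<^sub>R (\<theta> - ?m)))"
    using integrable_mean integrable_k
    by (intro integrable_scaleR_right) (simp add: scaleR_diff_right)
  have "?I *\<^sub>R (?m' - ?m) = (LINT \<theta>|lborel. (k \<theta> * (h \<theta>)\<^sup>2) *\<^sub>R (\<theta> - ?m))"
    using weighted.integrable_mean weighted.integrable_k weighted.integral_mean by (simp add: scaleR_diff_right)
  also have "\<dots> = (LINT \<theta>|lborel. (k \<theta> * (h \<theta>)\<^sup>2) *\<^sub>R (\<theta> - ?m)) - (LINT \<theta>|lborel. a *\<^sub>R (k \<theta> *\<^sub>R (\<theta> - ?m)))"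
    by (simp only: integral_scaleR_right integral_centered scaleR_zero_right diff_zero)
  also have "\<dots> = (LINT \<theta>|lborel. (k \<theta> * ((h \<theta>)\<^sup>2 - a)) *\<^sub>R (\<theta> - ?m))"
    unfolding Bochner_Integration.integral_diff[OF i1 i2, symmetric]
    by (intro Bochner_Integration.integral_cong refl)
       (simp only: scaleR_scaleR scaleR_left_diff_distrib[symmetric] right_diff_distrib mult.commute[of a])
  finally have eq: "?I *\<^sub>R (?m' - ?m) = (LINT \<theta>|lborel. (k \<theta> * ((h \<theta>)\<^sup>2 - a)) *\<^sub>R (\<theta> - ?m))" .
  have "?I * norm (?m - ?m') = norm (?I *\<^sub>R (?m' - ?m))"
    using weighted.mass_pos by (simp add: norm_minus_commute)
  also have "\<dots> = norm (LINT \<theta>|lborel. (k \<theta> * ((h \<theta>)\<^sup>2 - a)) *\<^sub>R (\<theta> - ?m))" by (simp only: eq)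
  also have "\<dots> \<le> (LINT \<theta>|lborel. norm ((k \<theta> * ((h \<theta>)\<^sup>2 - a)) *\<^sub>R (\<theta> - ?m)))"
    by (rule integral_norm_bound)
  also have "\<dots> \<le> (LINT \<theta>|lborel. U \<theta>)"
  proof (rule integral_mono'[OF U(1)])
    fix \<theta>
    have "norm (\<theta> - ?m) \<le> norm (\<theta> - x) + e"
      using norm_triangle_ineq4[of "\<theta> - x" "?m - x"] e by simp
    then have "k \<theta> * \<bar>(h \<theta>)\<^sup>2 - a\<bar> * norm (\<theta> - ?m) \<le> k \<theta> * \<bar>(h \<theta>)\<^sup>2 - a\<bar> * (norm (\<theta> - x) + e)"
      using nonneg by (intro mult_left_mono) auto
    then show "norm ((k \<theta> * ((h \<theta>)\<^sup>2 - a)) *\<^sub>R (\<theta> - ?m)) \<le> U \<theta>"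
      using U(2)[of \<theta>] nonneg[of \<theta>] by (simp add: abs_mult mult_ac)
    have "0 \<le> e" using e norm_ge_zero order_trans by blast
    then have "0 \<le> k \<theta> * (norm (\<theta> - x) + e) * \<bar>(h \<theta>)\<^sup>2 - a\<bar>" using nonneg by simp
    then show "0 \<le> U \<theta>" using U(2)[of \<theta>] by linarith
  qed
  finally show ?thesis .
qed

end

lemma (in kernel) weighted_limits:
  fixes h :: "nat \<Rightarrow> 'a \<Rightarrow> real"
  assumes wk: "\<And>i. weighted_kernel k (h i)" and lim: "\<And>\<theta>. (\<lambda>i. h i \<theta>) \<longlonglongrightarrow> 1"
  shows "(\<lambda>i. LINT \<theta>|lborel. k \<theta> * (h i \<theta>)\<^sup>2) \<longlonglongrightarrow> (LINT \<theta>|lborel. k \<theta>)"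
    and "(\<lambda>i. kernel_mean (\<lambda>\<theta>. k \<theta> * (h i \<theta>)\<^sup>2)) \<longlonglongrightarrow> kernel_mean k"
proof -
  have [measurable]: "h i \<in> borel_measurable borel" for i
    using weighted_kernel.measurable_h[OF wk] .
  have le: "k \<theta> * (h i \<theta>)\<^sup>2 \<le> k \<theta>" for i \<theta>
    using weighted_kernel.weighted_le[OF wk] .
  have sq: "(\<lambda>i. k \<theta> * (h i \<theta>)\<^sup>2) \<longlonglongrightarrow> k \<theta>" for \<theta>
    using tendsto_mult[OF tendsto_const[of "k \<theta>"] tendsto_power[OF lim[of \<theta>], of 2]] by simp
  show 1: "(\<lambda>i. LINT \<theta>|lborel. k \<theta> * (h i \<theta>)\<^sup>2) \<longlonglongrightarrow> (LINT \<theta>|lborel. k \<theta>)"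
    by (rule integral_dominated_convergence[where w = k])
       (use integrable_k sq le nonneg in auto)
  have "(\<lambda>i. LINT \<theta>|lborel. (k \<theta> * (h i \<theta>)\<^sup>2) *\<^sub>R \<theta>) \<longlonglongrightarrow> (LINT \<theta>|lborel. k \<theta> *\<^sub>R \<theta>)"
  proof (rule integral_dominated_convergence[where w = "\<lambda>\<theta>. norm (k \<theta> *\<^sub>R \<theta>)"])
    show "integrable lborel (\<lambda>\<theta>. norm (k \<theta> *\<^sub>R \<theta>))" using integrable_mean by (rule integrable_norm)
    show "AE \<theta> in lborel. (\<lambda>i. (k \<theta> * (h i \<theta>)\<^sup>2) *\<^sub>R \<theta>) \<longlonglongrightarrow> k \<theta> *\<^sub>R \<theta>"
      by (intro AE_I2 tendsto_scaleR sq tendsto_const)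
    show "AE \<theta> in lborel. norm ((k \<theta> * (h i \<theta>)\<^sup>2) *\<^sub>R \<theta>) \<le> norm (k \<theta> *\<^sub>R \<theta>)" for i
      using le nonneg by (auto intro!: mult_right_mono)
  qed measurable
  then show "(\<lambda>i. kernel_mean (\<lambda>\<theta>. k \<theta> * (h i \<theta>)\<^sup>2)) \<longlonglongrightarrow> kernel_mean k"
    unfolding kernel_mean_def using 1 mass_pos by (intro tendsto_scaleR tendsto_inverse) auto
qed

section \<open>Blyth's method\<close>

lemma borel_measurable_matrix_vector_mult [measurable (raw)]:
  fixes Q :: "real^'p^'q"
  assumes "F \<in> borel_measurable M"
  shows "(\<lambda>x. Q *v F x) \<in> borel_measurable M"
  using assms
  by (rule measurable_compose)
     (intro borel_measurable_continuous_onI linear_continuous_on matrix_vector_mul_bounded_linear)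

lemma pos_def_matrixD:
  assumes "pos_def_matrix Q"
  shows "x \<bullet> (Q *v y) = (Q *v x) \<bullet> y" "0 \<le> x \<bullet> (Q *v x)" "x \<bullet> (Q *v x) = 0 \<longleftrightarrow> x = 0"
proof -
  show "x \<bullet> (Q *v y) = (Q *v x) \<bullet> y"
    using assms by (metis pos_def_matrix_def dot_lmul_matrix vector_transpose_matrix)
  have "x \<noteq> 0 \<Longrightarrow> 0 < x \<bullet> (Q *v x)" using assms by (simp add: pos_def_matrix_def)
  then show "0 \<le> x \<bullet> (Q *v x)" "x \<bullet> (Q *v x) = 0 \<longleftrightarrow> x = 0"
    by (cases "x = 0"; force)+
qed

lemma quad_form_le: "\<exists>K\<ge>0. \<forall>x. x \<bullet> (Q *v x) \<le> K * (norm x)\<^sup>2"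
  for Q :: "real^'p^'p"
proof -
  obtain K where K: "0 \<le> K" "\<And>x. norm (Q *v x) \<le> norm x * K"
    using bounded_linear.nonneg_bounded[OF matrix_vector_mul_bounded_linear[of Q]] by blast
  have "x \<bullet> (Q *v x) \<le> K * (norm x)\<^sup>2" for x
  proof -
    have "x \<bullet> (Q *v x) \<le> norm x * norm (Q *v x)" by (rule norm_cauchy_schwarz)
    also have "\<dots> \<le> norm x * (norm x * K)" by (intro mult_left_mono K) simp
    finally show ?thesis by (simp add: power2_eq_square mult_ac)
  qed
  with K(1) show ?thesis by blast
qed

text \<open>By the parallelogram identity the two sides differ by the form at
  \<open>x - y\<close>.\<close>

lemma quad_form_add_le:
  assumes "pos_def_matrix Q"
  shows "(x + y) \<bullet> (Q *v (x + y)) \<le> 2 * (x \<bullet> (Q *v x)) + 2 * (y \<bullet> (Q *v y))"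
  using pos_def_matrixD(2)[OF assms, of "x - y"]
  by (simp add: inner_add_left inner_add_right inner_diff_left inner_diff_right
      matrix_vector_mult_diff_distrib matrix_vector_right_distrib)

section \<open>Translation and reflection, and the location model\<close>

lemma nn_integral_lborel_shift:
  fixes F :: "'a::euclidean_space \<Rightarrow> ennreal"
  assumes [measurable]: "F \<in> borel_measurable borel"
  shows "(\<integral>\<^sup>+x. F (x - a) \<partial>lborel) = (\<integral>\<^sup>+x. F x \<partial>lborel)"
proof -
  have "(\<integral>\<^sup>+x. F x \<partial>lborel) = (\<integral>\<^sup>+x. F x \<partial>distr lborel borel ((+) (- a)))"
    by (simp add: lborel_distr_plus)
  also have "\<dots> = (\<integral>\<^sup>+x. F (x - a) \<partial>lborel)"
    by (subst nn_integral_distr) simp_all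
  finally show ?thesis by simp
qed

lemma nn_integral_lborel_reflect:
  fixes F :: "'a::euclidean_space \<Rightarrow> ennreal"
  assumes [measurable]: "F \<in> borel_measurable borel"
  shows "(\<integral>\<^sup>+x. F (a - x) \<partial>lborel) = (\<integral>\<^sup>+x. F x \<partial>lborel)"
proof -
  have "(\<integral>\<^sup>+x. F x \<partial>lborel) = (\<integral>\<^sup>+x. F x \<partial>density (distr lborel borel (\<lambda>x. a + (- 1) *\<^sub>R x)) (\<lambda>_. 1))"
    using lborel_affine[of "- 1" a] by simp
  also have "\<dots> = (\<integral>\<^sup>+x. F (a - x) \<partial>lborel)"
    by (subst nn_integral_density, measurable, subst nn_integral_distr) simp_all
  finally show ?thesis by simp
qed

locale location_model =
  fixes f :: "real \<Rightarrow> real" and g :: "real^'p::finite \<Rightarrow> real"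
  assumes density: "location_density TYPE('p) f"
    and g_measurable [measurable]: "g \<in> borel_measurable borel"
    and g_nonneg: "0 \<le> g \<theta>"
begin

definition k :: "real^'p \<Rightarrow> real^'p \<Rightarrow> real" where
  "k x \<theta> = f (norm (x - \<theta>)) * g \<theta>"

lemma f_nonneg: "0 \<le> f (norm (y :: real^'p))"
  using density by (simp add: location_density_def)

lemma f_norm_measurable [measurable]: "(\<lambda>y::real^'p. f (norm y)) \<in> borel_measurable borel"
proof -
  have "(\<lambda>x::real^'p. f (norm (x - 0))) \<in> borel_measurable borel"
    using density unfolding location_density_def by blast
  then show ?thesis by simp
qed

lemma f_diff_measurable1 [measurable]: "(\<lambda>\<theta>. f (norm (x - \<theta> :: real^'p))) \<in> borel_measurable borel"
  by (rule measurable_compose[OF _ f_norm_measurable]) measurable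

lemma f_diff_measurable2 [measurable]: "(\<lambda>x. f (norm (x - \<theta> :: real^'p))) \<in> borel_measurable borel"
  by (rule measurable_compose[OF _ f_norm_measurable]) measurable

lemma f_total_mass: "(\<integral>\<^sup>+y. ennreal (f (norm (y :: real^'p))) \<partial>lborel) = 1"
proof -
  have "prob_space (sampling f (0 :: real^'p))" using density by (simp add: location_density_def)
  from prob_space.emeasure_space_1[OF this] show ?thesis
    by (simp add: sampling_def emeasure_density)
qed

lemma k_nonneg: "0 \<le> k x \<theta>"
  by (simp add: k_def f_nonneg g_nonneg)

lemma k_measurable [measurable (raw)]:
  assumes [measurable]: "F \<in> borel_measurable M" "H \<in> borel_measurable M"
  shows "(\<lambda>z. k (F z) (H z)) \<in> borel_measurable M"
proof -
  have "(\<lambda>z. f (norm (F z - H z))) \<in> borel_measurable M"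
    by (rule measurable_compose[OF _ f_norm_measurable]) measurable
  then show ?thesis unfolding k_def by measurable
qed

lemma risk_eq:
  fixes \<delta> :: "real^'p \<Rightarrow> real^'p"
  assumes [measurable]: "\<delta> \<in> borel_measurable borel"
  shows "risk f Q \<theta> \<delta> = (\<integral>\<^sup>+x. ennreal (f (norm (x - \<theta>))) * ennreal ((\<delta> x - \<theta>) \<bullet> (Q *v (\<delta> x - \<theta>))) \<partial>lborel)"
proof -
  show ?thesis unfolding risk_def sampling_def quad_loss_def
    by (subst nn_integral_density) simp_all
qed

lemma risk_cong_AE:
  fixes \<delta> :: "real^'p \<Rightarrow> real^'p"
  assumes [measurable]: "\<delta> \<in> borel_measurable borel" "\<delta>' \<in> borel_measurable borel"
    and "AE x in lborel. \<delta>' x = \<delta> x"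
  shows "risk f Q \<theta> \<delta>' = risk f Q \<theta> \<delta>"
  unfolding risk_eq[OF assms(1)] risk_eq[OF assms(2)]
  by (rule nn_integral_cong_AE) (use assms(3) in eventually_elim, simp)

lemma gen_bayes_measurable: "gen_bayes f g \<in> borel_measurable borel"
proof -
  have "(\<lambda>x. LINT \<theta>|lborel. k x \<theta> *\<^sub>R \<theta>) \<in> borel_measurable borel"
    by (rule lborel.borel_measurable_lebesgue_integral) (simp add: split_beta')
  moreover have "(\<lambda>x. LINT \<theta>|lborel. k x \<theta>) \<in> borel_measurable borel"
    by (rule lborel.borel_measurable_lebesgue_integral) (simp add: split_beta')
  ultimately show ?thesis unfolding gen_bayes_def[abs_def] k_def[symmetric] by measurable
qed

lemma nn_integral_risk:
  fixes \<delta> :: "real^'p \<Rightarrow> real^'p"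
  assumes [measurable]: "\<delta> \<in> borel_measurable borel"
  shows "(\<integral>\<^sup>+\<theta>. ennreal (g \<theta>) * risk f Q \<theta> \<delta> \<partial>lborel)
    = (\<integral>\<^sup>+x. (\<integral>\<^sup>+\<theta>. ennreal (k x \<theta>) * ennreal ((\<delta> x - \<theta>) \<bullet> (Q *v (\<delta> x - \<theta>))) \<partial>lborel) \<partial>lborel)"
proof -
  have "(\<integral>\<^sup>+\<theta>. ennreal (g \<theta>) * risk f Q \<theta> \<delta> \<partial>lborel)
      = (\<integral>\<^sup>+\<theta>. (\<integral>\<^sup>+x. ennreal (k x \<theta>) * ennreal ((\<delta> x - \<theta>) \<bullet> (Q *v (\<delta> x - \<theta>))) \<partial>lborel) \<partial>lborel)"
    unfolding risk_eq[OF assms]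
    by (intro nn_integral_cong, subst nn_integral_cmult[symmetric])
       (auto intro!: nn_integral_cong simp: k_def ennreal_mult f_nonneg g_nonneg mult_ac)
  also have "\<dots> = (\<integral>\<^sup>+x. (\<integral>\<^sup>+\<theta>. ennreal (k x \<theta>) * ennreal ((\<delta> x - \<theta>) \<bullet> (Q *v (\<delta> x - \<theta>))) \<partial>lborel) \<partial>lborel)"
    by (rule lborel_pair.Fubini') measurable
  finally show ?thesis .
qed

text \<open>Instead of contradicting a strict improvement through continuity of risk functions, the
  proof shows that any estimator \<open>\<delta>'\<close> at least as good as
  \<open>\<delta>\<close> equals it almost everywhere. Under each proper prior both are compared
  with the Bayes estimator \<open>\<delta>i\<close>; the excess of \<open>\<delta>\<close> tends to
  0, hence so does that of \<open>\<delta>'\<close>, and the two estimators are squeezed together.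
  Estimators equal almost everywhere have equal risks because the observation has a density.\<close>

theorem blyth:
  fixes Q :: "real^'p^'p" and h :: "nat \<Rightarrow> real^'p \<Rightarrow> real"
  assumes Q: "pos_def_matrix Q"
    and h_measurable [measurable]: "\<And>i. h i \<in> borel_measurable borel"
    and h_pos: "\<And>i \<theta>. 0 < h i \<theta>" and h_le_1: "\<And>i \<theta>. h i \<theta> \<le> 1"
    and h_lim: "\<And>\<theta>. (\<lambda>i. h i \<theta>) \<longlonglongrightarrow> 1"
    and kernel: "AE x in lborel. kernel (k x)"
    and prior_finite: "\<And>i. (\<integral>\<^sup>+\<theta>. ennreal (g \<theta> * (h i \<theta>)\<^sup>2) \<partial>lborel) < \<infinity>"
    and second_moment: "(\<integral>\<^sup>+y. ennreal (f (norm y) * (norm (y::real^'p))\<^sup>2) \<partial>lborel) < \<infinity>"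
    and Psi [measurable]: "Psi \<in> borel_measurable borel" and Psi_finite: "(\<integral>\<^sup>+x. Psi x \<partial>lborel) < \<infinity>"
    and dominated: "\<And>i. AE x in lborel. ennreal ((LINT \<theta>|lborel. k x \<theta> * (h i \<theta>)\<^sup>2) *
      (norm (kernel_mean (k x) - kernel_mean (\<lambda>\<theta>. k x \<theta> * (h i \<theta>)\<^sup>2)))\<^sup>2) \<le> Psi x"
  shows "admissible f Q (gen_bayes f g)"
proof -
  define \<delta> where "\<delta> = gen_bayes f g"
  define gi where "gi i \<theta> = g \<theta> * (h i \<theta>)\<^sup>2" for i \<theta>
  define \<delta>i where "\<delta>i i = gen_bayes f (gi i)" for i
  define mi where "mi i x = (LINT \<theta>|lborel. k x \<theta> * (h i \<theta>)\<^sup>2)" for i x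
  define q where "q u = u \<bullet> (Q *v u)" for u
  define V where "V i x = (\<integral>\<^sup>+\<theta>. ennreal (k x \<theta> * (h i \<theta>)\<^sup>2) * ennreal (q (\<delta>i i x - \<theta>)) \<partial>lborel)" for i x
  note q_nonneg = pos_def_matrixD(2)[OF Q, folded q_def]
  obtain K where K: "0 \<le> K" "\<And>u. q u \<le> K * (norm u)\<^sup>2"
    using quad_form_le[of Q] unfolding q_def by blast
  have [measurable]: "q \<in> borel_measurable borel" unfolding q_def[abs_def] by measurable
  have loc: "location_model f (gi i)" for i
    by unfold_locales (auto simp: gi_def[abs_def] density g_nonneg)
  have ki: "location_model.k f (gi i) x \<theta> = k x \<theta> * (h i \<theta>)\<^sup>2" for i x \<theta>
    by (simp add: location_model.k_def[OF loc] k_def gi_def)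
  have \<delta>i_eq: "\<delta>i i x = kernel_mean (\<lambda>\<theta>. k x \<theta> * (h i \<theta>)\<^sup>2)" for i x
    by (simp add: \<delta>i_def gen_bayes_eq_kernel_mean k_def gi_def mult_ac)
  have \<delta>_eq: "\<delta> x = kernel_mean (k x)" for x
    by (simp add: \<delta>_def gen_bayes_eq_kernel_mean k_def[abs_def])
  have \<delta>_m [measurable]: "\<delta> \<in> borel_measurable borel" unfolding \<delta>_def by (rule gen_bayes_measurable)
  have [measurable]: "\<delta>i i \<in> borel_measurable borel" for i
    unfolding \<delta>i_def by (rule location_model.gen_bayes_measurable[OF loc])
  have mi_m [measurable]: "mi i \<in> borel_measurable borel" for i
    unfolding mi_def[abs_def]
    by (rule lborel.borel_measurable_lebesgue_integral) (simp add: split_beta')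
  have V_m [measurable]: "V i \<in> borel_measurable borel" for i
    unfolding V_def[abs_def] by measurable
  have wk: "weighted_kernel (k x) (h i)" if "kernel (k x)" for i x
  proof -
    interpret kernel "k x" by fact
    show ?thesis by unfold_locales (auto simp: h_pos h_le_1)
  qed
  have mi_nonneg: "0 \<le> mi i x" for i x
    unfolding mi_def by (intro integral_nonneg_AE) (auto simp: k_nonneg)
  have decomp: "(\<integral>\<^sup>+\<theta>. ennreal (k x \<theta> * (h i \<theta>)\<^sup>2) * ennreal (q (a - \<theta>)) \<partial>lborel) = ennreal (mi i x * q (a - \<delta>i i x)) + V i x"
    if "kernel (k x)" for x i a
  proof -
    interpret weighted_kernel "k x" "h i" using wk[OF that] .
    have "linear ((*v) Q)" by (rule matrix_vector_mul_linear)
    from weighted.quadratic_decomposition[OF this pos_def_matrixD(1)[OF Q] pos_def_matrixD(2)[OF Q], of a]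
    show ?thesis
      unfolding V_def mi_def \<delta>i_eq q_def using k_nonneg
      by (simp add: ennreal_mult' [symmetric])
  qed
  have bayes: "(\<integral>\<^sup>+\<theta>. ennreal (gi i \<theta>) * risk f Q \<theta> d \<partial>lborel)
      = (\<integral>\<^sup>+x. ennreal (mi i x * q (d x - \<delta>i i x)) \<partial>lborel) + (\<integral>\<^sup>+x. V i x \<partial>lborel)"
    if [measurable]: "d \<in> borel_measurable borel" for d i
  proof -
    have "(\<integral>\<^sup>+\<theta>. ennreal (gi i \<theta>) * risk f Q \<theta> d \<partial>lborel)
       = (\<integral>\<^sup>+x. (\<integral>\<^sup>+\<theta>. ennreal (k x \<theta> * (h i \<theta>)\<^sup>2) * ennreal (q (d x - \<theta>)) \<partial>lborel) \<partial>lborel)"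
      unfolding location_model.nn_integral_risk[OF loc that] ki q_def ..
    also have "\<dots> = (\<integral>\<^sup>+x. ennreal (mi i x * q (d x - \<delta>i i x)) + V i x \<partial>lborel)"
      by (rule nn_integral_cong_AE) (use kernel in eventually_elim, rule decomp)
    also have "\<dots> = (\<integral>\<^sup>+x. ennreal (mi i x * q (d x - \<delta>i i x)) \<partial>lborel) + (\<integral>\<^sup>+x. V i x \<partial>lborel)"
      by (rule nn_integral_add) measurable
    finally show ?thesis .
  qed
  \<comment> \<open>The minimal Bayes risk is common to both estimators and must be finite to be
    cancelled. It is at most the Bayes risk of the estimator \<open>x\<close>, whose risk is bounded
    uniformly in \<open>\<theta>\<close> by the second moment of \<open>f\<close>.\<close>
  have V_finite: "(\<integral>\<^sup>+x. V i x \<partial>lborel) < \<infinity>" for i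
  proof -
    define S where "S = ennreal K * (\<integral>\<^sup>+y. ennreal (f (norm y) * (norm (y::real^'p))\<^sup>2) \<partial>lborel)"
    have "risk f Q \<theta> (\<lambda>x. x) \<le> S" for \<theta>
    proof -
      have "risk f Q \<theta> (\<lambda>x. x) \<le> (\<integral>\<^sup>+x. ennreal K * ennreal (f (norm (x - \<theta>)) * (norm (x - \<theta>))\<^sup>2) \<partial>lborel)"
        unfolding risk_eq[OF measurable_ident_sets[OF refl]]
        using K f_nonneg q_nonneg
        by (intro nn_integral_mono)
           (auto simp: ennreal_mult'[symmetric] q_def[symmetric] mult.left_commute[of K] intro!: ennreal_leI mult_left_mono)
      also have "\<dots> = ennreal K * (\<integral>\<^sup>+x. ennreal (f (norm (x - \<theta>)) * (norm (x - \<theta>))\<^sup>2) \<partial>lborel)"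
        by (rule nn_integral_cmult) measurable
      also have "\<dots> = S"
        unfolding S_def by (subst nn_integral_lborel_shift[where F = "\<lambda>y. ennreal (f (norm y) * (norm y)\<^sup>2)"]) simp_all
      finally show ?thesis .
    qed
    then have "(\<integral>\<^sup>+\<theta>. ennreal (gi i \<theta>) * risk f Q \<theta> (\<lambda>x. x) \<partial>lborel) \<le> (\<integral>\<^sup>+\<theta>. ennreal (gi i \<theta>) * S \<partial>lborel)"
      by (intro nn_integral_mono mult_left_mono) auto
    also have "\<dots> = (\<integral>\<^sup>+\<theta>. ennreal (gi i \<theta>) \<partial>lborel) * S"
      unfolding gi_def by (rule nn_integral_multc) measurable
    also have "\<dots> < \<infinity>"
      using prior_finite[of i] second_moment by (auto simp: gi_def S_def ennreal_mult_less_top)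
    finally have "(\<integral>\<^sup>+\<theta>. ennreal (gi i \<theta>) * risk f Q \<theta> (\<lambda>x. x) \<partial>lborel) < \<infinity>" .
    then show ?thesis by (subst (asm) bayes) auto
  qed
  have tendsto0: "(\<lambda>i. \<integral>\<^sup>+x. ennreal (mi i x * q (\<delta> x - \<delta>i i x)) \<partial>lborel) \<longlonglongrightarrow> (\<integral>\<^sup>+x. 0 \<partial>(lborel :: (real^'p) measure))"
  proof (rule nn_integral_dominated_convergence[where w = "\<lambda>x. ennreal K * Psi x"])
    show "AE x in lborel. ennreal (mi i x * q (\<delta> x - \<delta>i i x)) \<le> ennreal K * Psi x" for i
      using dominated[of i]
    proof eventually_elim
      case (elim x)
      have "mi i x * q (\<delta> x - \<delta>i i x) \<le> K * (mi i x * (norm (\<delta> x - \<delta>i i x))\<^sup>2)"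
        using mult_left_mono[OF K(2)[of "\<delta> x - \<delta>i i x"] mi_nonneg[of i x]] by (simp add: mult_ac)
      then have "ennreal (mi i x * q (\<delta> x - \<delta>i i x)) \<le> ennreal K * ennreal (mi i x * (norm (\<delta> x - \<delta>i i x))\<^sup>2)"
        using K(1) by (simp add: ennreal_mult'[symmetric] ennreal_leI)
      also have "\<dots> \<le> ennreal K * Psi x"
        using elim unfolding mi_def \<delta>_eq \<delta>i_eq by (rule mult_left_mono) simp
      finally show ?case .
    qed
    show "(\<integral>\<^sup>+x. ennreal K * Psi x \<partial>lborel) < \<infinity>"
      using Psi_finite by (subst nn_integral_cmult) (auto simp: ennreal_mult_less_top)
    show "AE x in lborel. (\<lambda>i. ennreal (mi i x * q (\<delta> x - \<delta>i i x))) \<longlonglongrightarrow> 0"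
      using kernel
    proof eventually_elim
      case (elim x)
      interpret kernel "k x" by fact
      note lims = weighted_limits[of h, OF wk[OF elim] h_lim]
      have "(\<lambda>i. K * (mi i x * (norm (\<delta> x - \<delta>i i x))\<^sup>2)) \<longlonglongrightarrow> K * ((LINT \<theta>|lborel. k x \<theta>) * (norm (\<delta> x - \<delta> x))\<^sup>2)"
        using lims unfolding mi_def \<delta>i_eq \<delta>_eq by (intro tendsto_intros)
      then have "(\<lambda>i. K * (mi i x * (norm (\<delta> x - \<delta>i i x))\<^sup>2)) \<longlonglongrightarrow> 0" by simp
      then have "(\<lambda>i. mi i x * q (\<delta> x - \<delta>i i x)) \<longlonglongrightarrow> 0"
        by (rule real_tendsto_sandwich[rotated 3, where f = "\<lambda>_. 0"])
           (auto simp: mi_nonneg q_nonneg mult.left_commute[of K] intro!: mult_left_mono K always_eventually)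
      then show ?case using tendsto_ennrealI by fastforce
    qed
  qed measurable
  have unique: "AE x in lborel. \<delta>' x = \<delta> x"
    if [measurable]: "\<delta>' \<in> borel_measurable borel" and dom: "\<And>\<theta>. risk f Q \<theta> \<delta>' \<le> risk f Q \<theta> \<delta>" for \<delta>'
  proof -
    have le: "(\<integral>\<^sup>+x. ennreal (mi i x * q (\<delta>' x - \<delta>i i x)) \<partial>lborel) \<le> (\<integral>\<^sup>+x. ennreal (mi i x * q (\<delta> x - \<delta>i i x)) \<partial>lborel)" for i
    proof -
      have "(\<integral>\<^sup>+\<theta>. ennreal (gi i \<theta>) * risk f Q \<theta> \<delta>' \<partial>lborel) \<le> (\<integral>\<^sup>+\<theta>. ennreal (gi i \<theta>) * risk f Q \<theta> \<delta> \<partial>lborel)"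
        by (intro nn_integral_mono mult_left_mono dom) simp
      then show ?thesis
        unfolding bayes[OF that(1)] bayes[OF \<delta>_m]
        using V_finite[of i] by (auto simp: add.commute[of _ "integral\<^sup>N lborel (V i)"] ennreal_add_left_cancel_le)
    qed
    have bound: "(\<integral>\<^sup>+x. ennreal (mi i x * q (\<delta>' x - \<delta> x)) \<partial>lborel) \<le> 4 * (\<integral>\<^sup>+x. ennreal (mi i x * q (\<delta> x - \<delta>i i x)) \<partial>lborel)" for i
    proof -
      have "(\<integral>\<^sup>+x. ennreal (mi i x * q (\<delta>' x - \<delta> x)) \<partial>lborel)
          \<le> (\<integral>\<^sup>+x. 2 * ennreal (mi i x * q (\<delta>' x - \<delta>i i x)) + 2 * ennreal (mi i x * q (\<delta> x - \<delta>i i x)) \<partial>lborel)"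
      proof (rule nn_integral_mono)
        fix x
        have neg: "q (\<delta>i i x - \<delta> x) = q (\<delta> x - \<delta>i i x)"
          by (simp add: q_def inner_diff_left inner_diff_right matrix_vector_mult_diff_distrib)
        have "q (\<delta>' x - \<delta> x) \<le> 2 * q (\<delta>' x - \<delta>i i x) + 2 * q (\<delta> x - \<delta>i i x)"
          using quad_form_add_le[OF Q, of "\<delta>' x - \<delta>i i x" "\<delta>i i x - \<delta> x"] neg by (simp add: q_def)
        then have "mi i x * q (\<delta>' x - \<delta> x) \<le> 2 * (mi i x * q (\<delta>' x - \<delta>i i x)) + 2 * (mi i x * q (\<delta> x - \<delta>i i x))"
          using mult_left_mono[OF _ mi_nonneg[of i x]] by (fastforce simp: algebra_simps)
        then have "ennreal (mi i x * q (\<delta>' x - \<delta> x)) \<le> ennreal (2 * (mi i x * q (\<delta>' x - \<delta>i i x)) + 2 * (mi i x * q (\<delta> x - \<delta>i i x)))"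
          by (rule ennreal_leI)
        also have "\<dots> = 2 * ennreal (mi i x * q (\<delta>' x - \<delta>i i x)) + 2 * ennreal (mi i x * q (\<delta> x - \<delta>i i x))"
          using mi_nonneg q_nonneg by (simp add: ennreal_mult)
        finally show "ennreal (mi i x * q (\<delta>' x - \<delta> x)) \<le> 2 * ennreal (mi i x * q (\<delta>' x - \<delta>i i x)) + 2 * ennreal (mi i x * q (\<delta> x - \<delta>i i x))" .
      qed
      also have "\<dots> = 2 * (\<integral>\<^sup>+x. ennreal (mi i x * q (\<delta>' x - \<delta>i i x)) \<partial>lborel) + 2 * (\<integral>\<^sup>+x. ennreal (mi i x * q (\<delta> x - \<delta>i i x)) \<partial>lborel)"
        by (simp add: nn_integral_add nn_integral_cmult)
      also have "\<dots> \<le> 2 * (\<integral>\<^sup>+x. ennreal (mi i x * q (\<delta> x - \<delta>i i x)) \<partial>lborel) + 2 * (\<integral>\<^sup>+x. ennreal (mi i x * q (\<delta> x - \<delta>i i x)) \<partial>lborel)"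
        by (intro add_right_mono mult_left_mono le) simp
      finally show ?thesis by (simp add: distrib_right[symmetric])
    qed
    \<comment> \<open>No integrable majorant is known for the competitor, so Fatou replaces
      dominated convergence here.\<close>
    have "(\<integral>\<^sup>+x. liminf (\<lambda>i. ennreal (mi i x * q (\<delta>' x - \<delta> x))) \<partial>lborel)
        \<le> liminf (\<lambda>i. \<integral>\<^sup>+x. ennreal (mi i x * q (\<delta>' x - \<delta> x)) \<partial>lborel)"
      by (rule nn_integral_liminf) measurable
    also have "\<dots> \<le> liminf (\<lambda>i. 4 * (\<integral>\<^sup>+x. ennreal (mi i x * q (\<delta> x - \<delta>i i x)) \<partial>lborel))"
      by (intro Liminf_mono always_eventually allI bound)
    also have "\<dots> = 4 * 0"
      using tendsto0 by (intro lim_imp_Liminf ennreal_tendsto_cmult) auto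
    finally have "(\<integral>\<^sup>+x. liminf (\<lambda>i. ennreal (mi i x * q (\<delta>' x - \<delta> x))) \<partial>lborel) = 0" by simp
    then have "AE x in lborel. liminf (\<lambda>i. ennreal (mi i x * q (\<delta>' x - \<delta> x))) = 0"
      by (subst (asm) nn_integral_0_iff_AE) auto
    with kernel show ?thesis
    proof eventually_elim
      case (elim x)
      interpret kernel "k x" by fact
      have "(\<lambda>i. ennreal (mi i x * q (\<delta>' x - \<delta> x))) \<longlonglongrightarrow> ennreal ((LINT \<theta>|lborel. k x \<theta>) * q (\<delta>' x - \<delta> x))"
        unfolding mi_def by (intro tendsto_ennrealI tendsto_intros weighted_limits(1)[of h, OF wk[OF elim(1)] h_lim])
      then have "ennreal ((LINT \<theta>|lborel. k x \<theta>) * q (\<delta>' x - \<delta> x)) = 0"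
        using lim_imp_Liminf[OF sequentially_bot] elim(2) by metis
      then have "q (\<delta>' x - \<delta> x) \<le> 0"
        using mass_pos by (auto simp: ennreal_eq_0_iff mult_le_0_iff)
      then show ?case using pos_def_matrixD(2,3)[OF Q, of "\<delta>' x - \<delta> x"] by (simp add: q_def)
    qed
  qed
  have "\<not> risk f Q \<theta> \<delta>' < risk f Q \<theta> \<delta>"
    if "\<delta>' \<in> borel_measurable borel" "\<forall>\<theta>. risk f Q \<theta> \<delta>' \<le> risk f Q \<theta> \<delta>" for \<delta>' \<theta>
  proof -
    have "risk f Q \<theta> \<delta>' = risk f Q \<theta> \<delta>"
      using that by (intro risk_cong_AE \<delta>_m unique) auto
    then show ?thesis by simp
  qed
  then show ?thesis
    unfolding admissible_def \<delta>_def[symmetric] using \<delta>_m by blast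
qed

end

section \<open>Domination of the excess risk\<close>

text \<open>Assumption (F1) enters with \<open>s = 3 + 4 e\<close>.\<close>

locale tail_model = location_model f g + log_scale n b
  for f :: "real \<Rightarrow> real" and g :: "real^'p::finite \<Rightarrow> real" and n :: nat and b :: real +
  fixes p r0 L e Cg kg :: real
  assumes p_def: "p = real CARD('p)" and e_pos: "0 < e" and r0: "1 \<le> r0" and L_pos: "0 < L"
    and f_tail: "\<And>r. r0 \<le> r \<Longrightarrow> f r \<le> L * r powr (- p - 3 - 4 * e)"
    and g_pos: "\<And>\<theta>. \<theta> \<noteq> 0 \<Longrightarrow> 0 < g \<theta>"
    and Cg: "1 \<le> Cg"
    and g_near: "\<And>x \<theta>. 1 \<le> norm x \<Longrightarrow> norm (x - \<theta>) \<le> norm x / 2 \<Longrightarrow> g \<theta> \<le> Cg * g x \<and> g x \<le> Cg * g \<theta>"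
    and kg: "0 < kg"
    and g_lower: "\<And>x. 1 \<le> norm x \<Longrightarrow> kg * norm x powr (2 - p) \<le> g x"
    and g_tail: "(\<integral>\<^sup>+\<theta>. ennreal (max 1 (norm \<theta>) powr (- 2 - 2 * e) * g \<theta>) \<partial>lborel) < \<infinity>"
    and g_w: "(\<integral>\<^sup>+\<theta>. ennreal ((w (norm \<theta>))\<^sup>2 * g \<theta>) \<partial>lborel) < \<infinity>"
begin

lemma p_ge_1: "1 \<le> p"
  using zero_less_card_finite[where 'a='p] by (simp add: p_def Suc_le_eq)

section \<open>Moments of the sampling density and the posterior kernels\<close>

lemma radial_tail_finite:
  assumes "0 < a" "0 < t"
  shows "(\<integral>\<^sup>+x. ennreal (norm (x::real^'p) powr (- p - t)) * indicator {a..} (norm x) \<partial>lborel) < \<infinity>"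
proof -
  have "(\<integral>\<^sup>+x. ennreal (norm (x::real^'p) powr (- p - t)) * indicator {a..} (norm x) \<partial>lborel)
    = ennreal (real DIM(real^'p) * unit_ball_vol (DIM(real^'p))) *
      (\<integral>\<^sup>+r\<in>{0<..}. ennreal (r ^ (DIM(real^'p) - 1)) * (ennreal (r powr (- p - t)) * indicator {a..} r) \<partial>lborel)"
    by (rule nn_integral_radial) measurable
  also have "(\<integral>\<^sup>+r\<in>{0<..}. ennreal (r ^ (DIM(real^'p) - 1)) * (ennreal (r powr (- p - t)) * indicator {a..} r) \<partial>lborel)
      = (\<integral>\<^sup>+r\<in>{a..}. ennreal (r powr (- 1 - t)) \<partial>lborel)"
  proof (rule nn_integral_cong)
    fix r :: real
    have "r ^ (CARD('p) - 1) * r powr (- p - t) = r powr (- 1 - t)" if "0 < r"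
    proof -
      have "r ^ (CARD('p) - 1) = r powr (p - 1)"
        using that p_ge_1 by (simp add: p_def powr_realpow[symmetric] of_nat_diff)
      then show ?thesis by (simp add: powr_add[symmetric])
    qed
    then show "ennreal (r ^ (DIM(real^'p) - 1)) * (ennreal (r powr (- p - t)) * indicator {a..} r) * indicator {0<..} r
        = ennreal (r powr (- 1 - t)) * indicator {a..} r"
      using assms(1) by (auto simp: indicator_def ennreal_mult[symmetric])
  qed
  also have "ennreal (real DIM(real^'p) * unit_ball_vol (DIM(real^'p))) * \<dots> < \<infinity>"
    using nn_integral_powr_at_top_finite[of a "- 1 - t"] assms by (simp add: ennreal_mult_less_top)
  finally show ?thesis .
qed

text \<open>The three powers come from the integrand of the mean shift: one from the distance of
  \<open>\<theta>\<close> to the posterior mean, one each from the difference and the sum of the two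
  cutoff values in \<open>h \<theta> ^ 2 - h x ^ 2\<close>.\<close>

definition \<phi> :: "real^'p \<Rightarrow> real" where "\<phi> y = f (norm y) * (1 + norm y) ^ 3"

lemma \<phi>_nonneg: "0 \<le> \<phi> y"
  by (simp add: \<phi>_def f_nonneg)

lemma \<phi>_measurable [measurable]: "\<phi> \<in> borel_measurable borel"
  unfolding \<phi>_def[abs_def] by measurable

text \<open>Below \<open>r0\<close> the cubic weight is bounded and \<open>f\<close> has mass 1;
  above, the weight uses up three powers of the tail and leaves a surplus of \<open>4 * e\<close>
  over the dimension.\<close>

lemma \<phi>_finite: "(\<integral>\<^sup>+y. ennreal (\<phi> y) \<partial>lborel) < \<infinity>"
proof -
  have bound: "ennreal (\<phi> y) \<le> ennreal ((1 + r0) ^ 3) * ennreal (f (norm y))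
      + ennreal (8 * L) * (ennreal (norm y powr (- p - 4 * e)) * indicator {r0..} (norm y))" for y :: "real^'p"
  proof (cases "norm y < r0")
    case True
    then have "\<phi> y \<le> (1 + r0) ^ 3 * f (norm y)"
      unfolding \<phi>_def using f_nonneg[of y]
      by (subst mult.commute, intro mult_right_mono power_mono) auto
    then have "ennreal (\<phi> y) \<le> ennreal ((1 + r0) ^ 3) * ennreal (f (norm y))"
      using r0 f_nonneg[of y] by (simp add: ennreal_mult[symmetric] ennreal_leI)
    then show ?thesis using True by simp
  next
    case False
    then have y: "r0 \<le> norm y" "0 < norm y" using r0 by auto
    have "\<phi> y \<le> (L * norm y powr (- p - 3 - 4 * e)) * (2 * norm y) ^ 3"
      unfolding \<phi>_def using f_tail[OF y(1)] y r0 f_nonneg[of y] L_pos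
      by (intro mult_mono power_mono) auto
    also have "\<dots> = 8 * L * (norm y powr (- p - 3 - 4 * e) * norm y powr 3)"
      using y by (simp add: power_mult_distrib)
    also have "norm y powr (- p - 3 - 4 * e) * norm y powr 3 = norm y powr (- p - 4 * e)"
      by (simp only: powr_add[symmetric]) simp
    finally have "ennreal (\<phi> y) \<le> ennreal (8 * L) * ennreal (norm y powr (- p - 4 * e))"
      using L_pos by (simp add: ennreal_mult[symmetric] ennreal_leI)
    then show ?thesis using y by (simp add: add_increasing)
  qed
  have "(\<integral>\<^sup>+y. ennreal (\<phi> y) \<partial>lborel) \<le> (\<integral>\<^sup>+y. ennreal ((1 + r0) ^ 3) * ennreal (f (norm (y::real^'p)))
      + ennreal (8 * L) * (ennreal (norm y powr (- p - 4 * e)) * indicator {r0..} (norm y)) \<partial>lborel)"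
    by (intro nn_integral_mono bound)
  also have "\<dots> = ennreal ((1 + r0) ^ 3) * 1
      + ennreal (8 * L) * (\<integral>\<^sup>+y. ennreal (norm (y::real^'p) powr (- p - 4 * e)) * indicator {r0..} (norm y) \<partial>lborel)"
    by (simp add: nn_integral_add nn_integral_cmult f_total_mass)
  also have "\<dots> < \<infinity>"
    using radial_tail_finite[of r0 "4 * e"] r0 e_pos by (simp add: ennreal_mult_less_top)
  finally show ?thesis .
qed

lemma \<phi>_reflect_integrable: "integrable lborel (\<lambda>\<theta>. \<phi> (x - \<theta>))"
  and \<phi>_reflect_integral: "(LINT \<theta>|lborel. \<phi> (x - \<theta>)) = (LINT y|lborel. \<phi> y)"
proof -
  have eq: "(\<integral>\<^sup>+\<theta>. ennreal (\<phi> (x - \<theta>)) \<partial>lborel) = (\<integral>\<^sup>+y. ennreal (\<phi> y) \<partial>lborel)"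
    by (rule nn_integral_lborel_reflect[of "\<lambda>y. ennreal (\<phi> y)"]) measurable
  show "integrable lborel (\<lambda>\<theta>. \<phi> (x - \<theta>))"
    using \<phi>_finite eq by (intro integrableI_nonneg) (auto simp: \<phi>_nonneg)
  show "(LINT \<theta>|lborel. \<phi> (x - \<theta>)) = (LINT y|lborel. \<phi> y)"
    by (simp add: integral_eq_nn_integral \<phi>_nonneg eq)
qed

text \<open>The share of the far contribution that depends on \<open>\<theta>\<close> alone: the
  prior, damped just enough by the tail of \<open>f\<close> to have finite mass.\<close>

definition k0 :: "real^'p \<Rightarrow> real" where "k0 \<theta> = max 1 (norm \<theta>) powr (- 2 - 2 * e) * g \<theta>"

lemma k0_nonneg: "0 \<le> k0 \<theta>"
  by (simp add: k0_def g_nonneg)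

lemma k0_measurable [measurable]: "k0 \<in> borel_measurable borel"
  unfolding k0_def[abs_def] by measurable

lemma k0_integrable: "integrable lborel k0"
  using g_tail by (intro integrableI_nonneg) (auto simp: k0_nonneg k0_def[symmetric])

lemma f_diff_total: "(\<integral>\<^sup>+\<theta>. ennreal (f (norm (x - \<theta> :: real^'p))) \<partial>lborel) = 1"
  using nn_integral_lborel_reflect[of "\<lambda>y. ennreal (f (norm y))" x] f_total_mass by simp

lemma f_diff_integrable: "integrable lborel (\<lambda>\<theta>. f (norm (x - \<theta> :: real^'p)))"
  using f_diff_total[of x] by (intro integrableI_nonneg) (auto simp: f_nonneg)

lemma second_moment: "(\<integral>\<^sup>+y. ennreal (f (norm y) * (norm (y::real^'p))\<^sup>2) \<partial>lborel) < \<infinity>"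
proof -
  have "(norm y)\<^sup>2 \<le> (1 + norm y) ^ 3" for y :: "real^'p"
  proof -
    have "(norm y)\<^sup>2 \<le> (1 + norm y)\<^sup>2" by (intro power_mono) auto
    also have "\<dots> \<le> (1 + norm y) ^ 3" by (intro power_increasing) auto
    finally show ?thesis .
  qed
  then have "(\<integral>\<^sup>+y. ennreal (f (norm y) * (norm (y::real^'p))\<^sup>2) \<partial>lborel) \<le> (\<integral>\<^sup>+y. ennreal (\<phi> y) \<partial>lborel)"
    unfolding \<phi>_def using f_nonneg by (intro nn_integral_mono ennreal_leI mult_left_mono) auto
  also have "\<dots> < \<infinity>" by (rule \<phi>_finite)
  finally show ?thesis .
qed

text \<open>Integrating out \<open>x\<close> over a ball first, the decay of \<open>f\<close> leaves a power of \<open>\<theta>\<close> against which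
  the prior is integrable.\<close>

lemma local_second_moment_finite:
  assumes \<rho>: "r0 \<le> \<rho>"
  shows "(\<integral>\<^sup>+x\<in>ball 0 \<rho>. (\<integral>\<^sup>+\<theta>. ennreal (k x \<theta> * (1 + (norm (x - \<theta>))\<^sup>2)) \<partial>lborel) \<partial>lborel) < \<infinity>"
proof -
  \<comment> \<open>\<open>D\<close> is the largest value of
    \<open>max 1 (norm \<theta>) powr (2 + 2 * e)\<close> allowed by
    \<open>norm \<theta> <= 2 * \<rho>\<close>, so a constant bound on \<open>J\<close> there can be
    written with the damping factor.\<close>
  define D where "D = (2 * \<rho>) powr (2 + 2 * e)"
  define M where "M = (\<integral>\<^sup>+y. ennreal (\<phi> y) \<partial>lborel)"
  define C where "C = M * ennreal D + ennreal (2 * L * 2 powr (p + 1 + 4 * e)) * emeasure lborel (ball (0::real^'p) \<rho>)"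
  have [measurable]: "ball (0::real^'p) \<rho> \<in> sets borel" by simp
  have \<rho>1: "1 \<le> \<rho>" using r0 \<rho> by simp
  have "emeasure lborel (ball (0::real^'p) \<rho>) < \<infinity>"
    using emeasure_bounded_finite[OF bounded_ball] by auto
  then have C_fin: "C < \<infinity>" using \<phi>_finite by (auto simp: C_def M_def ennreal_mult_less_top)
  define J where "J \<theta> = (\<integral>\<^sup>+x\<in>ball 0 \<rho>. ennreal (f (norm (x - \<theta>)) * (1 + (norm (x - \<theta>))\<^sup>2)) \<partial>lborel)" for \<theta> :: "real^'p"
  have sq_le: "1 + t\<^sup>2 \<le> (1 + t) ^ 3" if "0 \<le> t" for t :: real
    using that by (simp add: power3_eq_cube power2_eq_square algebra_simps)
  have J: "J \<theta> \<le> C * ennreal (max 1 (norm \<theta>) powr (- 2 - 2 * e))" for \<theta>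
  proof (cases "norm \<theta> < 2 * \<rho>")
    case True
    have "J \<theta> \<le> (\<integral>\<^sup>+x. ennreal (\<phi> (x - \<theta>)) \<partial>lborel)"
      unfolding J_def \<phi>_def using sq_le f_nonneg
      by (intro nn_integral_mono) (auto simp: indicator_def intro!: ennreal_leI mult_left_mono)
    also have "\<dots> = M"
      unfolding M_def by (rule nn_integral_lborel_shift) measurable
    finally have "J \<theta> \<le> M" .
    moreover have "1 \<le> D * max 1 (norm \<theta>) powr (- 2 - 2 * e)"
    proof -
      have "max 1 (norm \<theta>) powr (2 + 2 * e) \<le> D"
        unfolding D_def using True \<rho>1 e_pos by (intro powr_mono2) auto
      then have "max 1 (norm \<theta>) powr (2 + 2 * e) * max 1 (norm \<theta>) powr (- 2 - 2 * e) \<le> D * max 1 (norm \<theta>) powr (- 2 - 2 * e)"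
        by (intro mult_right_mono) auto
      also have "max 1 (norm \<theta>) powr (2 + 2 * e) * max 1 (norm \<theta>) powr (- 2 - 2 * e) = 1"
        by (simp only: powr_add[symmetric]) simp
      finally show ?thesis .
    qed
    then have "M * 1 \<le> M * ennreal (D * max 1 (norm \<theta>) powr (- 2 - 2 * e))"
      by (intro mult_left_mono) auto
    moreover have "M * ennreal (D * max 1 (norm \<theta>) powr (- 2 - 2 * e)) \<le> C * ennreal (max 1 (norm \<theta>) powr (- 2 - 2 * e))"
      unfolding C_def D_def by (auto simp: ennreal_mult mult.assoc[symmetric] distrib_right)
    ultimately show ?thesis by simp
  next
    \<comment> \<open>Now \<open>norm (x - \<theta>)\<close> is at least
      \<open>norm \<theta> / 2\<close>, hence at least \<open>r0\<close>, for every \<open>x\<close>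
      in the ball, and the tail bound on \<open>f\<close> applies.\<close>
    case False
    define t where "t = norm \<theta>"
    have t: "2 \<le> t" "2 * \<rho> \<le> t" using False \<rho>1 by (auto simp: t_def)
    have "f (norm (x - \<theta>)) * (1 + (norm (x - \<theta>))\<^sup>2) \<le> 2 * L * 2 powr (p + 1 + 4 * e) * max 1 t powr (- 2 - 2 * e)"
      if x: "norm x < \<rho>" for x
    proof -
      define y where "y = norm (x - \<theta>)"
      have y: "t / 2 \<le> y" using norm_triangle_ineq3[of \<theta> x] x t by (simp add: y_def t_def norm_minus_commute)
      then have y1: "1 \<le> y" "r0 \<le> y" using t \<rho> by auto
      have "1 \<le> y\<^sup>2" using y1 by (simp add: one_le_power)
      then have "f y * (1 + y\<^sup>2) \<le> (L * y powr (- p - 3 - 4 * e)) * (2 * y powr 2)"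
        using f_tail[OF y1(2)] y1 f_nonneg[of "x - \<theta>"] L_pos
        by (intro mult_mono) (auto simp: y_def)
      also have "\<dots> = 2 * L * (y powr (- p - 3 - 4 * e) * y powr 2)" by simp
      also have "y powr (- p - 3 - 4 * e) * y powr 2 = y powr (- (p + 1 + 4 * e))"
        by (simp only: powr_add[symmetric]) (simp add: algebra_simps)
      also have "\<dots> \<le> (t / 2) powr (- (p + 1 + 4 * e))"
        using y t p_ge_1 e_pos by (intro powr_mono2') auto
      also have "\<dots> = t powr (- (p + 1 + 4 * e)) / 2 powr (- (p + 1 + 4 * e))"
        by (rule powr_divide)
      also have "\<dots> = 2 powr (p + 1 + 4 * e) * t powr (- (p + 1 + 4 * e))"
        by (simp only: powr_minus[of 2] divide_inverse inverse_inverse_eq mult.commute)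
      \<comment> \<open>Two of the powers \<open>p + 1 + 4 * e\<close> are available in every
        dimension because \<open>1 <= p\<close>.\<close>
      also have "t powr (- (p + 1 + 4 * e)) \<le> t powr (- 2 - 2 * e)"
        using t p_ge_1 e_pos by (intro powr_mono) auto
      finally show ?thesis
        using t L_pos by (simp add: y_def mult_left_mono mult.assoc max_absorb2)
    qed
    then have "J \<theta> \<le> (\<integral>\<^sup>+x. ennreal (2 * L * 2 powr (p + 1 + 4 * e) * max 1 t powr (- 2 - 2 * e)) * indicator (ball 0 \<rho>) (x::real^'p) \<partial>lborel)"
      unfolding J_def by (intro nn_integral_mono) (auto simp: indicator_def intro!: ennreal_leI)
    also have "\<dots> = ennreal (2 * L * 2 powr (p + 1 + 4 * e)) * emeasure lborel (ball (0::real^'p) \<rho>) * ennreal (max 1 t powr (- 2 - 2 * e))"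
      using L_pos by (subst nn_integral_cmult_indicator) (auto simp: ennreal_mult mult_ac)
    also have "\<dots> \<le> C * ennreal (max 1 t powr (- 2 - 2 * e))"
      unfolding C_def by (intro mult_right_mono) auto
    finally show ?thesis by (simp add: t_def)
  qed
  have "(\<integral>\<^sup>+x\<in>ball 0 \<rho>. (\<integral>\<^sup>+\<theta>. ennreal (k x \<theta> * (1 + (norm (x - \<theta>))\<^sup>2)) \<partial>lborel) \<partial>lborel)
      = (\<integral>\<^sup>+x. (\<integral>\<^sup>+\<theta>. ennreal (k x \<theta> * (1 + (norm (x - \<theta>))\<^sup>2)) * indicator (ball 0 \<rho>) x \<partial>lborel) \<partial>lborel)"
    by (intro nn_integral_cong nn_integral_multc[symmetric]) measurable
  also have "\<dots> = (\<integral>\<^sup>+\<theta>. (\<integral>\<^sup>+x. ennreal (k x \<theta> * (1 + (norm (x - \<theta>))\<^sup>2)) * indicator (ball 0 \<rho>) x \<partial>lborel) \<partial>lborel)"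
    by (rule lborel_pair.Fubini') measurable
  also have "\<dots> = (\<integral>\<^sup>+\<theta>. ennreal (g \<theta>) * J \<theta> \<partial>lborel)"
    unfolding J_def
    by (intro nn_integral_cong, subst nn_integral_cmult[symmetric])
       (auto intro!: nn_integral_cong simp: k_def ennreal_mult f_nonneg g_nonneg mult_ac)
  also have "\<dots> \<le> (\<integral>\<^sup>+\<theta>. ennreal (g \<theta>) * (C * ennreal (max 1 (norm \<theta>) powr (- 2 - 2 * e))) \<partial>lborel)"
    by (intro nn_integral_mono mult_left_mono J) simp
  also have "\<dots> = (\<integral>\<^sup>+\<theta>. C * ennreal (k0 \<theta>) \<partial>lborel)"
    by (intro nn_integral_cong) (simp add: k0_def ennreal_mult g_nonneg mult_ac)
  also have "\<dots> = C * (\<integral>\<^sup>+\<theta>. ennreal (k0 \<theta>) \<partial>lborel)"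
    by (rule nn_integral_cmult) measurable
  also have "\<dots> < \<infinity>" using C_fin g_tail by (simp add: ennreal_mult_less_top k0_def)
  finally show ?thesis .
qed

lemma nn_integral_k_pos: "0 < (\<integral>\<^sup>+\<theta>. ennreal (k x \<theta>) \<partial>lborel)"
proof (rule ccontr)
  assume "\<not> ?thesis"
  then have "AE \<theta> in lborel. ennreal (k x \<theta>) = 0"
    by (subst nn_integral_0_iff_AE[symmetric]) auto
  with AE_lborel_singleton[of "0 :: real^'p"]
  have "AE \<theta> in lborel. ennreal (f (norm (x - \<theta>))) = 0"
  proof eventually_elim
    case (elim \<theta>)
    then show ?case using g_pos[of \<theta>] by (auto simp: k_def ennreal_eq_0_iff mult_le_0_iff)
  qed
  then have "(\<integral>\<^sup>+\<theta>. ennreal (f (norm (x - \<theta>))) \<partial>lborel) = 0"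
    by (subst nn_integral_0_iff_AE) auto
  then show False using f_diff_total[of x] by simp
qed

text \<open>A bound for each single \<open>x\<close> is out of reach, as \<open>f\<close> may be
  unbounded below \<open>r0\<close> and the prior singular at 0. Finite integrals over all balls
  give finiteness almost everywhere, and risks do not see null sets.\<close>

lemma kernel_AE: "AE x in lborel. kernel (k x)"
proof -
  have "AE x in lborel. x \<in> ball 0 (r0 + real N) \<longrightarrow> (\<integral>\<^sup>+\<theta>. ennreal (k x \<theta> * (1 + (norm (x - \<theta>))\<^sup>2)) \<partial>lborel) < \<infinity>" for N
  proof -
    have [measurable]: "ball (0::real^'p) (r0 + real N) \<in> sets borel" by simp
    have "AE x in lborel. (\<integral>\<^sup>+\<theta>. ennreal (k x \<theta> * (1 + (norm (x - \<theta>))\<^sup>2)) \<partial>lborel) * indicator (ball 0 (r0 + real N)) x \<noteq> \<infinity>"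
    proof (rule nn_integral_PInf_AE)
      show "(\<lambda>x. (\<integral>\<^sup>+\<theta>. ennreal (k x \<theta> * (1 + (norm (x - \<theta>))\<^sup>2)) \<partial>lborel) * indicator (ball 0 (r0 + real N)) x) \<in> borel_measurable lborel"
        by measurable
    qed (use local_second_moment_finite[of "r0 + real N"] in auto)
    then show ?thesis by eventually_elim (auto simp: less_top)
  qed
  then have "AE x in lborel. \<forall>N. x \<in> ball 0 (r0 + real N) \<longrightarrow> (\<integral>\<^sup>+\<theta>. ennreal (k x \<theta> * (1 + (norm (x - \<theta>))\<^sup>2)) \<partial>lborel) < \<infinity>"
    unfolding AE_all_countable by (rule allI)
  then show ?thesis
  proof eventually_elim
    case (elim x)
    obtain N :: nat where "norm x < real N" using reals_Archimedean2 by blast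
    then have "x \<in> ball 0 (r0 + real N)" using r0 by simp
    with elim have "(\<integral>\<^sup>+\<theta>. ennreal (k x \<theta> * (1 + (norm (x - \<theta>))\<^sup>2)) \<partial>lborel) < \<infinity>" by blast
    then have int: "integrable lborel (\<lambda>\<theta>. k x \<theta> * (1 + (norm (x - \<theta>))\<^sup>2))"
      by (intro integrableI_nonneg) (auto simp: k_nonneg)
    show ?case
    proof
      show int_k: "integrable lborel (k x)"
      proof (rule Bochner_Integration.integrable_bound[OF int])
        have "k x \<theta> * 1 \<le> k x \<theta> * (1 + (norm (x - \<theta>))\<^sup>2)" for \<theta>
          using k_nonneg by (intro mult_left_mono) auto
        then show "AE \<theta> in lborel. norm (k x \<theta>) \<le> norm (k x \<theta> * (1 + (norm (x - \<theta>))\<^sup>2))"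
          using k_nonneg[of x] by (simp add: abs_mult)
      qed measurable
      show "integrable lborel (\<lambda>\<theta>. k x \<theta> * (norm \<theta>)\<^sup>2)"
      proof (rule Bochner_Integration.integrable_bound)
        show "integrable lborel (\<lambda>\<theta>. 2 * (k x \<theta> * (1 + (norm (x - \<theta>))\<^sup>2)) + 2 * (norm x)\<^sup>2 * k x \<theta>)"
          using int int_k by simp
        have "(norm \<theta>)\<^sup>2 \<le> 2 * (1 + (norm (x - \<theta>))\<^sup>2) + 2 * (norm x)\<^sup>2" for \<theta>
        proof -
          have "(norm \<theta>)\<^sup>2 \<le> (norm (x - \<theta>) + norm x)\<^sup>2"
            using norm_triangle_sub[of \<theta> x] by (intro power_mono) (auto simp: norm_minus_commute)
          also have "\<dots> \<le> 2 * (norm (x - \<theta>))\<^sup>2 + 2 * (norm x)\<^sup>2"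
            using zero_le_power2[of "norm (x - \<theta>) - norm x"] by (simp add: power2_eq_square algebra_simps)
          finally show ?thesis by simp
        qed
        then have "k x \<theta> * (norm \<theta>)\<^sup>2 \<le> k x \<theta> * (2 * (1 + (norm (x - \<theta>))\<^sup>2) + 2 * (norm x)\<^sup>2)" for \<theta>
          using k_nonneg by (intro mult_left_mono)
        then show "AE \<theta> in lborel. norm (k x \<theta> * (norm \<theta>)\<^sup>2) \<le> norm (2 * (k x \<theta> * (1 + (norm (x - \<theta>))\<^sup>2)) + 2 * (norm x)\<^sup>2 * k x \<theta>)"
          using k_nonneg by (auto simp: algebra_simps)
      qed measurable
      show "0 < (LINT \<theta>|lborel. k x \<theta>)"
        using nn_integral_k_pos[of x] by (simp add: nn_integral_eq_integral[OF int_k] k_nonneg)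
    qed (rule k_nonneg)
  qed
qed

section \<open>Cutoffs on the parameter space, and estimates for near and far parameters\<close>

definition h :: "nat \<Rightarrow> real^'p \<Rightarrow> real" where "h i \<theta> = cutoff i (norm \<theta>)"

lemma h_measurable [measurable]: "h i \<in> borel_measurable borel"
  unfolding h_def[abs_def] by measurable

lemma w_le_h: "w (norm \<theta>) \<le> h i \<theta>"
  by (simp add: h_def cutoff_ge)

lemma h_pos: "0 < h i \<theta>"
  using w_le_h[of \<theta> i] w_pos[of "norm \<theta>"] by simp

lemma h_le_1: "h i \<theta> \<le> 1"
  by (simp add: h_def cutoff_le_1)

lemma h_tendsto: "(\<lambda>i. h i \<theta>) \<longlonglongrightarrow> 1"
  by (simp add: h_def cutoff_tendsto)

text \<open>Outside a ball depending on \<open>i\<close> the cutoff is \<open>w\<close>, and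
  \<open>g_w\<close> applies; inside, the prior has finite mass because the damping factor in
  \<open>k0\<close> is bounded away from 0 there.\<close>

lemma prior_finite: "(\<integral>\<^sup>+\<theta>. ennreal (g \<theta> * (h i \<theta>)\<^sup>2) \<partial>lborel) < \<infinity>"
proof -
  obtain R where R: "0 \<le> R" "\<And>r. R \<le> r \<Longrightarrow> cutoff i r = w r" using cutoff_eq_w[of i] by blast
  define D where "D = max 1 R powr (2 + 2 * e)"
  have "ennreal (g \<theta> * (h i \<theta>)\<^sup>2) \<le> ennreal ((w (norm \<theta>))\<^sup>2 * g \<theta>) + ennreal D * ennreal (k0 \<theta>)" for \<theta>
  proof (cases "R \<le> norm \<theta>")
    case True
    then show ?thesis by (simp add: h_def R(2) mult.commute)
  next
    case False
    have "max 1 (norm \<theta>) powr (2 + 2 * e) \<le> D"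
      unfolding D_def using False e_pos by (intro powr_mono2) auto
    then have "max 1 (norm \<theta>) powr (2 + 2 * e) * max 1 (norm \<theta>) powr (- 2 - 2 * e) \<le> D * max 1 (norm \<theta>) powr (- 2 - 2 * e)"
      by (intro mult_right_mono) auto
    also have "max 1 (norm \<theta>) powr (2 + 2 * e) * max 1 (norm \<theta>) powr (- 2 - 2 * e) = 1"
      by (simp only: powr_add[symmetric]) simp
    finally have "g \<theta> * 1 \<le> g \<theta> * (D * max 1 (norm \<theta>) powr (- 2 - 2 * e))"
      by (intro mult_left_mono g_nonneg)
    moreover have "g \<theta> * (h i \<theta>)\<^sup>2 \<le> g \<theta>"
      using h_le_1[of i \<theta>] h_pos[of i \<theta>] g_nonneg[of \<theta>] by (intro mult_left_le power_le_one) auto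
    ultimately have "g \<theta> * (h i \<theta>)\<^sup>2 \<le> D * k0 \<theta>"
      by (simp add: k0_def mult_ac)
    moreover have "0 \<le> D" by (simp add: D_def)
    ultimately have "ennreal (g \<theta> * (h i \<theta>)\<^sup>2) \<le> ennreal D * ennreal (k0 \<theta>)"
      using k0_nonneg by (simp add: ennreal_mult[symmetric] ennreal_leI)
    then show ?thesis by (simp add: add_increasing)
  qed
  then have "(\<integral>\<^sup>+\<theta>. ennreal (g \<theta> * (h i \<theta>)\<^sup>2) \<partial>lborel)
      \<le> (\<integral>\<^sup>+\<theta>. ennreal ((w (norm \<theta>))\<^sup>2 * g \<theta>) + ennreal D * ennreal (k0 \<theta>) \<partial>lborel)"
    by (intro nn_integral_mono)
  also have "\<dots> = (\<integral>\<^sup>+\<theta>. ennreal ((w (norm \<theta>))\<^sup>2 * g \<theta>) \<partial>lborel) + ennreal D * (\<integral>\<^sup>+\<theta>. ennreal (k0 \<theta>) \<partial>lborel)"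
    by (simp add: nn_integral_add nn_integral_cmult)
  also have "\<dots> < \<infinity>" using g_w g_tail by (simp add: ennreal_mult_less_top k0_def)
  finally show ?thesis .
qed

text \<open>The factor \<open>1 + |x - \<theta>|\<close> leaves the decay
  \<open>p + 2 + 4 * e\<close> in the distance, which dominates both \<open>|x|\<close> and
  \<open>|\<theta>|\<close> up to a constant. It is therefore split as
  \<open>(p + 2 * e) + (2 + 2 * e)\<close>: the first share is integrable in \<open>x\<close>, the
  second tames the prior.\<close>

lemma far_bound: "\<exists>C\<ge>0. \<forall>x \<theta>. 2 * r0 \<le> norm x \<longrightarrow> norm x / 2 < norm (x - \<theta>) \<longrightarrow>
    (1 + norm (x - \<theta>)) * k x \<theta> \<le> C * norm x powr (- p - 2 * e) * k0 \<theta>"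
proof (intro exI[of _ "2 * L * 3 powr (p + 2 + 4 * e)"] conjI allI impI)
  fix x \<theta> :: "real^'p"
  assume x: "2 * r0 \<le> norm x" and far: "norm x / 2 < norm (x - \<theta>)"
  define y where "y = norm (x - \<theta>)"
  define m where "m = max (norm x) (norm \<theta>)"
  have y: "r0 \<le> y" "1 \<le> y" using x far r0 by (auto simp: y_def)
  have "norm \<theta> \<le> norm x + y" using norm_triangle_sub[of \<theta> x] by (simp add: y_def norm_minus_commute)
  \<comment> \<open>\<open>|x| < 2 * y\<close>, so
    \<open>|\<theta>| <= |x| + y < 3 * y\<close>.\<close>
  then have my: "m / 3 \<le> y" using far y by (auto simp: m_def y_def)
  have m: "norm x \<le> m" "max 1 (norm \<theta>) \<le> m" "0 < m" "0 < norm x" using x r0 by (auto simp: m_def)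
  have "(1 + y) * f y \<le> (2 * y powr 1) * (L * y powr (- p - 3 - 4 * e))"
    using f_tail[OF y(1)] y f_nonneg[of "x - \<theta>"] L_pos by (intro mult_mono) (auto simp: y_def)
  also have "\<dots> = 2 * L * (y powr 1 * y powr (- p - 3 - 4 * e))" by simp
  also have "y powr 1 * y powr (- p - 3 - 4 * e) = y powr (- (p + 2 + 4 * e))"
    by (simp only: powr_add[symmetric]) (simp add: algebra_simps)
  also have "\<dots> \<le> (m / 3) powr (- (p + 2 + 4 * e))"
    using my m p_ge_1 e_pos by (intro powr_mono2') auto
  also have "\<dots> = m powr (- (p + 2 + 4 * e)) / 3 powr (- (p + 2 + 4 * e))"
    by (rule powr_divide)
  also have "\<dots> = 3 powr (p + 2 + 4 * e) * m powr (- (p + 2 + 4 * e))"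
    by (simp only: powr_minus[of 3] divide_inverse inverse_inverse_eq mult.commute)
  also have "m powr (- (p + 2 + 4 * e)) = m powr (- p - 2 * e) * m powr (- 2 - 2 * e)"
    by (simp only: powr_add[symmetric]) (simp add: algebra_simps)
  also have "\<dots> \<le> norm x powr (- p - 2 * e) * max 1 (norm \<theta>) powr (- 2 - 2 * e)"
    using m p_ge_1 e_pos by (intro mult_mono powr_mono2') auto
  finally have "(1 + y) * f y \<le> 2 * L * (3 powr (p + 2 + 4 * e) * (norm x powr (- p - 2 * e) * max 1 (norm \<theta>) powr (- 2 - 2 * e)))"
    using L_pos by (simp add: mult_left_mono)
  from mult_right_mono[OF this g_nonneg[of \<theta>]]
  show "(1 + norm (x - \<theta>)) * k x \<theta> \<le> 2 * L * 3 powr (p + 2 + 4 * e) * norm x powr (- p - 2 * e) * k0 \<theta>"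
    by (simp add: k_def k0_def y_def mult_ac)
qed (use L_pos in auto)

lemma near_bound:
  assumes "1 \<le> norm x" "norm (x - \<theta>) \<le> norm x / 2"
  shows "(1 + norm (x - \<theta>)) ^ 3 * k x \<theta> \<le> Cg * g x * \<phi> (x - \<theta>)"
proof -
  have "f (norm (x - \<theta>)) * g \<theta> \<le> f (norm (x - \<theta>)) * (Cg * g x)"
    using g_near[OF assms] f_nonneg by (intro mult_left_mono) auto
  from mult_left_mono[OF this, of "(1 + norm (x - \<theta>)) ^ 3"]
  show ?thesis by (simp add: k_def \<phi>_def mult_ac)
qed

text \<open>Translation invariance makes one radius work for every \<open>x\<close>; it localises
  the lower bounds on posterior masses.\<close>

lemma half_mass: "\<exists>R>0. \<forall>x. 1 / 2 \<le> (LINT \<theta>|lborel. f (norm (x - \<theta> :: real^'p)) * indicator {..R} (norm (x - \<theta>)))"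
proof -
  have "(\<lambda>N. LINT y|lborel. f (norm (0 - y :: real^'p)) * indicator {..real N} (norm (0 - y)))
      \<longlonglongrightarrow> (LINT y|lborel. f (norm (0 - y :: real^'p)))"
  proof (rule integral_dominated_convergence[where w = "\<lambda>y. f (norm (0 - y))"])
    show "AE y in lborel. (\<lambda>N. f (norm (0 - y :: real^'p)) * indicator {..real N} (norm (0 - y))) \<longlonglongrightarrow> f (norm (0 - y))"
    proof (intro AE_I2 tendsto_eventually)
      fix y :: "real^'p"
      obtain N0 where "norm y \<le> real N0" using real_arch_simple by blast
      then show "eventually (\<lambda>N. f (norm (0 - y)) * indicator {..real N} (norm (0 - y)) = f (norm (0 - y))) sequentially"
        by (intro eventually_sequentiallyI[of N0]) auto
    qed
  qed (use f_diff_integrable[of 0] f_nonneg in \<open>auto simp: indicator_def\<close>)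
  moreover have "(LINT y|lborel. f (norm (0 - y :: real^'p))) = 1"
    using f_diff_total[of 0] by (simp add: integral_eq_nn_integral f_nonneg)
  ultimately have "(\<lambda>N. LINT y|lborel. f (norm (0 - y :: real^'p)) * indicator {..real N} (norm (0 - y))) \<longlonglongrightarrow> 1"
    by (simp only:)
  then have "eventually (\<lambda>N. 1 / 2 < (LINT y|lborel. f (norm (0 - y :: real^'p)) * indicator {..real N} (norm (0 - y)))) sequentially"
    by (rule order_tendstoD(1)) simp
  then obtain N where N: "\<And>M. N \<le> M \<Longrightarrow> 1 / 2 < (LINT y|lborel. f (norm (0 - y :: real^'p)) * indicator {..real M} (norm (0 - y)))"
    by (auto simp: eventually_sequentially)
  \<comment> \<open>\<open>Suc N\<close> keeps the radius positive.\<close>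
  define F where "F y = f (norm y) * indicator {..real (Suc N)} (norm y)" for y :: "real^'p"
  have [measurable]: "F \<in> borel_measurable borel" unfolding F_def[abs_def] by measurable
  have F: "0 \<le> F y" for y by (simp add: F_def f_nonneg)
  have "(LINT \<theta>|lborel. F (x - \<theta>)) = enn2real (\<integral>\<^sup>+y. ennreal (F y) \<partial>lborel)" for x
    using nn_integral_lborel_reflect[of "\<lambda>y. ennreal (F y)" x] F by (simp add: integral_eq_nn_integral)
  then have "(LINT \<theta>|lborel. F (x - \<theta>)) = (LINT \<theta>|lborel. F (0 - \<theta>))" for x by (simp only:)
  then show ?thesis
    using N[of "Suc N"] unfolding F_def
    by (intro exI[of _ "real (Suc N)"]) (simp only: of_nat_0_less_iff zero_less_Suc, auto)
qed

lemma norm_powr_le_g: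
  assumes "1 \<le> norm x"
  shows "norm x powr (- p - 2 * e) \<le> g x / kg"
proof -
  have "norm x powr (- p - 2 * e) \<le> norm x powr (2 - p)"
    using assms e_pos by (intro powr_mono) auto
  then show ?thesis using g_lower[OF assms] kg by (simp add: field_simps mult_left_mono order_trans)
qed

text \<open>Divided by a posterior mass of at least \<open>g x / (2 * Cg)\<close>, this keeps the
  posterior mean within a fixed distance of \<open>x\<close>. The far part is absorbed because
  \<open>|x| powr (- p - 2 * e)\<close> is below a multiple of \<open>g x\<close>.\<close>

lemma first_moment:
  "\<exists>C\<ge>0. \<forall>x. 2 * r0 \<le> norm x \<longrightarrow> integrable lborel (\<lambda>\<theta>. k x \<theta> * norm (\<theta> - x))
     \<and> (LINT \<theta>|lborel. k x \<theta> * norm (\<theta> - x)) \<le> C * g x"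
proof -
  obtain C where C: "0 \<le> C" "\<And>x \<theta>. 2 * r0 \<le> norm x \<Longrightarrow> norm x / 2 < norm (x - \<theta>) \<Longrightarrow>
      (1 + norm (x - \<theta>)) * k x \<theta> \<le> C * norm x powr (- p - 2 * e) * k0 \<theta>"
    using far_bound by blast
  define M where "M = (LINT y|lborel. \<phi> y)"
  define K0 where "K0 = (LINT \<theta>|lborel. k0 \<theta>)"
  have "0 \<le> M" "0 \<le> K0" by (auto simp: M_def K0_def \<phi>_nonneg k0_nonneg intro!: integral_nonneg_AE)
  note nonneg = this
  have "integrable lborel (\<lambda>\<theta>. k x \<theta> * norm (\<theta> - x)) \<and> (LINT \<theta>|lborel. k x \<theta> * norm (\<theta> - x)) \<le> (Cg * M + C * K0 / kg) * g x"
    if x: "2 * r0 \<le> norm x" for x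
  proof -
    have x1: "1 \<le> norm x" using x r0 by simp
    define T where "T = C * norm x powr (- p - 2 * e)"
    define U where "U \<theta> = Cg * g x * \<phi> (x - \<theta>) + T * k0 \<theta>" for \<theta>
    have T: "0 \<le> T" using C(1) by (simp add: T_def)
    have le: "k x \<theta> * norm (\<theta> - x) \<le> U \<theta>" for \<theta>
    proof (cases "norm (x - \<theta>) \<le> norm x / 2")
      case True
      have "norm (x - \<theta>) \<le> 1 + norm (x - \<theta>)" by simp
      also have "\<dots> \<le> (1 + norm (x - \<theta>)) ^ 3" using power_increasing[of 1 3 "1 + norm (x - \<theta>)"] by simp
      finally have "k x \<theta> * norm (x - \<theta>) \<le> k x \<theta> * (1 + norm (x - \<theta>)) ^ 3"
        by (intro mult_left_mono k_nonneg)
      also have "\<dots> \<le> Cg * g x * \<phi> (x - \<theta>)" using near_bound[OF x1 True] by (simp add: mult.commute)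
      finally show ?thesis
        using T k0_nonneg[of \<theta>] by (simp add: U_def norm_minus_commute add_increasing2)
    next
      case False
      have "norm (x - \<theta>) * k x \<theta> \<le> (1 + norm (x - \<theta>)) * k x \<theta>"
        by (intro mult_right_mono k_nonneg) simp
      also have "\<dots> \<le> T * k0 \<theta>" using C(2)[OF x] False by (simp add: T_def)
      finally show ?thesis
        using Cg g_nonneg[of x] \<phi>_nonneg[of "x - \<theta>"]
        by (simp add: U_def norm_minus_commute mult.commute add_increasing)
    qed
    have int_U: "integrable lborel U"
      unfolding U_def[abs_def] using \<phi>_reflect_integrable[of x] k0_integrable by simp
    have "(LINT \<theta>|lborel. U \<theta>) = Cg * g x * M + T * K0"
      unfolding U_def M_def K0_def using \<phi>_reflect_integrable[of x] k0_integrable \<phi>_reflect_integral[of x] by simp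
    moreover have "T * K0 \<le> (C * (g x / kg)) * K0"
      unfolding T_def using C(1) norm_powr_le_g[OF x1] nonneg by (intro mult_right_mono mult_left_mono) auto
    moreover have "integrable lborel (\<lambda>\<theta>. k x \<theta> * norm (\<theta> - x))"
    proof (rule Bochner_Integration.integrable_bound[OF int_U])
      show "AE \<theta> in lborel. norm (k x \<theta> * norm (\<theta> - x)) \<le> norm (U \<theta>)"
        using le k_nonneg by (intro AE_I2) (simp add: abs_mult order_trans[OF _ abs_ge_self])
    qed measurable
    moreover have "(LINT \<theta>|lborel. k x \<theta> * norm (\<theta> - x)) \<le> (LINT \<theta>|lborel. U \<theta>)"
      by (intro integral_mono' int_U le) (meson le k_nonneg mult_nonneg_nonneg norm_ge_zero order_trans)
    ultimately show ?thesis by (simp add: algebra_simps)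
  qed
  moreover have "0 \<le> Cg * M + C * K0 / kg" using Cg C(1) nonneg kg by simp
  ultimately show ?thesis by blast
qed

text \<open>Only parameters within \<open>R\<close> of \<open>x\<close> are counted;
  \<open>2 * R <= norm x\<close> makes them near, so the prior there is at least
  \<open>g x / Cg\<close>, and they carry half of the sampling mass. It is used with
  \<open>u = 1\<close> and with \<open>u\<close> the squared cutoff.\<close>

lemma mass_lower:
  assumes R: "0 < R" "\<forall>x. 1 / 2 \<le> (LINT \<theta>|lborel. f (norm (x - \<theta> :: real^'p)) * indicator {..R} (norm (x - \<theta>)))"
    and x: "1 \<le> norm x" "2 * R \<le> norm x"
    and u: "integrable lborel (\<lambda>\<theta>. k x \<theta> * u \<theta>)" "\<And>\<theta>. 0 \<le> u \<theta>" "\<And>\<theta>. norm (x - \<theta>) \<le> R \<Longrightarrow> \<beta> \<le> u \<theta>" and "0 \<le> \<beta>"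
  shows "\<beta> * g x / (2 * Cg) \<le> (LINT \<theta>|lborel. k x \<theta> * u \<theta>)"
proof -
  have "(\<beta> * g x / Cg) * (1 / 2) \<le> (\<beta> * g x / Cg) * (LINT \<theta>|lborel. f (norm (x - \<theta>)) * indicator {..R} (norm (x - \<theta>)))"
    using R(2) \<open>0 \<le> \<beta>\<close> g_nonneg[of x] Cg by (intro mult_left_mono) auto
  also have "\<dots> = (LINT \<theta>|lborel. (\<beta> * g x / Cg) * (f (norm (x - \<theta>)) * indicator {..R} (norm (x - \<theta>))))"
    by simp
  also have "\<dots> \<le> (LINT \<theta>|lborel. k x \<theta> * u \<theta>)"
  proof (rule integral_mono'[OF u(1)])
    fix \<theta>
    show "0 \<le> k x \<theta> * u \<theta>" using k_nonneg u(2) by simp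
    show "(\<beta> * g x / Cg) * (f (norm (x - \<theta>)) * indicator {..R} (norm (x - \<theta>))) \<le> k x \<theta> * u \<theta>"
    proof (cases "norm (x - \<theta>) \<le> R")
      case True
      then have "g x / Cg \<le> g \<theta>" using g_near[of x \<theta>] x Cg by (simp add: divide_le_eq mult.commute)
      then have "g x / Cg * \<beta> \<le> g \<theta> * u \<theta>"
        using u(3)[OF True] \<open>0 \<le> \<beta>\<close> g_nonneg by (intro mult_mono) auto
      from mult_left_mono[OF this f_nonneg[of "x - \<theta>"]] show ?thesis
        using True by (simp add: k_def mult_ac)
    qed (use k_nonneg u(2) in auto)
  qed
  finally show ?thesis by simp
qed

text \<open>The point \<open>z0\<close> only supplies a radius below both norms; it will be
  \<open>x / 2\<close> or \<open>\<theta> / 2\<close>, depending on which of the two cutoff values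
  is to control the difference.\<close>

lemma h_diff_le:
  assumes "norm z0 \<le> norm x" "norm z0 \<le> norm \<theta>"
  shows "\<bar>h i \<theta> - h i x\<bar> \<le> real (n + 2) * w (norm z0) * norm (x - \<theta>)"
proof -
  have "\<bar>h i \<theta> - h i x\<bar> \<le> real (n + 2) * w (norm z0) * \<bar>norm \<theta> - norm x\<bar>"
    unfolding h_def using assms by (intro cutoff_diff_le) auto
  also have "\<dots> \<le> real (n + 2) * w (norm z0) * norm (x - \<theta>)"
    using w_pos[of "norm z0"] norm_triangle_ineq3[of \<theta> x]
    by (intro mult_left_mono) (auto simp: norm_minus_commute)
  finally show ?thesis .
qed

text \<open>The floor \<open>w \<le> h\<close> absorbs the second-order term of \<open>h\<^sup>2\<close>, so that only third moments of \<open>f\<close>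
  are needed.\<close>

lemma domination:
  "\<exists>\<rho>\<ge>r0. \<exists>C\<ge>0. \<forall>x i. \<rho> \<le> norm x \<longrightarrow> kernel (k x) \<longrightarrow>
    (LINT \<theta>|lborel. k x \<theta> * (h i \<theta>)\<^sup>2) * (norm (kernel_mean (k x) - kernel_mean (\<lambda>\<theta>. k x \<theta> * (h i \<theta>)\<^sup>2)))\<^sup>2
    \<le> C * ((w (norm x))\<^sup>2 * g x + norm x powr (- p - 2 * e))"
proof -
  obtain R where R: "0 < R" "\<forall>x. 1 / 2 \<le> (LINT \<theta>|lborel. f (norm (x - \<theta> :: real^'p)) * indicator {..R} (norm (x - \<theta>)))"
    using half_mass by blast
  obtain C1 where C1: "0 \<le> C1" "\<And>x \<theta>. 2 * r0 \<le> norm x \<Longrightarrow> norm x / 2 < norm (x - \<theta>) \<Longrightarrow>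
      (1 + norm (x - \<theta>)) * k x \<theta> \<le> C1 * norm x powr (- p - 2 * e) * k0 \<theta>"
    using far_bound by blast
  obtain C2 where C2: "0 \<le> C2" "\<And>x. 2 * r0 \<le> norm x \<Longrightarrow> integrable lborel (\<lambda>\<theta>. k x \<theta> * norm (\<theta> - x))"
     "\<And>x. 2 * r0 \<le> norm x \<Longrightarrow> (LINT \<theta>|lborel. k x \<theta> * norm (\<theta> - x)) \<le> C2 * g x"
    using first_moment by blast
  obtain Cw where Cw: "1 \<le> Cw" "\<And>r. 0 \<le> r \<Longrightarrow> w (r / 2) \<le> Cw * w r" using w_half by blast
  obtain kw where kw: "0 < kw" "\<And>r. 0 \<le> r \<Longrightarrow> kw * (1 + r) powr (- 1 - e) \<le> w r" using w_lower[OF e_pos] by blast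
  have half: "norm (z /\<^sub>R 2) = norm z / 2" for z :: "real^'p" by simp
  define M where "M = (LINT y|lborel. \<phi> y)"
  define K0 where "K0 = (LINT \<theta>|lborel. k0 \<theta>)"
  have nonneg: "0 \<le> M" "0 \<le> K0" by (auto simp: M_def K0_def \<phi>_nonneg k0_nonneg intro!: integral_nonneg_AE)
  define E where "E = C2 * (2 * Cg)"
  define K where "K = real (n + 2) * Cw"
  define A where "A = (1 + E) * K * (2 + K) * Cg * M"
  define B where "B = (1 + E) * C1 * K0"
  \<comment> \<open>On the ball of radius \<open>R\<close> about \<open>x\<close> the cutoff is at
    least \<open>h i x / (1 + K * R)\<close>; the \<open>2 * Cg\<close> comes from
    \<open>mass_lower\<close>.\<close>
  define c where "c = 1 / ((1 + K * R)\<^sup>2 * (2 * Cg))"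
  \<comment> \<open>The factor \<open>2 powr (- 1 - e)\<close> comes from
    \<open>1 + norm x <= 2 * norm x\<close>.\<close>
  define k2 where "k2 = kg * (kw * 2 powr (- 1 - e))\<^sup>2"
  have E: "0 \<le> E" using C2(1) Cg by (simp add: E_def)
  have K: "0 \<le> K" using Cw by (simp add: K_def)
  have A: "0 \<le> A" and B: "0 \<le> B" using E K Cg nonneg C1(1) by (simp_all add: A_def B_def)
  have KR: "1 \<le> 1 + K * R" using K R(1) by simp
  have c: "0 < c" using KR Cg by (auto simp: c_def intro!: divide_pos_pos mult_pos_pos)
  have k2: "0 < k2" using kg kw(1) by (simp add: k2_def)
  define \<rho> where "\<rho> = max (2 * r0) (2 * R)"
  have main: "(LINT \<theta>|lborel. k x \<theta> * (h i \<theta>)\<^sup>2) * (norm (kernel_mean (k x) - kernel_mean (\<lambda>\<theta>. k x \<theta> * (h i \<theta>)\<^sup>2)))\<^sup>2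
    \<le> (2 * A\<^sup>2 / c + 2 * B\<^sup>2 / (c * k2)) * ((w (norm x))\<^sup>2 * g x + norm x powr (- p - 2 * e))"
    if x\<rho>: "\<rho> \<le> norm x" and kern: "kernel (k x)" for x i
  proof -
    interpret kernel "k x" by fact
    interpret wk: weighted_kernel "k x" "h i" by unfold_locales (auto simp: h_pos h_le_1)
    have x: "2 * r0 \<le> norm x" "2 * R \<le> norm x" "1 \<le> norm x" using x\<rho> r0 by (auto simp: \<rho>_def)
    define a where "a = h i x"
    define W where "W = w (norm x)"
    define T where "T = norm x powr (- p - 2 * e)"
    define I where "I = (LINT \<theta>|lborel. k x \<theta> * (h i \<theta>)\<^sup>2)"
    define N where "N = norm (kernel_mean (k x) - kernel_mean (\<lambda>\<theta>. k x \<theta> * (h i \<theta>)\<^sup>2))"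
    have W: "0 < W" "W \<le> a" "a \<le> 1" using w_pos[of "norm x"] w_le_h[of x i] h_le_1[of i x] by (auto simp: W_def a_def)
    have gx: "0 < g x" using x by (intro g_pos) auto
    have mass: "g x / (2 * Cg) \<le> (LINT \<theta>|lborel. k x \<theta>)"
      using mass_lower[OF R x(3,2), of "\<lambda>_. 1" 1] integrable_k by simp
    have mean: "norm (kernel_mean (k x) - x) \<le> E"
    proof (rule norm_mean_diff_le[OF C2(2)[OF x(1)]])
      have "C2 * g x = E * (g x / (2 * Cg))" using Cg by (simp add: E_def)
      also have "\<dots> \<le> E * (LINT \<theta>|lborel. k x \<theta>)" using E by (intro mult_left_mono mass)
      finally show "(LINT \<theta>|lborel. k x \<theta> * norm (\<theta> - x)) \<le> E * (LINT \<theta>|lborel. k x \<theta>)"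
        using C2(3)[OF x(1)] by simp
    qed
    have I: "c * g x * a\<^sup>2 \<le> I"
    proof -
      have "(a / (1 + K * R))\<^sup>2 \<le> (h i \<theta>)\<^sup>2" if \<theta>: "norm (x - \<theta>) \<le> R" for \<theta>
      proof -
        have n\<theta>: "norm \<theta> / 2 \<le> norm x"
          using norm_triangle_sub[of \<theta> x] \<theta> x by (simp add: norm_minus_commute)
        \<comment> \<open>Using \<open>\<theta> / 2\<close> rather than \<open>x / 2\<close> makes
          the Lipschitz constant a multiple of \<open>h i \<theta>\<close> itself, so that
          \<open>a <= h i \<theta> + K * R * h i \<theta>\<close> can be solved for
          \<open>h i \<theta>\<close>.\<close>
        have "\<bar>h i \<theta> - h i x\<bar> \<le> real (n + 2) * w (norm (\<theta> /\<^sub>R 2)) * norm (x - \<theta>)"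
          by (rule h_diff_le) (use n\<theta> in auto)
        also have "\<dots> \<le> real (n + 2) * (Cw * h i \<theta>) * R"
        proof (rule mult_mono[OF mult_left_mono])
          have "w (norm (\<theta> /\<^sub>R 2)) \<le> Cw * w (norm \<theta>)" unfolding half by (intro Cw(2)) simp
          also have "\<dots> \<le> Cw * h i \<theta>" using Cw(1) w_le_h by (intro mult_left_mono) auto
          finally show "w (norm (\<theta> /\<^sub>R 2)) \<le> Cw * h i \<theta>" .
          have "0 \<le> Cw * h i \<theta>" using Cw(1) h_pos[of i \<theta>] by (intro mult_nonneg_nonneg) auto
          then show "0 \<le> real (n + 2) * (Cw * h i \<theta>)" by (rule mult_nonneg_nonneg[rotated]) simp
        qed (simp_all add: \<theta>)
        finally have "a \<le> (1 + K * R) * h i \<theta>" unfolding a_def K_def by (simp add: algebra_simps)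
        then have "a / (1 + K * R) \<le> h i \<theta>" using KR by (simp add: divide_le_eq mult.commute)
        then show ?thesis using W KR by (intro power_mono) auto
      qed
      then have "(a / (1 + K * R))\<^sup>2 * g x / (2 * Cg) \<le> I"
        unfolding I_def by (intro mass_lower[OF R x(3,2)] wk.integrable_weighted) auto
      then show ?thesis by (simp add: c_def power_divide mult_ac)
    qed
    \<comment> \<open>The first summand covers parameters near \<open>x\<close>, the second the
      others. One factor \<open>a\<close> and one factor \<open>W\<close> are kept: squared and
      divided by the lower bound \<open>c * g x * a^2\<close> for the mass, they leave
      \<open>W^2 * g x\<close>.\<close>
    define U where "U \<theta> = ((1 + E) * K * (2 + K) * a * W * Cg * g x) * \<phi> (x - \<theta>) + ((1 + E) * C1 * T) * k0 \<theta>" for \<theta>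
    have U: "k x \<theta> * (norm (\<theta> - x) + E) * \<bar>(h i \<theta>)\<^sup>2 - a\<^sup>2\<bar> \<le> U \<theta>" for \<theta>
    proof -
      define y where "y = norm (x - \<theta>)"
      have y0: "0 \<le> y" by (simp add: y_def)
      have yE: "y + E \<le> (1 + E) * (1 + y)" using E y0 by (simp add: algebra_simps)
      show ?thesis
      proof (cases "y \<le> norm x / 2")
        case True
        have n\<theta>: "norm x / 2 \<le> norm \<theta>"
          using norm_triangle_sub[of x \<theta>] True by (simp add: y_def)
        have "\<bar>h i \<theta> - h i x\<bar> \<le> real (n + 2) * w (norm (x /\<^sub>R 2)) * norm (x - \<theta>)"
          by (rule h_diff_le) (use n\<theta> in auto)
        also have "\<dots> \<le> real (n + 2) * (Cw * W) * y"
          unfolding half W_def y_def by (intro mult_right_mono mult_left_mono Cw(2)) auto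
        finally have diff: "\<bar>h i \<theta> - a\<bar> \<le> K * W * y" by (simp add: K_def a_def mult_ac)
        have "\<bar>h i \<theta> + a\<bar> \<le> 2 * a + \<bar>h i \<theta> - a\<bar>" using W by simp
        \<comment> \<open>Here the floor enters through \<open>W <= a\<close>: the whole sum becomes
          a multiple of \<open>a\<close>.\<close>
        also have "\<dots> \<le> 2 * a + K * a * y"
          using diff mult_right_mono[OF mult_left_mono[OF W(2) K] y0] by simp
        also have "\<dots> \<le> (2 + K) * a * (1 + y)"
          using W K y0 by (simp add: algebra_simps)
        finally have sum: "\<bar>h i \<theta> + a\<bar> \<le> (2 + K) * a * (1 + y)" .
        have "\<bar>(h i \<theta>)\<^sup>2 - a\<^sup>2\<bar> = \<bar>h i \<theta> - a\<bar> * \<bar>h i \<theta> + a\<bar>"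
          by (simp add: abs_mult[symmetric] power2_eq_square algebra_simps)
        also have "\<dots> \<le> (K * W * (1 + y)) * ((2 + K) * a * (1 + y))"
        proof (intro mult_mono sum)
          have "K * W * y \<le> K * W * (1 + y)" using K W by (intro mult_left_mono) auto
          with diff show "\<bar>h i \<theta> - a\<bar> \<le> K * W * (1 + y)" by linarith
        qed (use K W y0 in auto)
        finally have "(y + E) * \<bar>(h i \<theta>)\<^sup>2 - a\<^sup>2\<bar> \<le> ((1 + E) * (1 + y)) * ((K * W * (1 + y)) * ((2 + K) * a * (1 + y)))"
          using yE y0 E by (intro mult_mono) auto
        also have "\<dots> = ((1 + E) * K * (2 + K) * a * W) * (1 + y) ^ 3"
          by (simp add: power3_eq_cube mult_ac)
        finally have "k x \<theta> * ((y + E) * \<bar>(h i \<theta>)\<^sup>2 - a\<^sup>2\<bar>) \<le> k x \<theta> * (((1 + E) * K * (2 + K) * a * W) * (1 + y) ^ 3)"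
          by (intro mult_left_mono k_nonneg)
        also have "\<dots> = ((1 + E) * K * (2 + K) * a * W) * ((1 + y) ^ 3 * k x \<theta>)" by (simp add: mult_ac)
        also have "\<dots> \<le> ((1 + E) * K * (2 + K) * a * W) * (Cg * g x * \<phi> (x - \<theta>))"
          using near_bound[OF x(3)] True E K W unfolding y_def by (intro mult_left_mono) auto
        also have "\<dots> \<le> U \<theta>"
          using E C1(1) k0_nonneg[of \<theta>] by (simp add: U_def T_def mult.assoc)
        finally show ?thesis by (simp add: y_def norm_minus_commute mult.assoc)
      next
        case False
        have "\<bar>(h i \<theta>)\<^sup>2 - a\<^sup>2\<bar> \<le> 1"
          using wk.h_sq[of \<theta>] power_le_one[of a 2] zero_le_power2[of a] W unfolding abs_le_iff by linarith
        then have "(y + E) * \<bar>(h i \<theta>)\<^sup>2 - a\<^sup>2\<bar> \<le> ((1 + E) * (1 + y)) * 1"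
          using yE y0 E by (intro mult_mono) auto
        then have "k x \<theta> * ((y + E) * \<bar>(h i \<theta>)\<^sup>2 - a\<^sup>2\<bar>) \<le> k x \<theta> * ((1 + E) * (1 + y) * 1)"
          by (intro mult_left_mono k_nonneg)
        also have "\<dots> = (1 + E) * ((1 + y) * k x \<theta>)" by (simp add: mult_ac)
        also have "\<dots> \<le> (1 + E) * (C1 * T * k0 \<theta>)"
          using C1(2)[OF x(1)] False E unfolding y_def T_def by (intro mult_left_mono) auto
        also have "\<dots> \<le> U \<theta>"
          using E K W Cg gx \<phi>_nonneg[of "x - \<theta>"] by (simp add: U_def mult.assoc)
        finally show ?thesis by (simp add: y_def norm_minus_commute mult.assoc)
      qed
    qed
    have int_U: "integrable lborel U"
      unfolding U_def[abs_def] using \<phi>_reflect_integrable[of x] k0_integrable by simp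
    have "I * N \<le> (LINT \<theta>|lborel. U \<theta>)"
      unfolding I_def N_def by (rule wk.mean_shift_le[OF mean int_U U])
    also have "\<dots> = A * a * W * g x + B * T"
      unfolding U_def A_def B_def M_def K0_def
      using \<phi>_reflect_integrable[of x] k0_integrable \<phi>_reflect_integral[of x] by (simp add: mult_ac)
    finally have IN: "I * N \<le> A * a * W * g x + B * T" .
    have I_pos: "0 < I" using wk.weighted.mass_pos by (simp add: I_def)
    have N0: "0 \<le> N" by (simp add: N_def)
    have T0: "0 \<le> T" by (simp add: T_def)
    have a0: "0 < a" using W by simp
    have den: "0 < c * g x * a\<^sup>2" using c gx a0 by simp
    \<comment> \<open>The available bound is on \<open>I * N\<close>, so the mass is bounded below
      only once, in the denominator.\<close>
    have "I * N\<^sup>2 = (I * N)\<^sup>2 / I" using I_pos by (simp add: power2_eq_square)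
    also have "\<dots> \<le> (A * a * W * g x + B * T)\<^sup>2 / (c * g x * a\<^sup>2)"
      using IN I I_pos N0 den by (intro frac_le power_mono) auto
    also have "\<dots> \<le> (2 * (A * a * W * g x)\<^sup>2 + 2 * (B * T)\<^sup>2) / (c * g x * a\<^sup>2)"
      using den zero_le_power2[of "A * a * W * g x - B * T"]
      by (intro divide_right_mono) (auto simp: power2_sum power2_diff)
    also have "\<dots> = (2 * A\<^sup>2 / c) * (W\<^sup>2 * g x) + (2 * B\<^sup>2 / c) * (T\<^sup>2 / (g x * a\<^sup>2))"
      using c gx a0 by (simp add: field_simps power2_eq_square)
    \<comment> \<open>The second use of the floor: \<open>g x * a^2\<close> is at least of order
      \<open>|x|\<close> to the power \<open>(2 - p) + 2 * (- 1 - e) = - p - 2 * e\<close>, which is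
      \<open>T\<close>, and one of the two factors \<open>T\<close> cancels.\<close>
    also have "T\<^sup>2 / (g x * a\<^sup>2) \<le> T / k2"
    proof -
      have "kw * 2 powr (- 1 - e) * norm x powr (- 1 - e) = kw * (2 * norm x) powr (- 1 - e)"
        by (simp add: powr_mult)
      also have "\<dots> \<le> kw * (1 + norm x) powr (- 1 - e)"
        using x(3) e_pos kw(1) by (intro mult_left_mono powr_mono2') auto
      also have "\<dots> \<le> a" using kw(2)[of "norm x"] W by (simp add: W_def)
      finally have "(kw * 2 powr (- 1 - e) * norm x powr (- 1 - e))\<^sup>2 \<le> a\<^sup>2"
        using kw(1) by (intro power_mono) auto
      then have "(kg * norm x powr (2 - p)) * (kw * 2 powr (- 1 - e) * norm x powr (- 1 - e))\<^sup>2 \<le> g x * a\<^sup>2"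
        using g_lower[OF x(3)] kg gx by (intro mult_mono) auto
      also have "(kg * norm x powr (2 - p)) * (kw * 2 powr (- 1 - e) * norm x powr (- 1 - e))\<^sup>2
          = k2 * (norm x powr (2 - p) * (norm x powr (- 1 - e) * norm x powr (- 1 - e)))"
        by (simp add: k2_def power2_eq_square mult_ac)
      also have "norm x powr (2 - p) * (norm x powr (- 1 - e) * norm x powr (- 1 - e)) = T"
        unfolding T_def by (simp only: powr_add[symmetric]) (simp add: algebra_simps)
      finally have "k2 * T \<le> g x * a\<^sup>2" .
      then have "k2 * T\<^sup>2 \<le> T * (g x * a\<^sup>2)"
        using mult_left_mono[OF _ T0] by (fastforce simp: power2_eq_square mult_ac)
      then show ?thesis using k2 gx a0 by (simp add: field_simps)
    qed
    then have "(2 * A\<^sup>2 / c) * (W\<^sup>2 * g x) + (2 * B\<^sup>2 / c) * (T\<^sup>2 / (g x * a\<^sup>2))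
        \<le> (2 * A\<^sup>2 / c) * (W\<^sup>2 * g x) + (2 * B\<^sup>2 / c) * (T / k2)"
      using c by (intro add_left_mono mult_left_mono) auto
    also have "\<dots> = (2 * A\<^sup>2 / c) * (W\<^sup>2 * g x) + (2 * B\<^sup>2 / (c * k2)) * T" by simp
    also have "\<dots> \<le> (2 * A\<^sup>2 / c + 2 * B\<^sup>2 / (c * k2)) * (W\<^sup>2 * g x + T)"
    proof -
      have "0 \<le> 2 * A\<^sup>2 / c" "0 \<le> 2 * B\<^sup>2 / (c * k2)" "0 \<le> W\<^sup>2 * g x" using c k2 gx by auto
      then have "0 \<le> (2 * A\<^sup>2 / c) * T" "0 \<le> (2 * B\<^sup>2 / (c * k2)) * (W\<^sup>2 * g x)"
        using T0 by (simp_all only: mult_nonneg_nonneg)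
      then show ?thesis by (simp only: distrib_left distrib_right)
    qed
    finally show ?thesis by (simp add: I_def N_def W_def T_def)
  qed
  have "0 \<le> 2 * A\<^sup>2 / c + 2 * B\<^sup>2 / (c * k2)" using c k2 by simp
  moreover have "r0 \<le> \<rho>" using r0 by (simp add: \<rho>_def)
  ultimately show ?thesis using main by blast
qed

theorem gen_bayes_admissible:
  assumes Q: "pos_def_matrix Q"
  shows "admissible f Q (gen_bayes f g)"
proof -
  obtain \<rho> C where \<rho>: "r0 \<le> \<rho>" and C: "0 \<le> C" and dom: "\<And>x i. \<rho> \<le> norm x \<Longrightarrow> kernel (k x) \<Longrightarrow>
      (LINT \<theta>|lborel. k x \<theta> * (h i \<theta>)\<^sup>2) * (norm (kernel_mean (k x) - kernel_mean (\<lambda>\<theta>. k x \<theta> * (h i \<theta>)\<^sup>2)))\<^sup>2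
      \<le> C * ((w (norm x))\<^sup>2 * g x + norm x powr (- p - 2 * e))"
    using domination by blast
  have [measurable]: "ball (0::real^'p) \<rho> \<in> sets borel" by simp
  \<comment> \<open>The power of \<open>norm x\<close> is not integrable at 0 and is therefore
    restricted to \<open>\<rho> <= norm x\<close>; the term with \<open>w\<close> is integrable
    everywhere.\<close>
  define Psi where "Psi x = (\<integral>\<^sup>+\<theta>. ennreal (k x \<theta> * (1 + (norm (x - \<theta>))\<^sup>2)) \<partial>lborel) * indicator (ball 0 \<rho>) x
    + ennreal C * (ennreal ((w (norm x))\<^sup>2 * g x) + ennreal (norm x powr (- p - 2 * e)) * indicator {\<rho>..} (norm x))" for x
  show ?thesis
  proof (rule blyth[OF Q, of h Psi])
    show "AE x in lborel. kernel (k x)" by (rule kernel_AE)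
    show Psi_m: "Psi \<in> borel_measurable borel"
      unfolding Psi_def[abs_def] by measurable
    have "(\<integral>\<^sup>+x. Psi x \<partial>lborel) = (\<integral>\<^sup>+x\<in>ball 0 \<rho>. (\<integral>\<^sup>+\<theta>. ennreal (k x \<theta> * (1 + (norm (x - \<theta>))\<^sup>2)) \<partial>lborel) \<partial>lborel)
      + ennreal C * ((\<integral>\<^sup>+x. ennreal ((w (norm x))\<^sup>2 * g x) \<partial>lborel) + (\<integral>\<^sup>+x. ennreal (norm (x::real^'p) powr (- p - 2 * e)) * indicator {\<rho>..} (norm x) \<partial>lborel))"
      unfolding Psi_def
      by (subst nn_integral_add, measurable, subst nn_integral_cmult, measurable, subst nn_integral_add, measurable)
    also have "\<dots> < \<infinity>"
      using local_second_moment_finite[OF \<rho>] g_w radial_tail_finite[of \<rho> "2 * e"] r0 \<rho> e_pos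
      by (simp add: ennreal_mult_less_top)
    finally show "(\<integral>\<^sup>+x. Psi x \<partial>lborel) < \<infinity>" .
    show "AE x in lborel. ennreal ((LINT \<theta>|lborel. k x \<theta> * (h i \<theta>)\<^sup>2) *
      (norm (kernel_mean (k x) - kernel_mean (\<lambda>\<theta>. k x \<theta> * (h i \<theta>)\<^sup>2)))\<^sup>2) \<le> Psi x" for i
      using kernel_AE
    proof eventually_elim
      case (elim x)
      show ?case
      proof (cases "norm x < \<rho>")
        case True
        interpret kernel "k x" by fact
        interpret wk: weighted_kernel "k x" "h i" by unfold_locales (auto simp: h_pos h_le_1)
        have "ennreal (I * N) \<le> (\<integral>\<^sup>+\<theta>. ennreal (k x \<theta> * (1 + (norm (x - \<theta>))\<^sup>2)) \<partial>lborel)"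
          if "ennreal (I * N) \<le> (\<integral>\<^sup>+\<theta>. ennreal (k x \<theta> * (norm (x - \<theta>))\<^sup>2) \<partial>lborel)" for I N
          by (rule order_trans[OF that])
             (intro nn_integral_mono ennreal_leI mult_left_mono k_nonneg, simp)
        from this[OF wk.mean_shift_sq_le] show ?thesis
          using True by (simp add: Psi_def add_increasing2)
      next
        case False
        then have "ennreal ((LINT \<theta>|lborel. k x \<theta> * (h i \<theta>)\<^sup>2) *
            (norm (kernel_mean (k x) - kernel_mean (\<lambda>\<theta>. k x \<theta> * (h i \<theta>)\<^sup>2)))\<^sup>2)
          \<le> ennreal (C * ((w (norm x))\<^sup>2 * g x + norm x powr (- p - 2 * e)))"
          by (intro ennreal_leI dom elim) simp
        also have "\<dots> = Psi x"
          using False C g_nonneg[of x] by (simp add: Psi_def ennreal_mult)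
        finally show ?thesis .
      qed
    qed
  qed (use prior_finite second_moment in \<open>auto intro: h_pos h_le_1 h_tendsto\<close>)
qed

end

text \<open>For \<open>n = 0\<close> the constant \<open>c\<close> is unconstrained, but then it does not occur in the prior.\<close>

lemma log_prior_normalize:
  assumes "iLog_defined n c" "0 < iLog n c"
  obtains c' where "log_prior n c'" "prior_profile p n c = prior_profile p n c'"
proof (cases "n = 0")
  case True
  have "log_prior n 1" by unfold_locales (simp add: True)
  moreover have "prior_profile p n c = prior_profile p n 1"
    by (rule ext) (simp add: True prior_profile_def iLog_def)
  ultimately show ?thesis by (rule that)
next
  case False
  have "log_prior n c"
  proof
    show "\<forall>j\<le>n. 0 < (ln ^^ j) c"
      using assms False by (auto simp: iLog_defined_def iLog_def le_less)
  qed
  then show ?thesis by (rule that) simp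
qed

text \<open>The surplus \<open>s - 3\<close> is cut into four equal parts: two give decay in
  \<open>x\<close>, two go to the prior, where one of them pays for its logarithms. With
  \<open>1 <= r0\<close>, larger exponents mean smaller powers throughout the tail.\<close>

lemma tail_exponent_normalize:
  assumes nonneg: "\<And>r. 0 \<le> r \<Longrightarrow> 0 \<le> f r"
    and F1: "\<exists>r0>0. \<exists>L>0. \<exists>s>3. \<forall>r\<ge>r0. r powr (p + s) * f r \<le> (L::real)"
  obtains r0 L e where "1 \<le> r0" "0 < L" "0 < e" "\<And>r. r0 \<le> r \<Longrightarrow> f r \<le> L * r powr (- p - 3 - 4 * e)"
proof -
  obtain r0 L s where F: "0 < r0" "0 < L" "3 < s" "\<And>r. r0 \<le> r \<Longrightarrow> r powr (p + s) * f r \<le> L"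
    using F1 by blast
  define e where "e = (s - 3) / 4"
  show ?thesis
  proof (rule that[of "max 1 r0" L e])
    fix r assume r: "max 1 r0 \<le> r"
    have "4 * e = s - 3" by (simp add: e_def)
    then have eq: "- p - 3 - 4 * e = - (p + s)" by simp
    have "0 < r powr (p + s)" using r by auto
    then show "f r \<le> L * r powr (- p - 3 - 4 * e)"
      unfolding eq powr_minus using F(4)[of r] r by (simp add: field_simps)
  qed (use F in \<open>auto simp: e_def\<close>)
qed

section \<open>From the Euclidean to the weighted prior\<close>

context log_prior
begin

text \<open>Norms within a factor 2 of each other give radii within a factor \<open>2 * D\<close>,
  whichever of the two norms is taken, so \<open>G_comparable\<close> applies. The first inequality
  makes the prior locally comparable; the other two, taken at \<open>x = \<theta>\<close>, carry
  integrability and lower bounds over from the Euclidean radial prior.\<close>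

lemma weighted_prior_comparable:
  fixes d :: "real^'p::finite"
  assumes d: "\<forall>i. 1 \<le> d $ i"
  shows "\<exists>C\<ge>1. \<forall>x \<theta>. x \<noteq> 0 \<longrightarrow> \<theta> \<noteq> 0 \<longrightarrow> norm \<theta> \<le> 2 * norm x \<longrightarrow> norm x \<le> 2 * norm \<theta> \<longrightarrow>
    G p (weighted_norm d \<theta>) \<le> C * G p (weighted_norm d x) \<and>
    G p (weighted_norm d \<theta>) \<le> C * G p (norm x) \<and> G p (norm \<theta>) \<le> C * G p (weighted_norm d x)"
proof -
  define D where "D = (\<Sum>i\<in>UNIV. d $ i)"
  have D: "1 \<le> D"
    using member_le_sum[of undefined UNIV "\<lambda>i. d $ i"] d order_trans[OF zero_le_one]
    unfolding D_def by (metis (no_types, lifting) UNIV_I finite order_trans)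
  obtain C where C: "1 \<le> C" "\<And>x y. 0 < x \<Longrightarrow> 0 < y \<Longrightarrow> y \<le> (2 * D) * x \<Longrightarrow> x \<le> (2 * D) * y \<Longrightarrow> G p y \<le> C * G p x"
    using G_comparable[of "2 * D" p] D by auto
  have wn: "norm x \<le> weighted_norm d x" "weighted_norm d x \<le> D * norm x" for x
    using norm_le_weighted_norm[OF d] weighted_norm_le[OF d] by (auto simp: D_def)
  have le: "a \<le> (2 * D) * b" if "a \<le> D * u" "u \<le> 2 * v" "v \<le> b" for a b u v
  proof -
    have "a \<le> D * (2 * b)" using that D by (intro order_trans[OF that(1)] mult_left_mono) auto
    then show ?thesis by simp
  qed
  have self: "norm x \<le> D * norm x" for x :: "real^'p" using D by (simp add: mult_le_cancel_right1)
  show ?thesis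
  proof (intro exI[of _ C] conjI allI impI C(1))
    fix x \<theta> :: "real^'p"
    assume nz: "x \<noteq> 0" "\<theta> \<noteq> 0" and n: "norm \<theta> \<le> 2 * norm x" "norm x \<le> 2 * norm \<theta>"
    have pos: "0 < norm x" "0 < norm \<theta>" "0 < weighted_norm d x" "0 < weighted_norm d \<theta>"
      using nz wn(1)[of x] wn(1)[of \<theta>] by (auto intro: less_le_trans[OF _ wn(1)])
    show "G p (weighted_norm d \<theta>) \<le> C * G p (weighted_norm d x)"
      using pos by (intro C(2) le[OF wn(2) n(1) wn(1)] le[OF wn(2) n(2) wn(1)])
    show "G p (weighted_norm d \<theta>) \<le> C * G p (norm x)"
      using pos by (intro C(2) le[OF wn(2) n(1) order_refl] le[OF self n(2) wn(1)])
    show "G p (norm \<theta>) \<le> C * G p (weighted_norm d x)"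
      using pos by (intro C(2) le[OF self n(1) wn(1)] le[OF wn(2) n(2) order_refl])
  qed
qed

end

theorem corollary3p2:
  fixes f :: "real \<Rightarrow> real"
    and Q :: "real^'p::{finite,linorder}^'p::{finite,linorder}"
    and d :: "real^'p::{finite,linorder}"
    and n :: nat and c :: real
  defines "p \<equiv> CARD('p)"
  defines "G \<equiv> prior_profile p n c"
  assumes density: "location_density TYPE('p) f"
    and Q: "pos_def_matrix Q"
    and d_decreasing: "\<forall>i j. i \<le> j \<longrightarrow> d $ j \<le> d $ i"
    and d_ge_1: "\<forall>i. 1 \<le> d $ i"
    and c: "iLog_defined n c" "0 < iLog n c"
    and F1: "\<exists>r0>0. \<exists>L>0. \<exists>s>3. \<forall>r\<ge>r0. r powr (real p + s) * f r \<le> L"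
    and FG1: "(\<integral>\<^sup>+ r\<in>{0<..}. ennreal (r ^ (p - 1) * f r * G r) \<partial>lborel) < \<infinity>"
      "(\<integral>\<^sup>+ r\<in>{0<..}. ennreal (r powi (int p - 2)) * tail_fun f r * ennreal (G r) \<partial>lborel) < \<infinity>"
  shows "admissible f Q (gen_bayes f (\<lambda>\<theta>. G (weighted_norm d \<theta>)))"
proof -
  obtain c' where c': "log_prior n c'" "G = prior_profile p n c'"
    using log_prior_normalize[OF c, of p] unfolding G_def by blast
  interpret log_prior n c' by (rule c')
  obtain b where b: "c' \<le> b" "log_scale n b" using log_scale_exists by blast
  interpret ls: log_scale n b by (rule b)
  have "0 \<le> f r" if "0 \<le> r" for r using density that by (simp add: location_density_def)
  then obtain r0 L e where tail: "1 \<le> r0" "0 < L" "0 < e" "\<And>r. r0 \<le> r \<Longrightarrow> f r \<le> L * r powr (- real p - 3 - 4 * e)"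
    using tail_exponent_normalize[OF _ F1] by blast
  define g where "g \<theta> = G (weighted_norm d \<theta>)" for \<theta>
  obtain C where C: "1 \<le> C" "\<And>x \<theta>. x \<noteq> 0 \<Longrightarrow> \<theta> \<noteq> 0 \<Longrightarrow> norm \<theta> \<le> 2 * norm x \<Longrightarrow> norm x \<le> 2 * norm \<theta> \<Longrightarrow>
    g \<theta> \<le> C * g x \<and> g \<theta> \<le> C * G (norm x) \<and> G (norm \<theta>) \<le> C * g x"
    using weighted_prior_comparable[OF d_ge_1, of p] unfolding g_def c'(2) by blast
  obtain kg where kg: "0 < kg" "\<And>r. 0 < r \<Longrightarrow> kg * r powr (2 - real p) \<le> G r"
    using G_lower[of p] unfolding c'(2) by blast
  have [measurable]: "G \<in> borel_measurable borel" unfolding c'(2) by measurable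
  have g_m [measurable]: "g \<in> borel_measurable borel" unfolding g_def[abs_def] by measurable
  have wn0: "0 \<le> weighted_norm d \<theta>" for \<theta>
    using norm_le_weighted_norm[OF d_ge_1, of \<theta>] norm_ge_zero order_trans by blast
  have g_nonneg: "0 \<le> g \<theta>" for \<theta>
    unfolding g_def c'(2) by (intro G_nonneg wn0)
  have g_le: "ennreal (u * g \<theta>) \<le> ennreal C * ennreal (u * G (norm \<theta>))" if "\<theta> \<noteq> 0" "0 \<le> u" for u \<theta>
  proof -
    have "u * g \<theta> \<le> u * (C * G (norm \<theta>))" using C(2)[of \<theta> \<theta>] that by (intro mult_left_mono) auto
    also have "\<dots> = C * (u * G (norm \<theta>))" by simp
    finally show ?thesis using C(1) by (simp add: ennreal_mult'[symmetric] ennreal_leI)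
  qed
  have finite_transfer: "(\<integral>\<^sup>+\<theta>. ennreal (u (norm \<theta>) * g \<theta>) \<partial>lborel) < \<infinity>"
    if [measurable]: "u \<in> borel_measurable borel" and u: "\<And>r. 0 \<le> r \<Longrightarrow> 0 \<le> u r"
      and fin: "(\<integral>\<^sup>+\<theta>. ennreal (u (norm \<theta>) * G (norm (\<theta> :: (real, 'p) vec))) \<partial>lborel) < \<infinity>" for u
  proof -
    have "(\<integral>\<^sup>+\<theta>. ennreal (u (norm \<theta>) * g \<theta>) \<partial>lborel) \<le> (\<integral>\<^sup>+\<theta>. ennreal C * ennreal (u (norm \<theta>) * G (norm (\<theta> :: (real, 'p) vec))) \<partial>lborel)"
      \<comment> \<open>The origin, where \<open>G\<close> may have a dummy value, is discarded as a
        null set.\<close>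
      by (rule nn_integral_mono_AE, rule AE_mp[OF AE_lborel_singleton[of 0]])
         (auto intro!: AE_I2 g_le u)
    also have "\<dots> = ennreal C * (\<integral>\<^sup>+\<theta>. ennreal (u (norm \<theta>) * G (norm (\<theta> :: (real, 'p) vec))) \<partial>lborel)"
      by (rule nn_integral_cmult) measurable
    also have "\<dots> < \<infinity>" using fin by (simp add: ennreal_mult_less_top)
    finally show ?thesis .
  qed
  have tm: "tail_model f g n b (real p) r0 L e C (kg / C)"
  proof (unfold_locales)
    show "0 < g \<theta>" if "\<theta> \<noteq> 0" for \<theta>
      unfolding g_def c'(2) using that norm_le_weighted_norm[OF d_ge_1, of \<theta>]
      by (intro G_pos) (auto intro: less_le_trans[of 0 "norm \<theta>"])
    show "g \<theta> \<le> C * g x \<and> g x \<le> C * g \<theta>" if "1 \<le> norm x" "norm (x - \<theta>) \<le> norm x / 2" for x \<theta>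
    proof -
      have n: "norm x \<le> 2 * norm \<theta>" "norm \<theta> \<le> 2 * norm x"
        using norm_triangle_sub[of x \<theta>] norm_triangle_sub[of \<theta> x] that by (auto simp: norm_minus_commute)
      then have "x \<noteq> 0" "\<theta> \<noteq> 0" using that by auto
      with n show ?thesis using C(2)[of x \<theta>] C(2)[of \<theta> x] by auto
    qed
    show "kg / C * norm x powr (2 - real p) \<le> g x" if "1 \<le> norm x" for x
    proof -
      have "kg * norm x powr (2 - real p) \<le> C * g x"
        using kg(2)[of "norm x"] C(2)[of x x] that by force
      then show ?thesis using C(1) by (simp add: field_simps)
    qed
    show "0 < kg / C" using kg(1) C(1) by simp
    show "(\<integral>\<^sup>+\<theta>. ennreal (max 1 (norm \<theta>) powr (- 2 - 2 * e) * g \<theta>) \<partial>lborel) < \<infinity>"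
      using G_tail_finite[OF tail(3), where 'a="(real, 'p) vec"]
      by (intro finite_transfer[of "\<lambda>r. max 1 r powr (- 2 - 2 * e)"]) (auto simp: p_def c'(2))
    show "(\<integral>\<^sup>+\<theta>. ennreal ((ls.w (norm \<theta>))\<^sup>2 * g \<theta>) \<partial>lborel) < \<infinity>"
      using G_w_square_finite[OF b(2,1), where 'a="(real, 'p) vec"]
      by (intro finite_transfer[of "\<lambda>r. (ls.w r)\<^sup>2"]) (auto simp: p_def c'(2))
  qed (use density g_m g_nonneg tail C(1) in \<open>auto simp: p_def\<close>)
  have "admissible f Q (gen_bayes f g)" using tail_model.gen_bayes_admissible[OF tm Q] .
  then show ?thesis by (simp add: g_def[abs_def])
qed

end
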